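(* Let $d,m,n$ be positive integers with $d=m+n$ and $d\geq 3$. Let $\psi:[1,\infty)\to(0,\infty)$ be a continuous and non-increasing function with $\sum_{t=1}^{\infty}\psi(t)=\infty$. Let $\boldsymbol{v}\in\mathbb{Z}^d$ and let $N\geq 1$ be an integer. Let $\nu_1$ and $\nu_2$ be norms on $\mathbb{R}^m$ and $\mathbb{R}^n$ respectively, with $\nu_2$ normalized such that $\min_{\boldsymbol{w}\in\mathbb{Z}^n\setminus\{\boldsymbol{0}\}}\nu_2(\boldsymbol{w})=1$. For $\vartheta\in\mathrm{M}_{m\times n}(\mathbb{R})$ and $T>1$, let $\mathcal{N}(\vartheta,T)$ denote the number of $(\boldsymbol{p},\boldsymbol{q})\in\mathbb{Z}^m\times\mathbb{Z}^n$ satisfying $$\nu_1(\vartheta\boldsymbol{q}+\boldsymbol{p})^m<\psi(\nu_2(\boldsymbol{q})^n),\qquad (\boldsymbol{p},\boldsymbol{q})\equiv\boldsymbol{v}\pmod N,\qquad 1\leq\nu_2(\boldsymbol{q})^n<T.$$ Then for almost every $\vartheta\in\mathrm{M}_{m\times n}(\mathbb{R})$ (with respect to Lebesgue measure), $$\mathcal{N}(\vartheta,T)\ \sim\ N^{-d}c_{\nu_1}c_{\nu_2}\sum_{1\leq t<T}\psi(t)\qquad\text{as } T\to\infty,$$ where for $i=1,2$, $c_{\nu_i}$ is the volume (Lebesgue measure) of the unit ball with respect to $\nu_i$.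
   Context: $\mathrm{M}_{m\times n}(\mathbb{R})\cong\mathbb{R}^{mn}$ is the space of real $m\times n$ matrices. Vectors are column vectors, and $(\boldsymbol{p},\boldsymbol{q})\in\mathbb{Z}^m\times\mathbb{Z}^n$ is identified with an element of $\mathbb{Z}^d$; the congruence $(\boldsymbol{p},\boldsymbol{q})\equiv\boldsymbol{v}\pmod N$ is coordinatewise. The sum $\sum_{1\leq t<T}\psi(t)$ is over integers $t$. $f(T)\sim g(T)$ means $f(T)/g(T)\to 1$ as $T\to\infty$. *)

theory Defs
  imports
    "HOL-Analysis.Analysis"
    "HOL-Library.Landau_Symbols"
    "HOL-Number_Theory.Cong"
begin

definition is_norm :: "('a::real_vector \<Rightarrow> real) \<Rightarrow> bool" where
  "is_norm \<nu> \<longleftrightarrow>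
     (\<forall>x. \<nu> x \<ge> 0) \<and>
     (\<forall>x. \<nu> x = 0 \<longleftrightarrow> x = 0) \<and>
     (\<forall>c x. \<nu> (c *\<^sub>R x) = \<bar>c\<bar> * \<nu> x) \<and>
     (\<forall>x y. \<nu> (x + y) \<le> \<nu> x + \<nu> y)"

definition unit_ball_volume :: "('a::euclidean_space \<Rightarrow> real) \<Rightarrow> real" where
  "unit_ball_volume \<nu> = measure lebesgue {x. \<nu> x \<le> 1}"

definition real_vec :: "int ^ 'k \<Rightarrow> real ^ 'k" where
  "real_vec w = (\<chi> i. real_of_int (w $ i))"

text \<open>
  The identification of a pair \<open>(p, q)\<close> with one vector of length \<open>m + n\<close>; the coordinates
  of the latter are indexed by the sum type, so that \<open>CARD('m + 'n) = CARD('m) + CARD('n)\<close>.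
\<close>

definition concat_vec :: "'a ^ 'm \<Rightarrow> 'a ^ 'n \<Rightarrow> 'a ^ ('m + 'n)" where
  "concat_vec p q = (\<chi> k. case k of Inl i \<Rightarrow> p $ i | Inr j \<Rightarrow> q $ j)"

definition vec_cong :: "int ^ 'k \<Rightarrow> int ^ 'k \<Rightarrow> nat \<Rightarrow> bool" where
  "vec_cong x y N \<longleftrightarrow> (\<forall>k. [x $ k = y $ k] (mod int N))"

text \<open>
  The type \<open>real ^ 'n ^ 'm\<close> has \<open>CARD('m)\<close> rows and \<open>CARD('n)\<close> columns.
\<close>

definition solutions ::
  "(real ^ 'm \<Rightarrow> real) \<Rightarrow> (real ^ 'n \<Rightarrow> real) \<Rightarrow> (real \<Rightarrow> real) \<Rightarrow> int ^ ('m + 'n) \<Rightarrow> nat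
    \<Rightarrow> real ^ 'n ^ 'm \<Rightarrow> real \<Rightarrow> ((int ^ 'm) \<times> (int ^ 'n)) set" where
  "solutions \<nu>\<^sub>1 \<nu>\<^sub>2 \<psi> v N \<theta> T = {(p, q).
     \<nu>\<^sub>1 (\<theta> *v real_vec q + real_vec p) ^ CARD('m) < \<psi> (\<nu>\<^sub>2 (real_vec q) ^ CARD('n)) \<and>
     vec_cong (concat_vec p q) v N \<and>
     1 \<le> \<nu>\<^sub>2 (real_vec q) ^ CARD('n) \<and> \<nu>\<^sub>2 (real_vec q) ^ CARD('n) < T}"

text \<open>
  If \<open>\<nu>\<^sub>1\<close> and \<open>\<nu>\<^sub>2\<close> are norms, the set of solutions is finite: the last condition leaves
  finitely many \<open>q\<close>, and for each of them the first one leaves finitely many \<open>p\<close>.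
  Hence \<open>card\<close> does not return its default value for infinite sets.
\<close>

definition solution_count ::
  "(real ^ 'm \<Rightarrow> real) \<Rightarrow> (real ^ 'n \<Rightarrow> real) \<Rightarrow> (real \<Rightarrow> real) \<Rightarrow> int ^ ('m + 'n) \<Rightarrow> nat
    \<Rightarrow> real ^ 'n ^ 'm \<Rightarrow> real \<Rightarrow> nat" where
  "solution_count \<nu>\<^sub>1 \<nu>\<^sub>2 \<psi> v N \<theta> T = card (solutions \<nu>\<^sub>1 \<nu>\<^sub>2 \<psi> v N \<theta> T)"

end

theory Submission
  imports Defs "HOL-Real_Asymp.Real_Asymp"
begin

text \<open>
  For a denominator \<open>q\<close> let \<open>X\<^sub>q(\<theta>)\<close> be the number of admissible numerators \<open>p\<close>. As a function of \<open>\<theta>\<close> it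
  is periodic modulo \<open>N\<close>, and its mean over a period is \<open>c\<^sub>1 N\<^sup>-\<^sup>m \<psi>(\<nu>\<^sub>2(q)\<^sup>n)\<close>. The number of solutions
  is the sum of the \<open>X\<^sub>q\<close> over \<open>\<nu>\<^sub>2(q)\<^sup>n < T\<close> and \<open>q\<close> in a residue class. Counting lattice points in dilated
  balls and summing by parts shows that the mean of this sum is asymptotic to the claimed main term
  (\<open>mean_count_asymp\<close>). What remains is that the sum is almost surely asymptotic to its mean, which
  follows from a bound for its variance.
  
  All correlations come from one principle: the mean of a periodic function of \<open>\<theta>\<close> does not change under
  translations, in particular not under \<open>\<theta> \<mapsto> \<theta> + y w\<^sup>T\<close>, which moves \<open>\<theta> q\<close> by \<open>(w \<bullet> q) y\<close>.
  If \<open>q\<close> and \<open>q'\<close> are linearly independent, some \<open>w\<close> orthogonal to \<open>q'\<close> is not orthogonal to \<open>q\<close>;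
  averaging over \<open>y\<close> randomises \<open>\<theta> q\<close> while \<open>\<theta> q'\<close> stays fixed, so \<open>X\<^sub>q\<close> and \<open>X\<^sub>q\<^sub>'\<close> are uncorrelated
  (\<open>torus_mean_independent\<close>).
  If \<open>q = a s\<close> and \<open>q' = b s\<close> with \<open>a\<close>, \<open>b\<close> coprime, take \<open>w \<bullet> s = 1\<close> and \<open>y = j / a\<close> with \<open>j\<close> in \<open>N \<int>\<^sup>m\<close>. Then
  \<open>\<theta> q\<close> moves by a period, while \<open>\<theta> q'\<close> moves by \<open>(b / a) j\<close>. Averaging over the \<open>a\<^sup>m\<close> classes of \<open>j\<close> turns
  \<open>X\<^sub>q\<^sub>'\<close> into a count of points of the finer lattice \<open>(N / a) \<int>\<^sup>m\<close> in a ball of radius \<open>\<rho>\<close>, which is at most the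
  volume of a ball of radius \<open>\<rho> + O(1 / a)\<close> divided by the covolume (\<open>torus_mean_parallel\<close>). For every
  \<open>0 < \<delta> \<le> 1\<close> the resulting bound exceeds the uncorrelated value by a relative error \<open>O(\<delta>)\<close> plus an
  absolute one of order \<open>\<psi>(\<nu>\<^sub>2(q)\<^sup>n) / (\<delta> a)\<^sup>m\<close>.
  
  Summing the last term over all parallel pairs with \<open>\<bar>b\<bar> \<le> a\<close>, there are \<open>O(a)\<close> values of \<open>b\<close>, and the sum
  over \<open>s\<close> is \<open>O(a\<^sup>-\<^sup>n)\<close> times \<open>\<Psi>(K) = \<psi>(1) + \<dots> + \<psi>(K)\<close> because \<open>\<psi>\<close> is non-increasing. The total is
  \<open>O(\<delta>\<^sup>-\<^sup>m \<Psi>(K))\<close> times the sum of \<open>a\<^sup>1\<^sup>-\<^sup>d\<close>, and this series converges since \<open>d \<ge> 3\<close> (\<open>triple_sum_le\<close>). Hence the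
  variance is \<open>O(\<delta> \<Psi>(K)\<^sup>2 + \<delta>\<^sup>-\<^sup>m \<Psi>(K))\<close>. Along integers \<open>K\<^sub>j\<close> where \<open>\<Psi>\<close> first reaches \<open>j\<^sup>2\<^sup>m\<^sup>+\<^sup>2\<close>, the choice
  \<open>\<delta> = j\<^sup>-\<^sup>2\<close> makes the relative variances summable, which gives convergence almost everywhere along
  \<open>K\<^sub>j\<close>. Since \<open>\<Psi>(K\<^sub>j\<^sub>+\<^sub>1) / \<Psi>(K\<^sub>j)\<close> tends to \<open>1\<close> and the counts are monotone, the gaps between the \<open>K\<^sub>j\<close> do not matter
  (\<open>tendsto_along_powers\<close>).
\<close>

section \<open>Averages over a fundamental cell of a cubic lattice\<close>

definition grid :: "real \<Rightarrow> 'a::euclidean_space set" where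
  "grid h = {x. \<forall>b\<in>Basis. x \<bullet> b / h \<in> \<int>}"

definition cell :: "real \<Rightarrow> 'a::euclidean_space set" where
  "cell h = {x. \<forall>b\<in>Basis. 0 \<le> x \<bullet> b \<and> x \<bullet> b < h}"

text \<open>
  The Haar probability measure of the quotient by \<open>grid h\<close>, realised on the ambient space: a function on
  the quotient is a periodic function, and only its values on the half-open cell are seen.
\<close>

definition torus :: "real \<Rightarrow> 'a::euclidean_space measure" where
  "torus h = uniform_measure lborel (cell h)"

definition periodic :: "real \<Rightarrow> ('a::euclidean_space \<Rightarrow> 'b) \<Rightarrow> bool" where
  "periodic h H \<longleftrightarrow> (\<forall>x. \<forall>l\<in>grid h. H (x + l) = H x)"

text \<open>
  Extended non-negative values keep the sum over the lattice meaningful without any convergence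
  hypothesis. For the indicator of a set, \<open>periodize\<close> counts the points of the translated lattice \<open>x + grid h\<close> in it.
\<close>

definition periodize :: "real \<Rightarrow> ('a::euclidean_space \<Rightarrow> ennreal) \<Rightarrow> 'a \<Rightarrow> ennreal" where
  "periodize h g x = (\<integral>\<^sup>+l. g (x + l) \<partial>count_space (grid h))"

lemma grid_add: "l \<in> grid h \<Longrightarrow> k \<in> grid h \<Longrightarrow> l + k \<in> grid h"
  by (auto simp: grid_def inner_add_left add_divide_distrib)

lemma grid_uminus: "l \<in> grid h \<Longrightarrow> - l \<in> grid h"
  by (auto simp: grid_def)

lemma grid_diff: "l \<in> grid h \<Longrightarrow> k \<in> grid h \<Longrightarrow> l - k \<in> grid h"
  using grid_add[of l h "- k"] grid_uminus[of k h] by simp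

lemma countable_grid:
  assumes "h > 0"
  shows "countable (grid h :: 'a::euclidean_space set)"
proof -
  have "inj_on (\<lambda>x::'a. restrict (\<lambda>b. x \<bullet> b / h) Basis) (grid h)"
  proof (rule inj_onI)
    fix x y :: 'a
    assume eq: "restrict (\<lambda>b. x \<bullet> b / h) Basis = restrict (\<lambda>b. y \<bullet> b / h) Basis"
    show "x = y"
    proof (rule euclidean_eqI)
      fix b :: 'a assume "b \<in> Basis"
      with fun_cong[OF eq, of b] assms show "x \<bullet> b = y \<bullet> b" by simp
    qed
  qed
  moreover have sub: "(\<lambda>x::'a. restrict (\<lambda>b. x \<bullet> b / h) Basis) ` grid h \<subseteq> PiE Basis (\<lambda>_. \<int>)"
    by (auto simp: grid_def)
  moreover have "countable (PiE (Basis::'a set) (\<lambda>_. \<int>::real set))"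
    by (rule countable_PiE) (auto simp: Ints_def)
  ultimately show ?thesis
    by (intro countable_image_inj_on[OF countable_subset[OF sub]])
qed

lemma cell_sets[measurable]: "cell h \<in> sets borel"
  unfolding cell_def by measurable

lemma emeasure_cell:
  assumes "h > 0"
  shows "emeasure lborel (cell h :: 'a::euclidean_space set) = ennreal (h ^ DIM('a))"
proof -
  let ?u = "h *\<^sub>R One :: 'a"
  have "emeasure lborel (box 0 ?u) \<le> emeasure lborel (cell h :: 'a set)"
    by (rule emeasure_mono) (auto simp: cell_def box_def)
  moreover have "emeasure lborel (cell h :: 'a set) \<le> emeasure lborel (cbox 0 ?u)"
    by (rule emeasure_mono) (auto simp: cell_def cbox_def)
  ultimately show ?thesis
    using assms by (simp add: emeasure_lborel_box_eq emeasure_lborel_cbox_eq)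
qed

text \<open>
  The translates of the cell tile the space: the only lattice vector that brings \<open>x\<close> into the cell
  rounds every coordinate down to a multiple of \<open>h\<close>.
\<close>

lemma cell_tiling:
  assumes "h > 0"
  shows "(\<integral>\<^sup>+l. indicator (cell h) (x + l :: 'a::euclidean_space) \<partial>count_space (grid h)) = 1"
proof -
  define l0 where "l0 = - (\<Sum>b\<in>Basis. (h * of_int \<lfloor>x \<bullet> b / h\<rfloor>) *\<^sub>R b)"
  have l0b: "l0 \<bullet> b = - (h * of_int \<lfloor>x \<bullet> b / h\<rfloor>)" if "b \<in> Basis" for b
    using that by (simp add: l0_def)
  have l0: "l0 \<in> grid h" using assms by (auto simp: grid_def l0b)
  have iff: "x + l \<in> cell h \<longleftrightarrow> l = l0" if l: "l \<in> grid h" for l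
  proof
    assume "x + l \<in> cell h"
    hence *: "0 \<le> x \<bullet> b + l \<bullet> b" "x \<bullet> b + l \<bullet> b < h" if "b \<in> Basis" for b
      using that by (auto simp: cell_def inner_add_left)
    show "l = l0"
    proof (rule euclidean_eqI)
      fix b :: 'a assume b: "b \<in> Basis"
      from l b obtain z where z: "l \<bullet> b / h = of_int z" by (auto simp: grid_def elim!: Ints_cases)
      hence z': "l \<bullet> b = h * of_int z" using assms by (simp add: field_simps)
      have "\<lfloor>x \<bullet> b / h\<rfloor> = - z"
        using *[OF b] assms by (simp add: floor_eq_iff z' field_simps)
      thus "l \<bullet> b = l0 \<bullet> b" by (simp add: l0b[OF b] z')
    qed
  next
    assume "l = l0"
    thus "x + l \<in> cell h"
      using assms floor_divide_lower[OF assms] floor_divide_upper[OF assms]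
      by (auto simp: cell_def inner_add_left l0b algebra_simps)
  qed
  have "(\<integral>\<^sup>+l. indicator (cell h) (x + l) \<partial>count_space (grid h))
      = (\<integral>\<^sup>+l. indicator {l0} l \<partial>count_space (grid h))"
    by (rule nn_integral_cong) (auto simp: iff split: split_indicator)
  also have "\<dots> = 1" using l0 by simp
  finally show ?thesis .
qed

lemma nn_integral_lborel_shift:
  fixes f :: "'a::euclidean_space \<Rightarrow> ennreal"
  assumes [measurable]: "f \<in> borel_measurable borel"
  shows "(\<integral>\<^sup>+x. f (x + t) \<partial>lborel) = (\<integral>\<^sup>+x. f x \<partial>lborel)"
proof -
  have "(\<integral>\<^sup>+x. f x \<partial>lborel) = (\<integral>\<^sup>+x. f x \<partial>distr lborel borel ((+) t))"
    by (simp add: lborel_distr_plus)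
  also have "\<dots> = (\<integral>\<^sup>+x. f (x + t) \<partial>lborel)"
    by (subst nn_integral_distr) (auto simp: add.commute)
  finally show ?thesis ..
qed

lemma nn_integral_grid_shift:
  fixes g :: "'a::euclidean_space \<Rightarrow> ennreal"
  assumes "k \<in> grid h"
  shows "(\<integral>\<^sup>+l. g (l + k) \<partial>count_space (grid h)) = (\<integral>\<^sup>+l. g l \<partial>count_space (grid h))"
proof (rule nn_integral_bij_count_space)
  show "bij_betw (\<lambda>l. l + k) (grid h) (grid h)"
    by (rule bij_betwI[where g="\<lambda>l. l - k"]) (use assms in \<open>auto intro: grid_add grid_diff\<close>)
qed

lemma nn_integral_grid_uminus:
  fixes g :: "'a::euclidean_space \<Rightarrow> ennreal"
  shows "(\<integral>\<^sup>+l. g (- l) \<partial>count_space (grid h)) = (\<integral>\<^sup>+l. g l \<partial>count_space (grid h))"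
proof (rule nn_integral_bij_count_space)
  show "bij_betw uminus (grid h) (grid h :: 'a set)"
    by (rule bij_betwI[where g="uminus"]) (auto intro: grid_uminus)
qed

lemma measurable_periodize[measurable]:
  fixes g :: "'a::euclidean_space \<Rightarrow> ennreal"
  assumes h: "h > 0" and [measurable]: "g \<in> borel_measurable borel"
  shows "periodize h g \<in> borel_measurable borel"
proof -
  interpret sigma_finite_measure "count_space (grid h :: 'a set)"
    by (rule sigma_finite_measure_count_space_countable[OF countable_grid[OF h]])
  have "(\<lambda>(x, l). g (x + l)) \<in> borel_measurable (borel \<Otimes>\<^sub>M count_space (grid h))"
    using measurable_compose_countable'[where I="grid h" and g=snd and f="\<lambda>l p. g (fst p + l)"
        and M="borel \<Otimes>\<^sub>M count_space (grid h)" and N=borel] countable_grid[OF h]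
    by (simp add: case_prod_beta')
  from borel_measurable_nn_integral[OF this] show ?thesis
    unfolding periodize_def[abs_def] by simp
qed

lemma periodic_periodize: "periodic h (periodize h g)"
  unfolding periodic_def
proof (intro allI ballI)
  fix x k :: 'a assume k: "k \<in> grid h"
  have "periodize h g (x + k) = (\<integral>\<^sup>+l. g (x + (l + k)) \<partial>count_space (grid h))"
    unfolding periodize_def
    by (intro nn_integral_cong arg_cong[where f=g]) (simp add: algebra_simps)
  also have "\<dots> = periodize h g x"
    unfolding periodize_def by (rule nn_integral_grid_shift[OF k])
  finally show "periodize h g (x + k) = periodize h g x" .
qed

text \<open>
  Unfolding: the translates of the cell, over which the sum runs, together make up the whole space.
\<close>

lemma cell_unfold:
  fixes g :: "'a::euclidean_space \<Rightarrow> ennreal"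
  assumes h: "h > 0" and [measurable]: "g \<in> borel_measurable borel"
  shows "(\<integral>\<^sup>+x. periodize h g x * indicator (cell h) x \<partial>lborel) = (\<integral>\<^sup>+x. g x \<partial>lborel)"
proof -
  have "(\<integral>\<^sup>+x. periodize h g x * indicator (cell h) x \<partial>lborel)
      = (\<integral>\<^sup>+x. (\<integral>\<^sup>+l. g (x + l) * indicator (cell h) x \<partial>count_space (grid h)) \<partial>lborel)"
    unfolding periodize_def by (subst nn_integral_multc) auto
  also have "\<dots> = (\<integral>\<^sup>+l. (\<integral>\<^sup>+x. g (x + l) * indicator (cell h) x \<partial>lborel) \<partial>count_space (grid h))"
    by (rule nn_integral_count_space_nn_integral) (auto simp: countable_grid[OF h])
  also have "\<dots> = (\<integral>\<^sup>+l. (\<integral>\<^sup>+x. g x * indicator (cell h) (x + - l) \<partial>lborel) \<partial>count_space (grid h))"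
  proof (rule nn_integral_cong)
    fix l :: 'a
    show "(\<integral>\<^sup>+x. g (x + l) * indicator (cell h) x \<partial>lborel)
        = (\<integral>\<^sup>+x. g x * indicator (cell h) (x + - l) \<partial>lborel)"
      using nn_integral_lborel_shift[where f="\<lambda>x. g x * indicator (cell h) (x + - l)" and t=l] by simp
  qed
  also have "\<dots> = (\<integral>\<^sup>+l. (\<integral>\<^sup>+x. g x * indicator (cell h) (x + l) \<partial>lborel) \<partial>count_space (grid h))"
    using nn_integral_grid_uminus[where g="\<lambda>l. \<integral>\<^sup>+x. g x * indicator (cell h) (x + l) \<partial>lborel"] by simp
  also have "\<dots> = (\<integral>\<^sup>+x. (\<integral>\<^sup>+l. g x * indicator (cell h) (x + l) \<partial>count_space (grid h)) \<partial>lborel)"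
    by (rule nn_integral_count_space_nn_integral[symmetric]) (auto simp: countable_grid[OF h])
  also have "\<dots> = (\<integral>\<^sup>+x. g x * (\<integral>\<^sup>+l. indicator (cell h) (x + l) \<partial>count_space (grid h)) \<partial>lborel)"
    by (subst nn_integral_cmult) auto
  also have "\<dots> = (\<integral>\<^sup>+x. g x \<partial>lborel)"
    by (simp add: cell_tiling[OF h])
  finally show ?thesis .
qed

lemma sets_torus[measurable_cong]: "sets (torus h) = sets borel"
  by (simp add: torus_def)

lemma space_torus[simp]: "space (torus h) = UNIV"
  by (simp add: torus_def)

lemma nn_integral_torus:
  fixes f :: "'a::euclidean_space \<Rightarrow> ennreal"
  assumes "h > 0" and [measurable]: "f \<in> borel_measurable borel"
  shows "(\<integral>\<^sup>+x. f x \<partial>torus h) = (\<integral>\<^sup>+x. f x * indicator (cell h) x \<partial>lborel) / ennreal (h ^ DIM('a))"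
  unfolding torus_def by (subst nn_integral_uniform_measure) (auto simp: emeasure_cell assms)

lemma emeasure_torus:
  assumes "h > 0"
  shows "emeasure (torus h :: 'a::euclidean_space measure) UNIV = 1"
  unfolding torus_def using assms emeasure_cell[OF assms, where 'a='a]
  by (subst emeasure_uniform_measure) (auto simp: ennreal_divide_self)

lemma sigma_finite_torus:
  assumes "h > 0"
  shows "sigma_finite_measure (torus h :: 'a::euclidean_space measure)"
proof -
  interpret finite_measure "torus h :: 'a measure"
    by standard (simp add: emeasure_torus[OF assms])
  show ?thesis by (rule sigma_finite_measure_axioms)
qed

lemma torus_mean_periodize:
  fixes g :: "'a::euclidean_space \<Rightarrow> ennreal"
  assumes h: "h > 0" and [measurable]: "g \<in> borel_measurable borel"
  shows "(\<integral>\<^sup>+x. periodize h g x \<partial>torus h) = (\<integral>\<^sup>+x. g x \<partial>lborel) / ennreal (h ^ DIM('a))"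
  using assms by (simp add: nn_integral_torus cell_unfold)

text \<open>
  Unfolding \<open>H\<close> cut off by the indicator of the shifted cell gives \<open>H\<close> back, because the shifted
  cell tiles the space too.
\<close>

lemma torus_mean_shift:
  fixes H :: "'a::euclidean_space \<Rightarrow> ennreal"
  assumes h: "h > 0" and H[measurable]: "H \<in> borel_measurable borel" and per: "periodic h H"
  shows "(\<integral>\<^sup>+x. H (x + t) \<partial>torus h) = (\<integral>\<^sup>+x. H x \<partial>torus h)"
proof -
  have "(\<integral>\<^sup>+x. H (x + t) * indicator (cell h) x \<partial>lborel)
      = (\<integral>\<^sup>+x. H x * indicator (cell h) (x - t) \<partial>lborel)"
    using nn_integral_lborel_shift[where f="\<lambda>x. H x * indicator (cell h) (x - t)" and t=t] by simp
  also have "\<dots> = (\<integral>\<^sup>+x. periodize h (\<lambda>x. H x * indicator (cell h) (x - t)) x * indicator (cell h) x \<partial>lborel)"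
    by (rule cell_unfold[OF h, symmetric]) measurable
  also have "periodize h (\<lambda>x. H x * indicator (cell h) (x - t)) = H"
  proof
    fix x
    have "periodize h (\<lambda>x. H x * indicator (cell h) (x - t)) x
       = (\<integral>\<^sup>+l. H x * indicator (cell h) ((x - t) + l) \<partial>count_space (grid h))"
      unfolding periodize_def
    proof (rule nn_integral_cong)
      fix l :: 'a assume "l \<in> space (count_space (grid h))"
      hence "H (x + l) = H x" using per by (simp add: periodic_def)
      moreover have "x + l - t = (x - t) + l" by simp
      ultimately show "H (x + l) * indicator (cell h) (x + l - t) = H x * indicator (cell h) ((x - t) + l)"
        by (simp only:)
    qed
    also have "\<dots> = H x"
      by (subst nn_integral_cmult) (auto simp: cell_tiling[OF h])
    finally show "periodize h (\<lambda>x. H x * indicator (cell h) (x - t)) x = H x" .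
  qed
  finally show ?thesis using h by (simp add: nn_integral_torus)
qed

text \<open>
  A finite mean only controls \<open>H\<close> almost everywhere on the cell; periodicity carries this to the countably
  many translates.
\<close>

lemma AE_finite_if_torus_mean_finite:
  fixes H :: "'a::euclidean_space \<Rightarrow> ennreal"
  assumes h: "h > 0" and H[measurable]: "H \<in> borel_measurable borel" and per: "periodic h H"
    and fin: "(\<integral>\<^sup>+x. H x \<partial>torus h) < \<infinity>"
  shows "AE x in lborel. H x < \<infinity>"
proof -
  have fin': "(\<integral>\<^sup>+x. H x * indicator (cell h) x \<partial>lborel) < \<infinity>"
    using fin h
    by (auto simp: nn_integral_torus ennreal_divide_eq_top_iff top.not_eq_extremum[symmetric])
  have "AE x in lborel. \<forall>l\<in>grid h. H x * indicator (cell h) (x + l) \<noteq> \<infinity>"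
  proof (subst AE_ball_countable[OF countable_grid[OF h]], intro ballI)
    fix l :: 'a assume l: "l \<in> grid h"
    have "(\<integral>\<^sup>+x. H x * indicator (cell h) (x + l) \<partial>lborel)
        = (\<integral>\<^sup>+x. H (x + l) * indicator (cell h) (x + l) \<partial>lborel)"
      using per l by (auto simp: periodic_def intro!: nn_integral_cong)
    also have "\<dots> = (\<integral>\<^sup>+x. H x * indicator (cell h) x \<partial>lborel)"
      by (rule nn_integral_lborel_shift) auto
    finally show "AE x in lborel. H x * indicator (cell h) (x + l) \<noteq> \<infinity>"
      using fin' by (intro nn_integral_PInf_AE) auto
  qed
  moreover have "H x < \<infinity>" if "\<forall>l\<in>grid h. H x * indicator (cell h) (x + l) \<noteq> \<infinity>" for x
  proof (rule ccontr)
    note * = that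
    assume "\<not> H x < \<infinity>"
    hence "H x = top" using top.not_eq_extremum[of "H x"] by auto
    with * have "x + l \<notin> cell h" if "l \<in> grid h" for l
      using that by (auto simp: split: split_indicator)
    note notin = this
    have "(\<integral>\<^sup>+l. indicator (cell h) (x + l) \<partial>count_space (grid h)) = (\<integral>\<^sup>+(l::'a). 0 \<partial>count_space (grid h))"
      by (intro nn_integral_cong) (simp add: notin)
    with cell_tiling[OF h, of x] show False by simp
  qed
  ultimately show ?thesis by (rule eventually_mono)
qed

section \<open>Norms, volumes of balls and lattice points in balls\<close>

lemma is_norm_nonneg: "is_norm \<nu> \<Longrightarrow> 0 \<le> \<nu> x"
  and is_norm_zero: "is_norm \<nu> \<Longrightarrow> \<nu> x = 0 \<longleftrightarrow> x = 0"
  and is_norm_scaleR: "is_norm \<nu> \<Longrightarrow> \<nu> (c *\<^sub>R x) = \<bar>c\<bar> * \<nu> x"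
  and is_norm_triangle: "is_norm \<nu> \<Longrightarrow> \<nu> (x + y) \<le> \<nu> x + \<nu> y"
  unfolding is_norm_def by blast+

lemma is_norm_uminus: "is_norm \<nu> \<Longrightarrow> \<nu> (- x) = \<nu> x"
  using is_norm_scaleR[of \<nu> "-1" x] by simp

lemma is_norm_triangle_diff: "is_norm \<nu> \<Longrightarrow> \<nu> x \<le> \<nu> (x + y) + \<nu> y"
  using is_norm_triangle[of \<nu> "x + y" "- y"] by (simp add: is_norm_uminus)

lemma is_norm_sum:
  assumes "finite B" "is_norm \<nu>"
  shows "\<nu> (sum f B) \<le> (\<Sum>b\<in>B. \<nu> (f b))"
  using assms
proof (induction rule: finite_induct)
  case empty
  then show ?case using is_norm_zero[of \<nu> 0] by simp
next
  case (insert b B)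
  then show ?case using is_norm_triangle[of \<nu> "f b" "sum f B"] by simp
qed

text \<open>
  This number serves as the comparison constant for all upper bounds of \<open>\<nu>\<close> by coordinates.
\<close>

definition basis_norm :: "('a::euclidean_space \<Rightarrow> real) \<Rightarrow> real" where
  "basis_norm \<nu> = (\<Sum>b\<in>Basis. \<nu> b)"

lemma basis_norm_nonneg: "is_norm \<nu> \<Longrightarrow> 0 \<le> basis_norm \<nu>"
  unfolding basis_norm_def by (intro sum_nonneg is_norm_nonneg)

lemma is_norm_le_coords:
  fixes \<nu> :: "'a::euclidean_space \<Rightarrow> real"
  assumes \<nu>: "is_norm \<nu>" and "\<And>b. b \<in> Basis \<Longrightarrow> \<bar>x \<bullet> b\<bar> \<le> c"
  shows "\<nu> x \<le> c * basis_norm \<nu>"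
proof -
  have "\<nu> x = \<nu> (\<Sum>b\<in>Basis. (x \<bullet> b) *\<^sub>R b)"
    by (simp add: euclidean_representation)
  also have "\<dots> \<le> (\<Sum>b\<in>Basis. \<bar>x \<bullet> b\<bar> * \<nu> b)"
    using is_norm_sum[OF finite_Basis \<nu>, of "\<lambda>b. (x \<bullet> b) *\<^sub>R b"] by (simp add: is_norm_scaleR[OF \<nu>])
  also have "\<dots> \<le> (\<Sum>b\<in>Basis. c * \<nu> b)"
    by (intro sum_mono mult_right_mono assms is_norm_nonneg[OF \<nu>])
  finally show ?thesis by (simp add: basis_norm_def sum_distrib_left)
qed

lemma is_norm_le_norm:
  fixes \<nu> :: "'a::euclidean_space \<Rightarrow> real"
  assumes "is_norm \<nu>"
  shows "\<nu> x \<le> norm x * basis_norm \<nu>"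
  by (rule is_norm_le_coords[OF assms]) (rule Basis_le_norm)

lemma is_norm_cell_le:
  fixes \<nu> :: "'a::euclidean_space \<Rightarrow> real"
  assumes "is_norm \<nu>" "x \<in> cell h"
  shows "\<nu> x \<le> h * basis_norm \<nu>"
  by (rule is_norm_le_coords[OF assms(1)]) (use assms(2) in \<open>auto simp: cell_def less_imp_le\<close>)

lemma continuous_on_is_norm:
  fixes \<nu> :: "'a::euclidean_space \<Rightarrow> real"
  assumes \<nu>: "is_norm \<nu>"
  shows "continuous_on S \<nu>"
proof -
  have "dist (\<nu> x) (\<nu> y) \<le> basis_norm \<nu> * dist x y" for x y
    using is_norm_triangle[OF \<nu>, of y "x - y"] is_norm_triangle[OF \<nu>, of x "y - x"]
      is_norm_le_norm[OF \<nu>, of "x - y"] is_norm_uminus[OF \<nu>, of "x - y"]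
    by (simp add: dist_norm abs_le_iff mult.commute)
  hence "(basis_norm \<nu>)-lipschitz_on S \<nu>"
    by (intro lipschitz_onI) (auto simp: basis_norm_nonneg[OF \<nu>])
  thus ?thesis by (rule lipschitz_on_continuous_on)
qed

lemma borel_measurable_is_norm:
  fixes \<nu> :: "'a::euclidean_space \<Rightarrow> real"
  shows "is_norm \<nu> \<Longrightarrow> \<nu> \<in> borel_measurable borel"
  by (intro borel_measurable_continuous_onI continuous_on_is_norm)

text \<open>
  Compactness of the Euclidean unit sphere bounds \<open>\<nu>\<close> from below.
\<close>

lemma is_norm_ge_norm:
  fixes \<nu> :: "'a::euclidean_space \<Rightarrow> real"
  assumes \<nu>: "is_norm \<nu>"
  obtains c where "c > 0" "\<And>x. c * norm x \<le> \<nu> x"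
proof -
  obtain y where y: "y \<in> sphere 0 1" "\<And>x. x \<in> sphere 0 1 \<Longrightarrow> \<nu> y \<le> \<nu> x"
    using continuous_attains_inf[of "sphere (0::'a) 1" \<nu>] continuous_on_is_norm[OF \<nu>] by auto
  from y(1) have "y \<noteq> 0" by auto
  hence "\<nu> y > 0" using is_norm_nonneg[OF \<nu>, of y] is_norm_zero[OF \<nu>, of y] by linarith
  moreover have "\<nu> y * norm x \<le> \<nu> x" for x
  proof (cases "x = 0")
    case False
    hence "\<nu> y \<le> \<nu> ((1 / norm x) *\<^sub>R x)" by (intro y) auto
    thus ?thesis using False by (simp add: is_norm_scaleR[OF \<nu>] field_simps)
  qed (simp add: is_norm_nonneg[OF \<nu>])
  ultimately show ?thesis using that by blast
qed

lemma bounded_is_norm_le: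
  fixes \<nu> :: "'a::euclidean_space \<Rightarrow> real"
  assumes \<nu>: "is_norm \<nu>"
  shows "bounded {x. \<nu> x \<le> r}"
proof -
  obtain c where c: "c > 0" "\<And>x. c * norm x \<le> \<nu> x" using is_norm_ge_norm[OF \<nu>] by blast
  have "norm x \<le> r / c" if "\<nu> x \<le> r" for x
    using c(2)[of x] that c(1) by (simp add: field_simps)
  thus ?thesis unfolding bounded_iff by blast
qed

lemma emeasure_norm_cball:
  fixes \<nu> :: "'a::euclidean_space \<Rightarrow> real"
  assumes \<nu>: "is_norm \<nu>" and r: "r \<ge> 0"
  shows "emeasure lborel {x. \<nu> x \<le> r} = ennreal (unit_ball_volume \<nu> * r ^ DIM('a))"
proof -
  note [measurable] = borel_measurable_is_norm[OF \<nu>]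
  have cmp: "compact {x. \<nu> x \<le> s}" for s
  proof -
    have "closed {x. \<nu> x \<le> s}"
      by (intro closed_Collect_le continuous_on_is_norm[OF \<nu>] continuous_on_const)
    thus ?thesis using bounded_is_norm_le[OF \<nu>] compact_eq_bounded_closed by blast
  qed
  have V: "emeasure lborel {x. \<nu> x \<le> 1} = ennreal (unit_ball_volume \<nu>)"
  proof -
    have "emeasure lborel {x. \<nu> x \<le> 1} \<noteq> \<infinity>"
      using emeasure_compact_finite[OF cmp] by (simp add: less_top)
    hence "emeasure lborel {x. \<nu> x \<le> 1} = ennreal (measure lborel {x. \<nu> x \<le> 1})"
      by (simp add: emeasure_eq_ennreal_measure)
    also have "measure lborel {x. \<nu> x \<le> 1} = unit_ball_volume \<nu>"
      unfolding unit_ball_volume_def by (subst measure_completion) auto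
    finally show ?thesis .
  qed
  show ?thesis
  proof (cases "r = 0")
    case True
    have "{x. \<nu> x \<le> 0} = {0}"
      using is_norm_zero[OF \<nu>] is_norm_nonneg[OF \<nu>] by (auto simp: order.eq_iff)
    with True show ?thesis by (simp add: power_0_left)
  next
    case False
    with r have r: "r > 0" by simp
    have "{x. \<nu> x \<le> r} = (\<lambda>x. r *\<^sub>R x + 0) ` {x. \<nu> x \<le> 1}"
    proof safe
      fix x assume "\<nu> x \<le> r"
      hence "x = r *\<^sub>R (inverse r *\<^sub>R x) + 0" "\<nu> (inverse r *\<^sub>R x) \<le> 1"
        using r by (auto simp: is_norm_scaleR[OF \<nu>] field_simps)
      thus "x \<in> (\<lambda>x. r *\<^sub>R x + 0) ` {x. \<nu> x \<le> 1}" by blast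
    qed (use r in \<open>auto simp: is_norm_scaleR[OF \<nu>] field_simps\<close>)
    hence "emeasure lebesgue {x. \<nu> x \<le> r} = \<bar>r\<bar> ^ DIM('a) * emeasure lebesgue {x. \<nu> x \<le> 1}"
      by (simp only: emeasure_lebesgue_affine)
    also have "emeasure lebesgue {x. \<nu> x \<le> 1} = ennreal (unit_ball_volume \<nu>)"
      using V by (subst emeasure_completion) auto
    also have "emeasure lebesgue {x. \<nu> x \<le> r} = emeasure lborel {x. \<nu> x \<le> r}"
      by (subst emeasure_completion) auto
    finally show ?thesis using r
      by (simp add: ennreal_mult' mult.commute unit_ball_volume_def)
  qed
qed

lemma unit_ball_volume_pos:
  fixes \<nu> :: "'a::euclidean_space \<Rightarrow> real"
  assumes \<nu>: "is_norm \<nu>"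
  shows "unit_ball_volume \<nu> > 0"
proof -
  note [measurable] = borel_measurable_is_norm[OF \<nu>]
  let ?e = "1 / (basis_norm \<nu> + 1)"
  have e: "?e > 0" using basis_norm_nonneg[OF \<nu>] by simp
  have sub: "ball 0 ?e \<subseteq> {x. \<nu> x \<le> 1}"
  proof safe
    fix x :: 'a assume "x \<in> ball 0 ?e"
    hence "norm x * basis_norm \<nu> \<le> ?e * basis_norm \<nu>"
      by (intro mult_right_mono basis_norm_nonneg[OF \<nu>]) auto
    also have "\<dots> \<le> 1" using basis_norm_nonneg[OF \<nu>] by (simp add: field_simps)
    finally show "\<nu> x \<le> 1" using is_norm_le_norm[OF \<nu>, of x] by simp
  qed
  have "0 < emeasure lborel (ball 0 ?e :: 'a set)"
    using content_ball_pos[OF e, of "0::'a"] by (simp add: measure_def zero_less_iff_neq_zero enn2real_positive_iff)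
  also have "\<dots> \<le> emeasure lborel {x. \<nu> x \<le> 1}" by (intro emeasure_mono sub) auto
  finally show ?thesis by (simp add: emeasure_norm_cball[OF \<nu>])
qed

text \<open>
  Open and closed balls have the same volume: an open ball contains the closed balls of all smaller
  radii, whose volumes depend continuously on the radius.
\<close>

lemma emeasure_norm_ball:
  fixes \<nu> :: "'a::euclidean_space \<Rightarrow> real"
  assumes \<nu>: "is_norm \<nu>" and r: "r \<ge> 0"
  shows "emeasure lborel {x. \<nu> x < r} = ennreal (unit_ball_volume \<nu> * r ^ DIM('a))"
proof (cases "r = 0")
  case True
  hence "{x. \<nu> x < r} = {}" using is_norm_nonneg[OF \<nu>] by (auto simp: not_less)
  with True show ?thesis by (simp add: power_0_left)
next
  case False
  with r have r: "r > 0" by simp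
  note [measurable] = borel_measurable_is_norm[OF \<nu>]
  let ?V = "\<lambda>s. unit_ball_volume \<nu> * s ^ DIM('a)"
  have le: "emeasure lborel {x. \<nu> x < r} \<le> ennreal (?V r)"
    using r by (subst emeasure_norm_cball[OF \<nu>, symmetric]) (auto intro!: emeasure_mono)
  then obtain m where m: "emeasure lborel {x. \<nu> x < r} = ennreal m" "m \<ge> 0"
    by (metis ennreal_cases ennreal_less_top leD top.not_eq_extremum)
  have "?V s \<le> m" if "0 < s" "s < r" for s
  proof -
    have "ennreal (?V s) \<le> ennreal m"
      using that unfolding m(1)[symmetric]
      by (subst emeasure_norm_cball[OF \<nu>, symmetric]) (auto intro!: emeasure_mono)
    thus ?thesis using m(2) by (simp add: ennreal_le_iff)
  qed
  hence "eventually (\<lambda>s. ?V s \<le> m) (at_left r)"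
    using r by (auto simp: eventually_at_left_field intro!: exI[of _ 0])
  moreover have "(?V \<longlongrightarrow> ?V r) (at_left r)"
    by (intro tendsto_intros)
  ultimately have "?V r \<le> m"
    by (intro tendsto_upperbound) auto
  with le m show ?thesis
    by (metis ennreal_leI order.eq_iff)
qed

lemma cell_mean_count:
  fixes g :: "'a::euclidean_space \<Rightarrow> ennreal"
  assumes h: "h > 0" and [measurable]: "g \<in> borel_measurable borel"
  shows "(\<integral>\<^sup>+x. periodize h g (y + x) * indicator (cell h) x \<partial>lborel) = (\<integral>\<^sup>+x. g x \<partial>lborel)"
proof -
  have "(\<integral>\<^sup>+x. periodize h g (y + x) * indicator (cell h) x \<partial>lborel)
      = (\<integral>\<^sup>+x. periodize h (\<lambda>x. g (x + y)) x * indicator (cell h) x \<partial>lborel)"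
    by (simp add: periodize_def ac_simps)
  also have "\<dots> = (\<integral>\<^sup>+x. g (x + y) \<partial>lborel)" by (rule cell_unfold[OF h]) simp
  also have "\<dots> = (\<integral>\<^sup>+x. g x \<partial>lborel)" by (rule nn_integral_lborel_shift) simp
  finally show ?thesis .
qed

text \<open>
  A lattice point in a ball of radius \<open>r\<close> carries a cell contained in the ball of radius
  \<open>r + h * basis_norm \<nu>\<close>, and the cells that meet the ball of radius \<open>r - h * basis_norm \<nu>\<close> belong
  to lattice points of the ball of radius \<open>r\<close>.
\<close>

lemma grid_count_upper:
  fixes \<nu> :: "'a::euclidean_space \<Rightarrow> real"
  assumes \<nu>: "is_norm \<nu>" and h: "h > 0" and r: "r \<ge> 0"
  shows "periodize h (indicator {x. \<nu> x < r}) y * ennreal (h ^ DIM('a))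
    \<le> ennreal (unit_ball_volume \<nu> * (r + h * basis_norm \<nu>) ^ DIM('a))"
proof -
  note [measurable] = borel_measurable_is_norm[OF \<nu>]
  have "periodize h (indicator {x. \<nu> x < r}) y * ennreal (h ^ DIM('a))
      = (\<integral>\<^sup>+x. periodize h (indicator {x. \<nu> x < r}) y * indicator (cell h) (x::'a) \<partial>lborel)"
    by (subst nn_integral_cmult_indicator) (auto simp: emeasure_cell[OF h])
  also have "\<dots> \<le> (\<integral>\<^sup>+x. periodize h (indicator {x. \<nu> x < r + h * basis_norm \<nu>}) (y + x) * indicator (cell h) x \<partial>lborel)"
  proof (rule nn_integral_mono)
    fix x :: 'a
    have "indicator {x. \<nu> x < r} (y + l) \<le> (indicator {x. \<nu> x < r + h * basis_norm \<nu>} (y + x + l) :: ennreal)"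
      if "x \<in> cell h" for l
      using is_norm_cell_le[OF \<nu> that] is_norm_triangle[OF \<nu>, of "y + l" x]
      by (auto split: split_indicator simp: algebra_simps)
    thus "periodize h (indicator {x. \<nu> x < r}) y * indicator (cell h) x
        \<le> periodize h (indicator {x. \<nu> x < r + h * basis_norm \<nu>}) (y + x) * indicator (cell h) x"
      unfolding periodize_def by (auto split: split_indicator intro!: nn_integral_mono)
  qed
  also have "\<dots> = emeasure lborel {x. \<nu> x < r + h * basis_norm \<nu>}"
    by (subst cell_mean_count[OF h]) auto
  also have "\<dots> = ennreal (unit_ball_volume \<nu> * (r + h * basis_norm \<nu>) ^ DIM('a))"
    using r h basis_norm_nonneg[OF \<nu>] by (intro emeasure_norm_ball[OF \<nu>]) auto
  finally show ?thesis .
qed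

lemma grid_count_lower:
  fixes \<nu> :: "'a::euclidean_space \<Rightarrow> real"
  assumes \<nu>: "is_norm \<nu>" and h: "h > 0" and r: "r \<ge> h * basis_norm \<nu>"
  shows "ennreal (unit_ball_volume \<nu> * (r - h * basis_norm \<nu>) ^ DIM('a))
    \<le> periodize h (indicator {x. \<nu> x < r}) y * ennreal (h ^ DIM('a))"
proof -
  note [measurable] = borel_measurable_is_norm[OF \<nu>]
  have "ennreal (unit_ball_volume \<nu> * (r - h * basis_norm \<nu>) ^ DIM('a))
      = emeasure lborel {x. \<nu> x < r - h * basis_norm \<nu>}"
    using r by (intro emeasure_norm_ball[OF \<nu>, symmetric]) auto
  also have "\<dots> = (\<integral>\<^sup>+x. periodize h (indicator {x. \<nu> x < r - h * basis_norm \<nu>}) (y + x) * indicator (cell h) x \<partial>lborel)"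
    by (subst cell_mean_count[OF h]) auto
  also have "\<dots> \<le> (\<integral>\<^sup>+x. periodize h (indicator {x. \<nu> x < r}) y * indicator (cell h) (x::'a) \<partial>lborel)"
  proof (rule nn_integral_mono)
    fix x :: 'a
    have "(indicator {x. \<nu> x < r - h * basis_norm \<nu>} (y + x + l) :: ennreal) \<le> indicator {x. \<nu> x < r} (y + l)"
      if "x \<in> cell h" for l
      using is_norm_cell_le[OF \<nu> that] is_norm_triangle_diff[OF \<nu>, of "y + l" x]
      by (auto split: split_indicator simp: algebra_simps)
    thus "periodize h (indicator {x. \<nu> x < r - h * basis_norm \<nu>}) (y + x) * indicator (cell h) x
        \<le> periodize h (indicator {x. \<nu> x < r}) y * indicator (cell h) x"
      unfolding periodize_def by (auto split: split_indicator intro!: nn_integral_mono)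
  qed
  also have "\<dots> = periodize h (indicator {x. \<nu> x < r}) y * ennreal (h ^ DIM('a))"
    by (subst nn_integral_cmult_indicator) (auto simp: emeasure_cell[OF h])
  finally show ?thesis .
qed

section \<open>Averages over matrices\<close>

definition outer :: "real ^ 'm \<Rightarrow> real ^ 'n \<Rightarrow> real ^ 'n ^ 'm" where
  "outer y w = (\<chi> i j. y $ i * w $ j)"

lemma outer_mult_vec: "outer y w *v q = (w \<bullet> q) *\<^sub>R y"
  by (simp add: vec_eq_iff outer_def matrix_vector_mult_def inner_vec_def sum_distrib_left ac_simps)

lemma grid_vec_iff: "x \<in> grid h \<longleftrightarrow> (\<forall>i. x $ i / h \<in> \<int>)" for x :: "real ^ 'k"
  by (auto simp: grid_def Basis_vec_def inner_axis)

lemma grid_matrix_iff: "x \<in> grid h \<longleftrightarrow> (\<forall>i j. x $ i $ j / h \<in> \<int>)" for x :: "real ^ 'n ^ 'm"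
  by (auto simp: grid_def Basis_vec_def inner_axis)

text \<open>
  An integer vector \<open>q\<close> sends periods of matrices to periods of vectors, so \<open>\<theta> \<mapsto> F (\<theta> *v q)\<close>
  inherits periodicity from \<open>F\<close>.
\<close>

lemma grid_mult_real_vec:
  fixes l :: "real ^ 'n ^ 'm"
  assumes "l \<in> grid h"
  shows "l *v real_vec q \<in> grid h"
  unfolding grid_vec_iff
proof
  fix i
  have "(l *v real_vec q) $ i / h = (\<Sum>j\<in>UNIV. (l $ i $ j / h) * of_int (q $ j))"
    by (simp add: matrix_vector_mult_def real_vec_def sum_divide_distrib)
  also have "\<dots> \<in> \<int>"
    using assms by (intro Ints_sum Ints_mult) (auto simp: grid_matrix_iff)
  finally show "(l *v real_vec q) $ i / h \<in> \<int>" .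
qed

lemma borel_measurable_mult_vec[measurable]:
  fixes q :: "real ^ 'n"
  shows "(\<lambda>\<theta> :: real ^ 'n ^ 'm. \<theta> *v q) \<in> borel_measurable borel"
proof (intro borel_measurable_continuous_onI linear_continuous_on)
  have "linear (\<lambda>\<theta> :: real ^ 'n ^ 'm. \<theta> *v q)"
    by (rule linearI)
       (auto simp: vec_eq_iff matrix_vector_mult_def algebra_simps sum.distrib sum_distrib_left)
  thus "bounded_linear (\<lambda>\<theta> :: real ^ 'n ^ 'm. \<theta> *v q)"
    by (simp add: linear_conv_bounded_linear)
qed

lemma periodic_mult_vec:
  fixes F :: "real ^ 'm \<Rightarrow> 'b"
  assumes "periodic h F"
  shows "periodic h (\<lambda>\<theta> :: real ^ 'n ^ 'm. F (\<theta> *v real_vec q))"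
  using assms grid_mult_real_vec[of _ h q]
  by (auto simp: periodic_def matrix_vector_mult_add_rdistrib)

text \<open>
  Translating \<open>\<theta>\<close> by a multiple of \<open>outer y w\<close> shifts \<open>\<theta> *v q\<close> by \<open>y\<close> and does not change \<open>G\<close>. So the mean of
  \<open>F (\<theta> *v q + y) * G \<theta>\<close> is the same for all \<open>y\<close>, and its average over \<open>y\<close> is the product of the two
  means.
\<close>

lemma torus_mean_decouple:
  fixes F :: "real ^ 'm \<Rightarrow> ennreal" and G :: "real ^ 'n ^ 'm \<Rightarrow> ennreal"
  assumes h: "h > 0"
    and [measurable]: "F \<in> borel_measurable borel" and F: "periodic h F"
    and [measurable]: "G \<in> borel_measurable borel" and G: "periodic h G"
    and w: "w \<bullet> real_vec q \<noteq> 0" and inv: "\<And>\<theta> y. G (\<theta> + outer y w) = G \<theta>"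
  shows "(\<integral>\<^sup>+\<theta>. F (\<theta> *v real_vec q) * G \<theta> \<partial>torus h) = (\<integral>\<^sup>+x. F x \<partial>torus h) * (\<integral>\<^sup>+\<theta>. G \<theta> \<partial>torus h)"
proof -
  let ?q = "real_vec q"
  let ?H = "\<lambda>\<theta>. F (\<theta> *v ?q) * G \<theta>"
  have per: "periodic h ?H"
    using periodic_mult_vec[OF F, of q] G unfolding periodic_def by auto
  have shift: "(\<integral>\<^sup>+\<theta>. F (\<theta> *v ?q + y) * G \<theta> \<partial>torus h) = (\<integral>\<^sup>+\<theta>. ?H \<theta> \<partial>torus h)" for y
  proof -
    have "(\<theta> + outer ((1 / (w \<bullet> ?q)) *\<^sub>R y) w) *v ?q = \<theta> *v ?q + y" for \<theta>
      using w by (simp add: matrix_vector_mult_add_rdistrib outer_mult_vec)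
    thus ?thesis
      using torus_mean_shift[OF h _ per, of "outer ((1 / (w \<bullet> ?q)) *\<^sub>R y) w"] by (simp add: inv)
  qed
  interpret T1: sigma_finite_measure "torus h :: (real ^ 'm) measure" by (rule sigma_finite_torus[OF h])
  interpret T2: sigma_finite_measure "torus h :: (real ^ 'n ^ 'm) measure" by (rule sigma_finite_torus[OF h])
  interpret P: pair_sigma_finite "torus h :: (real ^ 'm) measure" "torus h :: (real ^ 'n ^ 'm) measure" ..
  have "(\<integral>\<^sup>+\<theta>. ?H \<theta> \<partial>torus h) = (\<integral>\<^sup>+y. (\<integral>\<^sup>+\<theta>. F (\<theta> *v ?q + y) * G \<theta> \<partial>torus h) \<partial>torus h)"
    by (simp add: shift emeasure_torus[OF h])
  also have "\<dots> = (\<integral>\<^sup>+\<theta>. (\<integral>\<^sup>+y. F (\<theta> *v ?q + y) * G \<theta> \<partial>torus h) \<partial>torus h)"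
    by (rule P.Fubini'[symmetric]) measurable
  also have "\<dots> = (\<integral>\<^sup>+\<theta>. (\<integral>\<^sup>+y. F y \<partial>torus h) * G \<theta> \<partial>torus h)"
  proof (rule nn_integral_cong)
    fix \<theta> :: "real ^ 'n ^ 'm"
    have "(\<integral>\<^sup>+y. F (\<theta> *v ?q + y) * G \<theta> \<partial>torus h) = (\<integral>\<^sup>+y. F (y + \<theta> *v ?q) \<partial>torus h) * G \<theta>"
      by (subst nn_integral_multc) (auto simp: add.commute)
    also have "(\<integral>\<^sup>+y. F (y + \<theta> *v ?q) \<partial>torus h) = (\<integral>\<^sup>+y. F y \<partial>torus h)"
      by (rule torus_mean_shift[OF h _ F]) simp
    finally show "(\<integral>\<^sup>+y. F (\<theta> *v ?q + y) * G \<theta> \<partial>torus h) = (\<integral>\<^sup>+y. F y \<partial>torus h) * G \<theta>" .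
  qed
  also have "\<dots> = (\<integral>\<^sup>+x. F x \<partial>torus h) * (\<integral>\<^sup>+\<theta>. G \<theta> \<partial>torus h)"
    by (subst nn_integral_cmult) auto
  finally show ?thesis .
qed

lemma torus_mean_mult_vec:
  fixes F :: "real ^ 'm \<Rightarrow> ennreal"
  assumes h: "h > 0" and F: "F \<in> borel_measurable borel" "periodic h F" and q: "real_vec q \<noteq> 0"
  shows "(\<integral>\<^sup>+\<theta>. F (\<theta> *v real_vec q) \<partial>(torus h :: (real ^ 'n ^ 'm) measure)) = (\<integral>\<^sup>+x. F x \<partial>torus h)"
  using torus_mean_decouple[OF h F, where G="\<lambda>_. 1" and w="real_vec q" and q=q] q
  by (simp add: emeasure_torus[OF h] periodic_def)

text \<open>
  For linearly independent \<open>q\<close>, \<open>q'\<close> the component \<open>w\<close> of \<open>q\<close> orthogonal to \<open>q'\<close> is not orthogonal to \<open>q\<close>, so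
  \<open>\<theta> *v q\<close> can be moved while \<open>\<theta> *v q'\<close> is kept.
\<close>

lemma torus_mean_independent:
  fixes F G :: "real ^ 'm \<Rightarrow> ennreal" and q q' :: "int ^ 'n"
  assumes h: "h > 0" and F: "F \<in> borel_measurable borel" "periodic h F"
    and G: "G \<in> borel_measurable borel" "periodic h G"
    and indep: "(real_vec q' \<bullet> real_vec q') *\<^sub>R real_vec q \<noteq> (real_vec q \<bullet> real_vec q') *\<^sub>R real_vec q'"
  shows "(\<integral>\<^sup>+\<theta>. F (\<theta> *v real_vec q) * G (\<theta> *v real_vec q') \<partial>(torus h :: (real ^ 'n ^ 'm) measure))
    = (\<integral>\<^sup>+x. F x \<partial>torus h) * (\<integral>\<^sup>+x. G x \<partial>torus h)"
proof -
  note [measurable] = G(1)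
  define w where "w = (real_vec q' \<bullet> real_vec q') *\<^sub>R real_vec q - (real_vec q \<bullet> real_vec q') *\<^sub>R real_vec q'"
  have w0: "w \<noteq> 0" using indep by (simp add: w_def)
  have orth: "w \<bullet> real_vec q' = 0" by (simp add: w_def inner_diff_left)
  \<comment> \<open>\<open>w \<bullet> q\<close> is non-zero because a multiple of it is \<open>w \<bullet> w\<close>.\<close>
  have "w \<bullet> w = (real_vec q' \<bullet> real_vec q') * (w \<bullet> real_vec q)"
    by (subst (2) w_def) (simp add: inner_diff_right orth)
  hence "w \<bullet> real_vec q \<noteq> 0" using w0 by auto
  moreover have "real_vec q' \<noteq> 0" using indep by auto
  ultimately show ?thesis
    using torus_mean_decouple[OF h F, where G="\<lambda>\<theta>. G (\<theta> *v real_vec q')" and w=w and q=q]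
      periodic_mult_vec[OF G(2), of q'] torus_mean_mult_vec[OF h G, of q']
    by (simp add: matrix_vector_mult_add_rdistrib outer_mult_vec orth)
qed

text \<open>
  Representatives of the classes of \<open>grid h\<close> modulo \<open>a\<close> times itself.
\<close>

definition reps :: "real \<Rightarrow> int \<Rightarrow> 'a::euclidean_space set" where
  "reps h a = grid h \<inter> cell (of_int a * h)"

text \<open>
  For \<open>x\<close> in the small cell, \<open>x + l\<close> lies in the cell of side \<open>a * h\<close> exactly if the lattice vector \<open>l\<close> does.
  So the volume of the large cell, unfolded, is the number of representatives times the volume of
  the small cell.
\<close>

lemma reps_card:
  assumes h: "h > 0" and a: "a > 0"
  shows "finite (reps h a :: 'a::euclidean_space set)" "real (card (reps h a :: 'a set)) = of_int a ^ DIM('a)"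
proof -
  have *: "x + l \<in> cell (of_int a * h) \<longleftrightarrow> l \<in> cell (of_int a * h)"
    if x: "x \<in> cell h" and l: "l \<in> grid h" for x l :: 'a
  proof -
    have "(0 \<le> (x + l) \<bullet> b \<and> (x + l) \<bullet> b < of_int a * h) \<longleftrightarrow> (0 \<le> l \<bullet> b \<and> l \<bullet> b < of_int a * h)"
      if b: "b \<in> Basis" for b
    proof -
      from l b obtain z where "l \<bullet> b / h = of_int z" by (auto simp: grid_def elim!: Ints_cases)
      hence z: "l \<bullet> b = of_int z * h" using h by (simp add: field_simps)
      define t where "t = (x \<bullet> b) / h"
      have t: "x \<bullet> b = t * h" "0 \<le> t" "t < 1" using x b h by (auto simp: t_def cell_def)
      have "(0 \<le> (x + l) \<bullet> b \<and> (x + l) \<bullet> b < of_int a * h) \<longleftrightarrow> (0 \<le> (t + of_int z) * h \<and> (t + of_int z) * h < of_int a * h)"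
        by (simp add: inner_add_left z t algebra_simps)
      also have "\<dots> \<longleftrightarrow> (0 \<le> t + of_int z \<and> t + of_int z < of_int a)"
        using h by (simp add: zero_le_mult_iff)
      also have "\<dots> \<longleftrightarrow> (0 \<le> z \<and> z < a)"
        using t(2,3) by linarith
      also have "\<dots> \<longleftrightarrow> (0 \<le> l \<bullet> b \<and> l \<bullet> b < of_int a * h)"
        using h by (simp add: z zero_le_mult_iff)
      finally show ?thesis .
    qed
    thus ?thesis unfolding cell_def by blast
  qed
  have "emeasure (count_space (grid h)) (reps h a :: 'a set) * ennreal (h ^ DIM('a))
      = (\<integral>\<^sup>+x. emeasure (count_space (grid h)) (reps h a :: 'a set) * indicator (cell h) (x::'a) \<partial>lborel)"
    by (subst nn_integral_cmult_indicator) (auto simp: emeasure_cell[OF h])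
  also have "\<dots> = (\<integral>\<^sup>+x. periodize h (indicator (cell (of_int a * h))) x * indicator (cell h) (x::'a) \<partial>lborel)"
  proof (rule nn_integral_cong)
    fix x :: 'a
    have "periodize h (indicator (cell (of_int a * h))) x = (\<integral>\<^sup>+(l::'a). indicator (reps h a) l \<partial>count_space (grid h))"
      if "x \<in> cell h"
      unfolding periodize_def
      by (rule nn_integral_cong) (use *[OF that] in \<open>auto simp: reps_def split: split_indicator\<close>)
    moreover have "(\<integral>\<^sup>+(l::'a). indicator (reps h a) l \<partial>count_space (grid h)) = emeasure (count_space (grid h)) (reps h a :: 'a set)"
      by (rule nn_integral_indicator) (auto simp: reps_def)
    ultimately show "emeasure (count_space (grid h)) (reps h a :: 'a set) * indicator (cell h) x
        = periodize h (indicator (cell (of_int a * h))) x * indicator (cell h) x"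
      by (auto split: split_indicator)
  qed
  also have "\<dots> = ennreal ((of_int a * h) ^ DIM('a))"
    using emeasure_cell[of "of_int a * h", where 'a='a] h a by (subst cell_unfold[OF h]) auto
  finally have eq: "emeasure (count_space (grid h)) (reps h a :: 'a set) * ennreal (h ^ DIM('a)) = ennreal ((of_int a * h) ^ DIM('a))" .
  show fin: "finite (reps h a :: 'a set)"
  proof (rule ccontr)
    assume "infinite (reps h a :: 'a set)"
    hence "emeasure (count_space (grid h)) (reps h a :: 'a set) = \<infinity>"
      by (subst emeasure_count_space_infinite) (auto simp: reps_def)
    with eq h show False by (simp add: ennreal_top_mult)
  qed
  have "emeasure (count_space (grid h)) (reps h a :: 'a set) = ennreal (real (card (reps h a :: 'a set)))"
    using fin by (subst emeasure_count_space_finite) (auto simp: reps_def ennreal_of_nat_eq_real_of_nat)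
  with eq have "ennreal (real (card (reps h a :: 'a set)) * h ^ DIM('a)) = ennreal ((of_int a * h) ^ DIM('a))"
    using h by (simp add: ennreal_mult)
  hence "real (card (reps h a :: 'a set)) * h ^ DIM('a) = (of_int a * h) ^ DIM('a)"
    using h a by (subst (asm) ennreal_inj) auto
  thus "real (card (reps h a :: 'a set)) = of_int a ^ DIM('a)"
    using h by (simp add: power_mult_distrib)
qed

text \<open>
  Coprimality enters here: multiplication by \<open>b\<close> permutes the residues modulo \<open>a\<close>.
\<close>

lemma reps_distinct_mod:
  fixes j j' :: "'a::euclidean_space"
  assumes h: "h > 0" and a: "a > 0" and cop: "coprime a b"
    and j: "j \<in> reps h a" "j' \<in> reps h a" and l: "l \<in> grid h" "l' \<in> grid h"
    and eq: "(of_int b / of_int a) *\<^sub>R j + l = (of_int b / of_int a) *\<^sub>R j' + l'"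
  shows "j = j'"
proof (rule euclidean_eqI)
  fix c :: 'a assume c: "c \<in> Basis"
  have ex: "\<exists>z. y \<bullet> c = of_int z * h" if "y \<in> grid h" for y
  proof -
    from that c obtain z where "y \<bullet> c / h = of_int z" by (auto simp: grid_def elim!: Ints_cases)
    thus ?thesis using h by (intro exI[of _ z]) (simp add: field_simps)
  qed
  from j have jg: "j \<in> grid h" "j' \<in> grid h" by (auto simp: reps_def)
  obtain z z' y y' where z: "j \<bullet> c = of_int z * h" "j' \<bullet> c = of_int z' * h"
      "l \<bullet> c = of_int y * h" "l' \<bullet> c = of_int y' * h"
    using ex[OF jg(1)] ex[OF jg(2)] ex[OF l(1)] ex[OF l(2)] by blast
  have bnd: "0 \<le> z" "z < a" "0 \<le> z'" "z' < a"
    using j c h by (auto simp: reps_def cell_def z zero_le_mult_iff)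
  from arg_cong[OF eq, of "\<lambda>v. v \<bullet> c"]
  have "((of_int b / of_int a) * of_int z + of_int y) * h = ((of_int b / of_int a) * of_int z' + of_int y') * h"
    by (simp add: inner_add_left z algebra_simps)
  hence "(of_int b / of_int a) * of_int z + of_int y = (of_int b / of_int a) * of_int z' + (of_int y' :: real)"
    using h by simp
  hence "real_of_int (b * z + a * y) = of_int (b * z' + a * y')"
    using a by (simp add: field_simps)
  hence "b * z + a * y = b * z' + a * y'" by (simp only: of_int_eq_iff)
  hence "b * (z - z') = a * (y' - y)" by (simp add: algebra_simps)
  hence "a dvd b * (z - z')" by simp
  hence "a dvd z - z'" using cop by (simp add: coprime_dvd_mult_right_iff)
  hence "z = z'" using bnd dvd_imp_le_int[of "z - z'" a] by (cases "z = z'") (auto simp: abs_if split: if_splits)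
  thus "j \<bullet> c = j' \<bullet> c" by (simp add: z)
qed

text \<open>
  The cosets \<open>(b / a) j + grid h\<close>, for \<open>j\<close> running through the representatives, are disjoint subsets
  of the finer lattice \<open>grid (h / a)\<close>.
\<close>

lemma periodize_sum_reps_le:
  fixes g :: "'a::euclidean_space \<Rightarrow> ennreal"
  assumes h: "h > 0" and a: "a > 0" and cop: "coprime a b"
  shows "(\<Sum>j\<in>reps h a. periodize h g (x + (of_int b / of_int a) *\<^sub>R j)) \<le> periodize (h / of_int a) g x"
proof -
  define A where "A j = (\<lambda>l. (of_int b / of_int a) *\<^sub>R j + l) ` grid h" for j :: 'a
  have sub: "A j \<subseteq> grid (h / of_int a)" if "j \<in> reps h a" for j
  proof -
    have "((of_int b / of_int a) *\<^sub>R j + l) \<bullet> c / (h / of_int a) = of_int b * (j \<bullet> c / h) + of_int a * (l \<bullet> c / h)" for l c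
      using h a by (simp add: inner_add_left field_simps)
    moreover have "of_int b * (j \<bullet> c / h) + of_int a * (l \<bullet> c / h) \<in> \<int>" if "l \<in> grid h" "c \<in> Basis" for l c
      using that \<open>j \<in> reps h a\<close> by (intro Ints_add Ints_mult) (auto simp: reps_def grid_def)
    ultimately show ?thesis by (auto simp: A_def grid_def)
  qed
  have "periodize h g (x + (of_int b / of_int a) *\<^sub>R j) = (\<integral>\<^sup>+k. g (x + k) * indicator (A j) k \<partial>count_space UNIV)" for j
  proof -
    have "periodize h g (x + (of_int b / of_int a) *\<^sub>R j)
        = (\<integral>\<^sup>+l. g (x + ((of_int b / of_int a) *\<^sub>R j + l)) \<partial>count_space (grid h))"
      by (simp add: periodize_def add.assoc)
    also have "\<dots> = (\<integral>\<^sup>+k. g (x + k) \<partial>count_space (A j))"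
      by (rule nn_integral_bij_count_space) (auto simp: A_def bij_betw_def inj_on_def)
    also have "\<dots> = (\<integral>\<^sup>+k. g (x + k) * indicator (A j) k \<partial>count_space UNIV)"
      using nn_integral_restrict_space[of "A j" "count_space UNIV" "\<lambda>k. g (x + k)"]
      by (simp add: restrict_count_space)
    finally show ?thesis .
  qed
  hence "(\<Sum>j\<in>reps h a. periodize h g (x + (of_int b / of_int a) *\<^sub>R j))
      = (\<integral>\<^sup>+k. (\<Sum>j\<in>reps h a. g (x + k) * indicator (A j) k) \<partial>count_space UNIV)"
    by (simp add: nn_integral_sum)
  also have "\<dots> \<le> (\<integral>\<^sup>+k. g (x + k) * indicator (grid (h / of_int a)) k \<partial>count_space UNIV)"
  proof (rule nn_integral_mono)
    fix k :: 'a
    show "(\<Sum>j\<in>reps h a. g (x + k) * indicator (A j) k) \<le> g (x + k) * indicator (grid (h / of_int a)) k"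
    proof (cases "\<exists>j\<in>reps h a. k \<in> A j")
      case True
      then obtain j0 where j0: "j0 \<in> reps h a" "k \<in> A j0" by blast
      have "(\<Sum>j\<in>reps h a. g (x + k) * indicator (A j) k) = (\<Sum>j\<in>{j0}. g (x + k) * indicator (A j) k)"
      proof (rule sum.mono_neutral_right)
        show "\<forall>j\<in>reps h a - {j0}. g (x + k) * indicator (A j) k = 0"
          using j0 reps_distinct_mod[OF h a cop _ j0(1)] by (auto simp: A_def split: split_indicator) 
      qed (use j0 reps_card[OF h a] in auto)
      thus ?thesis using j0 sub[OF j0(1)] by (auto split: split_indicator)
    next
      case False
      hence "(\<Sum>j\<in>reps h a. g (x + k) * indicator (A j) k) = 0" by (intro sum.neutral) auto
      thus ?thesis by simp
    qed
  qed
  also have "\<dots> = periodize (h / of_int a) g x"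
    unfolding periodize_def
    using nn_integral_restrict_space[of "grid (h / of_int a)" "count_space UNIV" "\<lambda>k. g (x + k)"]
    by (simp add: restrict_count_space)
  finally show ?thesis .
qed

text \<open>
  Average over the translations by \<open>outer ((1 / a) j) w\<close> with \<open>w \<bullet> s = 1\<close>: the first factor does not notice them,
  because \<open>\<theta> *v q\<close> moves by the period \<open>j\<close>, and the second is replaced by its sum over all
  \<open>(b / a) j\<close>, which is a sum over a finer lattice.
\<close>

lemma torus_mean_parallel:
  fixes F g :: "real ^ 'm \<Rightarrow> ennreal" and s :: "int ^ 'n"
  assumes h: "h > 0" and F: "F \<in> borel_measurable borel" "periodic h F"
    and g: "g \<in> borel_measurable borel"
    and a: "a > 0" and cop: "coprime a b" and s: "real_vec s \<noteq> 0"
    and q: "real_vec q = of_int a *\<^sub>R real_vec s" and q': "real_vec q' = of_int b *\<^sub>R real_vec s"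
    and B: "\<And>x. periodize (h / of_int a) g x \<le> B"
  shows "ennreal (of_int a ^ CARD('m))
      * (\<integral>\<^sup>+\<theta>. F (\<theta> *v real_vec q) * periodize h g (\<theta> *v real_vec q') \<partial>(torus h :: (real ^ 'n ^ 'm) measure))
    \<le> B * (\<integral>\<^sup>+x. F x \<partial>torus h)"
proof -
  note [measurable] = F(1) g measurable_periodize[OF h g]
  let ?P = "periodize h g" and ?S = "real_vec s"
  let ?H = "\<lambda>\<theta> :: real ^ 'n ^ 'm. F (\<theta> *v real_vec q) * ?P (\<theta> *v real_vec q')"
  define t where "t j = outer ((1 / (of_int a * (?S \<bullet> ?S))) *\<^sub>R j) ?S" for j :: "real ^ 'm"
  have per: "periodic h ?H"
    using periodic_mult_vec[OF F(2), of q] periodic_mult_vec[OF periodic_periodize, of h g q']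
    unfolding periodic_def by auto
  have t1: "(\<theta> + t j) *v real_vec q = \<theta> *v real_vec q + j"
    and t2: "(\<theta> + t j) *v real_vec q' = \<theta> *v real_vec q' + (of_int b / of_int a) *\<^sub>R j" for \<theta> j
    using a s by (simp_all add: t_def matrix_vector_mult_add_rdistrib outer_mult_vec q q')
  have F': "F (x + j) = F x" if "j \<in> reps h a" for x j
    using F(2) that by (auto simp: periodic_def reps_def)
  have "of_int a ^ CARD('m) = real (card (reps h a :: (real ^ 'm) set))"
    by (simp add: reps_card[OF h a])
  hence "ennreal (of_int a ^ CARD('m)) * (\<integral>\<^sup>+\<theta>. ?H \<theta> \<partial>torus h)
      = (\<Sum>j\<in>(reps h a :: (real ^ 'm) set). \<integral>\<^sup>+\<theta>. ?H \<theta> \<partial>torus h)"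
    by (simp add: ennreal_of_nat_eq_real_of_nat)
  also have "\<dots> = (\<Sum>j\<in>(reps h a :: (real ^ 'm) set). \<integral>\<^sup>+\<theta>. ?H (\<theta> + t j) \<partial>torus h)"
    by (subst torus_mean_shift[OF h _ per]) auto
  also have "\<dots> = (\<Sum>j\<in>(reps h a :: (real ^ 'm) set).
      \<integral>\<^sup>+\<theta>. F (\<theta> *v real_vec q) * ?P (\<theta> *v real_vec q' + (of_int b / of_int a) *\<^sub>R j) \<partial>torus h)"
    by (intro sum.cong refl) (simp add: t1 t2 F')
  also have "\<dots> = (\<integral>\<^sup>+\<theta>. F (\<theta> *v real_vec q) *
      (\<Sum>j\<in>(reps h a :: (real ^ 'm) set). ?P (\<theta> *v real_vec q' + (of_int b / of_int a) *\<^sub>R j)) \<partial>torus h)"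
    by (subst nn_integral_sum[symmetric]) (auto simp: sum_distrib_left)
  also have "\<dots> \<le> (\<integral>\<^sup>+\<theta>. B * F (\<theta> *v real_vec q) \<partial>(torus h :: (real ^ 'n ^ 'm) measure))"
  proof (rule nn_integral_mono)
    fix \<theta> :: "real ^ 'n ^ 'm"
    have "(\<Sum>j\<in>(reps h a :: (real ^ 'm) set). ?P (\<theta> *v real_vec q' + (of_int b / of_int a) *\<^sub>R j)) \<le> B"
      using periodize_sum_reps_le[OF h a cop] B order_trans by blast
    thus "F (\<theta> *v real_vec q) * (\<Sum>j\<in>(reps h a :: (real ^ 'm) set). ?P (\<theta> *v real_vec q' + (of_int b / of_int a) *\<^sub>R j))
        \<le> B * F (\<theta> *v real_vec q)"
      by (subst mult.commute) (rule mult_right_mono, auto)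
  qed
  also have "\<dots> = B * (\<integral>\<^sup>+x. F x \<partial>torus h)"
  proof -
    have "real_vec q \<noteq> 0" using a s by (simp add: q)
    from torus_mean_mult_vec[OF h F this] show ?thesis
      by (subst nn_integral_cmult) auto
  qed
  finally show ?thesis .
qed

section \<open>Lattice points in residue classes, perturbed powers, parallel integer vectors\<close>

lemma real_vec_inj: "real_vec x = real_vec y \<longleftrightarrow> x = y"
  by (simp add: real_vec_def vec_eq_iff)

lemma real_vec_zero: "real_vec 0 = 0"
  by (simp add: real_vec_def vec_eq_iff)

text \<open>
  A residue class modulo \<open>N\<close> is a translate of the lattice \<open>N \<int>\<^sup>k\<close>. Finiteness is part of the conclusion, since
  \<open>card\<close> of an infinite set would be \<open>0\<close>.
\<close>

lemma lattice_points_in_ball: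
  fixes \<nu> :: "real ^ 'k \<Rightarrow> real" and u :: "int ^ 'k"
  assumes \<nu>: "is_norm \<nu>" and N: "N \<ge> 1"
  defines "S \<equiv> \<lambda>y r. {p. vec_cong p u N \<and> \<nu> (y + real_vec p) < r}"
  shows "finite (S y r)"
    and "ennreal (real (card (S y r))) = periodize (real N) (indicator {x. \<nu> x < r}) (y + real_vec u)"
proof -
  let ?P = "{p. vec_cong p u N}"
  have h: "real N > 0" using N by simp
  have bij: "bij_betw (\<lambda>p. real_vec p - real_vec u) ?P (grid (real N))"
    unfolding bij_betw_def
  proof
    show "inj_on (\<lambda>p. real_vec p - real_vec u) ?P"
      by (rule inj_onI) (simp add: real_vec_inj)
    show "(\<lambda>p. real_vec p - real_vec u) ` ?P = grid (real N)"
    proof (intro equalityI subsetI)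
      fix x assume "x \<in> (\<lambda>p. real_vec p - real_vec u) ` ?P"
      then obtain p where p: "vec_cong p u N" and x: "x = real_vec p - real_vec u" by auto
      show "x \<in> grid (real N)" unfolding grid_vec_iff
      proof
        fix i
        from p have "int N dvd p $ i - u $ i" by (simp add: vec_cong_def cong_iff_dvd_diff)
        then obtain k where "p $ i - u $ i = int N * k" by (auto simp: dvd_def)
        hence "x $ i = real N * of_int k"
          by (simp add: x real_vec_def flip: of_int_diff)
        thus "x $ i / real N \<in> \<int>" using h by simp
      qed
    next
      fix x :: "real ^ 'k" assume "x \<in> grid (real N)"
      hence "\<forall>i. \<exists>k. x $ i / real N = of_int k" by (auto simp: grid_vec_iff elim!: Ints_cases)
      then obtain k where k: "x $ i / real N = of_int (k i)" for i by metis
      define p where "p = (\<chi> i. u $ i + int N * k i)"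
      have "vec_cong p u N" by (simp add: vec_cong_def p_def cong_def)
      moreover have "x = real_vec p - real_vec u"
        using k h by (simp add: vec_eq_iff real_vec_def p_def field_simps)
      ultimately show "x \<in> (\<lambda>p. real_vec p - real_vec u) ` ?P" by auto
    qed
  qed
  have "periodize (real N) (indicator {x. \<nu> x < r}) (y + real_vec u)
      = (\<integral>\<^sup>+p. indicator {x. \<nu> x < r} (y + real_vec u + (real_vec p - real_vec u)) \<partial>count_space ?P)"
    unfolding periodize_def by (rule nn_integral_bij_count_space[OF bij, symmetric])
  also have "\<dots> = (\<integral>\<^sup>+p. indicator (S y r) p \<partial>count_space ?P)"
    by (rule nn_integral_cong) (auto simp: S_def split: split_indicator)
  also have "\<dots> = emeasure (count_space ?P) (S y r)"
    by (rule nn_integral_indicator) (auto simp: S_def)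
  finally have eq: "periodize (real N) (indicator {x. \<nu> x < r}) (y + real_vec u) = emeasure (count_space ?P) (S y r)" .
  show fin: "finite (S y r)"
  proof (rule ccontr)
    assume "infinite (S y r)"
    hence inf: "periodize (real N) (indicator {x. \<nu> x < r}) (y + real_vec u) = \<infinity>"
      unfolding eq by (subst emeasure_count_space_infinite) (auto simp: S_def)
    have "periodize (real N) (indicator {x. \<nu> x < r}) (y + real_vec u)
        \<le> periodize (real N) (indicator {x. \<nu> x < max r 0}) (y + real_vec u)"
      unfolding periodize_def by (intro nn_integral_mono) (auto split: split_indicator)
    with inf have "periodize (real N) (indicator {x. \<nu> x < max r 0}) (y + real_vec u) = \<infinity>"
      by (simp add: top.extremum_unique)
    with grid_count_upper[OF \<nu> h, of "max r 0" "y + real_vec u"] h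
    show False by (simp add: ennreal_top_mult top.extremum_unique)
  qed
  show "ennreal (real (card (S y r))) = periodize (real N) (indicator {x. \<nu> x < r}) (y + real_vec u)"
    unfolding eq using fin
    by (subst emeasure_count_space_finite) (auto simp: S_def ennreal_of_nat_eq_real_of_nat)
qed

lemma lattice_card_upper:
  fixes \<nu> :: "real ^ 'k \<Rightarrow> real"
  assumes \<nu>: "is_norm \<nu>" and N: "N \<ge> 1" and r: "r \<ge> 0"
  shows "real (card {p. vec_cong p u N \<and> \<nu> (real_vec p) < r})
     \<le> unit_ball_volume \<nu> * (r + real N * basis_norm \<nu>) ^ CARD('k) / real N ^ CARD('k)"
proof -
  have h: "real N > 0" using N by simp
  let ?c = "real (card {p. vec_cong p u N \<and> \<nu> (real_vec p) < r})"
  have "ennreal (?c * real N ^ CARD('k)) \<le> ennreal (unit_ball_volume \<nu> * (r + real N * basis_norm \<nu>) ^ CARD('k))"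
    using grid_count_upper[OF \<nu> h r, of "0 + real_vec u"] lattice_points_in_ball(2)[OF \<nu> N, of u 0 r, symmetric]
    by (simp add: ennreal_mult)
  hence "?c * real N ^ CARD('k) \<le> unit_ball_volume \<nu> * (r + real N * basis_norm \<nu>) ^ CARD('k)"
    using r basis_norm_nonneg[OF \<nu>] unit_ball_volume_pos[OF \<nu>] by (subst (asm) ennreal_le_iff) auto
  thus ?thesis using h by (simp add: field_simps)
qed

lemma lattice_card_lower:
  fixes \<nu> :: "real ^ 'k \<Rightarrow> real"
  assumes \<nu>: "is_norm \<nu>" and N: "N \<ge> 1" and r: "r \<ge> real N * basis_norm \<nu>"
  shows "unit_ball_volume \<nu> * (r - real N * basis_norm \<nu>) ^ CARD('k) / real N ^ CARD('k)
     \<le> real (card {p. vec_cong p u N \<and> \<nu> (real_vec p) < r})"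
proof -
  have h: "real N > 0" using N by simp
  let ?c = "real (card {p. vec_cong p u N \<and> \<nu> (real_vec p) < r})"
  have "ennreal (unit_ball_volume \<nu> * (r - real N * basis_norm \<nu>) ^ CARD('k)) \<le> ennreal (?c * real N ^ CARD('k))"
    using grid_count_lower[OF \<nu> h r, of "0 + real_vec u"] lattice_points_in_ball(2)[OF \<nu> N, of u 0 r, symmetric]
    by (simp add: ennreal_mult)
  hence "unit_ball_volume \<nu> * (r - real N * basis_norm \<nu>) ^ CARD('k) \<le> ?c * real N ^ CARD('k)"
    by (subst (asm) ennreal_le_iff) auto
  thus ?thesis using h by (simp add: field_simps)
qed

lemma power_one_plus_le:
  fixes \<delta> :: real
  assumes "0 \<le> \<delta>" "\<delta> \<le> 1"
  shows "(1 + \<delta>) ^ k \<le> 1 + (2 ^ k - 1) * \<delta>"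
proof (induction k)
  case (Suc k)
  let ?c = "2 ^ k - 1 :: real"
  have c: "?c \<ge> 0" by simp
  have "(1 + \<delta>) ^ Suc k \<le> (1 + \<delta>) * (1 + ?c * \<delta>)"
    using Suc assms by simp
  also have "\<dots> = 1 + \<delta> + ?c * \<delta> + ?c * \<delta> * \<delta>" by (simp add: algebra_simps)
  also have "\<dots> \<le> 1 + \<delta> + ?c * \<delta> + ?c * \<delta> * 1"
    using assms c by (intro add_left_mono mult_left_mono) auto
  finally show ?case by (simp add: algebra_simps)
qed simp

text \<open>
  A perturbation \<open>y\<close> of \<open>\<rho>\<close> changes \<open>\<rho> ^ k\<close> by a small relative amount when \<open>y \<le> \<delta> * \<rho>\<close>;
  otherwise \<open>\<rho>\<close> itself is bounded in terms of \<open>y\<close>.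
\<close>

lemma power_perturb_le:
  fixes \<delta> \<rho> y :: real
  assumes l: "0 < \<delta>" "\<delta> \<le> 1" and \<rho>: "0 \<le> \<rho>" and y: "0 \<le> y"
  shows "(\<rho> + y) ^ k \<le> (1 + 2 ^ k * \<delta>) * \<rho> ^ k + (2 / \<delta>) ^ k * y ^ k"
proof (cases "y \<le> \<delta> * \<rho>")
  case True
  have "(\<rho> + y) ^ k \<le> ((1 + \<delta>) * \<rho>) ^ k"
    using True assms by (intro power_mono) (auto simp: algebra_simps)
  also have "\<dots> = (1 + \<delta>) ^ k * \<rho> ^ k" by (rule power_mult_distrib)
  also have "\<dots> \<le> (1 + 2 ^ k * \<delta>) * \<rho> ^ k"
    using power_one_plus_le[of \<delta> k] assms by (intro mult_right_mono) (auto simp: algebra_simps)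
  finally show ?thesis using assms by (smt (verit) divide_nonneg_nonneg mult_nonneg_nonneg zero_le_power)
next
  case False
  hence "\<delta> * \<rho> \<le> y" by simp
  hence "\<rho> \<le> y / \<delta>" using l by (simp add: field_simps)
  moreover have "y \<le> y / \<delta>" using l y mult_right_mono[of \<delta> 1 y] by (simp add: field_simps)
  ultimately have "(\<rho> + y) ^ k \<le> ((2 / \<delta>) * y) ^ k"
    using assms by (intro power_mono) (auto simp: field_simps)
  also have "\<dots> = (2 / \<delta>) ^ k * y ^ k" by (rule power_mult_distrib)
  finally show ?thesis using assms by (smt (verit) mult_nonneg_nonneg zero_le_power)
qed

text \<open>
  The hypothesis reads \<open>A q = B q'\<close> with the integers \<open>A = q' \<bullet> q'\<close> and \<open>B = q \<bullet> q'\<close>. Once \<open>A\<close> and \<open>B\<close> are divided by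
  their gcd, the cofactor of \<open>B\<close> divides every entry of \<open>q\<close>.
\<close>

lemma parallel_int_vectors:
  fixes q q' :: "int ^ 'n"
  assumes q: "q \<noteq> 0" and q': "q' \<noteq> 0"
    and par: "(real_vec q' \<bullet> real_vec q') *\<^sub>R real_vec q = (real_vec q \<bullet> real_vec q') *\<^sub>R real_vec q'"
  obtains a b s where "a > 0" "coprime a b" "q = (\<chi> i. a * s $ i)" "q' = (\<chi> i. b * s $ i)"
proof -
  define A where "A = (\<Sum>i\<in>UNIV. q' $ i * q' $ i)"
  define B where "B = (\<Sum>i\<in>UNIV. q $ i * q' $ i)"
  have eq: "A * q $ i = B * q' $ i" for i
  proof -
    have "real_vec q' \<bullet> real_vec q' = of_int A" "real_vec q \<bullet> real_vec q' = of_int B"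
      by (simp_all add: A_def B_def inner_vec_def real_vec_def)
    with par have "real_of_int A * (real_vec q $ i) = of_int B * (real_vec q' $ i)"
      by (simp add: vec_eq_iff)
    hence "real_of_int (A * q $ i) = of_int (B * q' $ i)" by (simp add: real_vec_def)
    thus ?thesis by (simp only: of_int_eq_iff)
  qed
  from q' obtain i0 where "q' $ i0 \<noteq> 0" by (auto simp: vec_eq_iff)
  hence A: "A > 0" unfolding A_def by (intro sum_pos2[of _ i0]) (auto simp: zero_less_mult_iff)
  from q obtain i1 where "q $ i1 \<noteq> 0" by (auto simp: vec_eq_iff)
  with eq[of i1] A have B: "B \<noteq> 0" by auto
  obtain a' b' where ab: "A = a' * gcd A B" "B = b' * gcd A B" "coprime a' b'"
    using gcd_coprime_exists[of A B] A by auto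
  have g: "gcd A B \<noteq> 0" using A by simp
  have eq': "a' * q $ i = b' * q' $ i" for i
  proof -
    have "gcd A B * (a' * q $ i) = gcd A B * (b' * q' $ i)"
      using eq[of i] ab(1,2) by (metis mult.commute mult.left_commute)
    thus ?thesis using g by (metis mult_left_cancel)
  qed
  have b': "b' \<noteq> 0" using ab B by auto
  have "\<exists>t. q $ i = b' * t" for i
  proof -
    have "b' dvd a' * q $ i" by (simp add: eq')
    hence "b' dvd q $ i" using ab(3) by (simp add: coprime_dvd_mult_right_iff coprime_commute)
    thus ?thesis by (auto simp: dvd_def)
  qed
  then obtain t where t: "q $ i = b' * t i" for i by metis
  have t': "q' $ i = a' * t i" for i
  proof -
    have "b' * q' $ i = b' * (a' * t i)" using eq'[of i] t[of i] by (metis mult.left_commute)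
    thus ?thesis using b' by auto
  qed
  show ?thesis
  proof (rule that[of "\<bar>b'\<bar>" "sgn b' * a'" "\<chi> i. sgn b' * t i"])
    show "\<bar>b'\<bar> > 0" using b' by simp
    show "coprime \<bar>b'\<bar> (sgn b' * a')"
      using ab(3) b' by (cases "b' > 0") (auto simp: coprime_commute)
    show "q = (\<chi> i. \<bar>b'\<bar> * (\<chi> i. sgn b' * t i) $ i)"
      using b' by (cases "b' > 0") (auto simp: vec_eq_iff t)
    show "q' = (\<chi> i. sgn b' * a' * (\<chi> i. sgn b' * t i) $ i)"
      using b' by (cases "b' > 0") (auto simp: vec_eq_iff t')
  qed
qed

section \<open>Summation by parts\<close>

text \<open>
  Write \<open>\<phi> (\<tau> s)\<close> as the telescoping sum of the drops of \<open>\<phi>\<close> from \<open>\<tau> s\<close> on and exchange the two sums. The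
  boundary condition \<open>\<phi> (K + 1) = 0\<close> absorbs the usual boundary term.
\<close>

lemma layer_cake:
  fixes \<phi> :: "nat \<Rightarrow> real" and \<tau> :: "'s \<Rightarrow> nat"
  assumes S: "finite S" and \<tau>: "\<And>s. s \<in> S \<Longrightarrow> \<tau> s \<in> {1..K}" and z: "\<phi> (Suc K) = 0"
  shows "(\<Sum>s\<in>S. \<phi> (\<tau> s)) = (\<Sum>t=1..K. (\<phi> t - \<phi> (Suc t)) * real (card {s\<in>S. \<tau> s \<le> t}))"
proof -
  have tel: "\<phi> k = (\<Sum>t=1..K. (\<phi> t - \<phi> (Suc t)) * (if k \<le> t then 1 else 0))" if "k \<in> {1..K}" for k
  proof -
    have "(\<Sum>t=1..K. (\<phi> t - \<phi> (Suc t)) * (if k \<le> t then 1 else 0)) = (\<Sum>t=k..K. \<phi> t - \<phi> (Suc t))"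
      using that by (intro sum.mono_neutral_cong_right) auto
    also have "\<dots> = \<phi> k - \<phi> (Suc K)"
      using that sum_telescope[of "\<lambda>i. \<phi> (k + i)" "K - k"]
        sum.shift_bounds_cl_nat_ivl[of "\<lambda>t. \<phi> t - \<phi> (Suc t)" 0 k "K - k"]
      by (simp add: atMost_atLeast0 add.commute)
    finally show ?thesis using z by simp
  qed
  have "(\<Sum>s\<in>S. \<phi> (\<tau> s)) = (\<Sum>s\<in>S. \<Sum>t=1..K. (\<phi> t - \<phi> (Suc t)) * (if \<tau> s \<le> t then 1 else 0))"
    by (intro sum.cong refl tel \<tau>)
  also have "\<dots> = (\<Sum>t=1..K. \<Sum>s\<in>S. (\<phi> t - \<phi> (Suc t)) * (if \<tau> s \<le> t then 1 else 0))"
    by (rule sum.swap)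
  also have "\<dots> = (\<Sum>t=1..K. (\<phi> t - \<phi> (Suc t)) * real (card {s\<in>S. \<tau> s \<le> t}))"
    using S by (simp add: sum_distrib_left[symmetric] sum.If_cases Int_def)
  finally show ?thesis .
qed

lemma layer_weights:
  fixes \<phi> :: "nat \<Rightarrow> real"
  assumes z: "\<phi> (Suc K) = 0" and K: "K \<ge> 1"
  shows "(\<Sum>t=1..K. (\<phi> t - \<phi> (Suc t)) * (\<kappa> * real t + C)) = \<kappa> * (\<Sum>t=1..K. \<phi> t) + C * \<phi> 1"
proof -
  have "(\<Sum>t=1..K. \<phi> t) = (\<Sum>t=1..K. (\<phi> t - \<phi> (Suc t)) * real (card {s\<in>{1..K}. s \<le> t}))"
    using layer_cake[of "{1..K}" "\<lambda>x. x" K \<phi>] z by simp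
  also have "\<dots> = (\<Sum>t=1..K. (\<phi> t - \<phi> (Suc t)) * real t)"
  proof (rule sum.cong[OF refl])
    fix t assume "t \<in> {1..K}"
    hence "{s\<in>{1..K}. s \<le> t} = {1..t}" by auto
    thus "(\<phi> t - \<phi> (Suc t)) * real (card {s\<in>{1..K}. s \<le> t}) = (\<phi> t - \<phi> (Suc t)) * real t" by simp
  qed
  finally have 1: "(\<Sum>t=1..K. (\<phi> t - \<phi> (Suc t)) * real t) = (\<Sum>t=1..K. \<phi> t)" ..
  have "(\<Sum>s\<in>{1::nat}. \<phi> s) = (\<Sum>t=1..K. (\<phi> t - \<phi> (Suc t)) * real (card {s\<in>{1}. s \<le> t}))"
    using layer_cake[of "{1}" "\<lambda>x. x" K \<phi>] z K by simp
  also have "\<dots> = (\<Sum>t=1..K. \<phi> t - \<phi> (Suc t))"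
  proof (rule sum.cong[OF refl])
    fix t assume "t \<in> {1..K}"
    hence "{s\<in>{1}. s \<le> t} = {1}" by auto
    thus "(\<phi> t - \<phi> (Suc t)) * real (card {s\<in>{1}. s \<le> t}) = \<phi> t - \<phi> (Suc t)" by simp
  qed
  finally have 2: "(\<Sum>t=1..K. \<phi> t - \<phi> (Suc t)) = \<phi> 1" by simp
  have "(\<Sum>t=1..K. (\<phi> t - \<phi> (Suc t)) * (\<kappa> * real t + C))
      = \<kappa> * (\<Sum>t=1..K. (\<phi> t - \<phi> (Suc t)) * real t) + C * (\<Sum>t=1..K. \<phi> t - \<phi> (Suc t))"
    by (simp add: sum_distrib_left sum.distrib[symmetric] algebra_simps)
  thus ?thesis by (simp only: 1 2)
qed

text \<open>
  If at most (here) or at least (in the next lemma) about \<open>\<kappa> t\<close> of the \<open>\<tau> s\<close> are below \<open>t\<close>, the sum of a non-increasing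
  \<open>\<phi>\<close> over them compares to \<open>\<kappa>\<close> times its sum over integers.
  An affine error \<open>C\<close> in the count only costs \<open>C * \<phi> 1\<close>, a bounded amount.
\<close>

lemma abel_upper:
  fixes \<phi> :: "nat \<Rightarrow> real" and \<tau> :: "'s \<Rightarrow> nat"
  assumes S: "finite S" "\<And>s. s \<in> S \<Longrightarrow> \<tau> s \<in> {1..K}" and z: "\<phi> (Suc K) = 0" and K: "K \<ge> 1"
    and mono: "\<And>t. t \<in> {1..K} \<Longrightarrow> \<phi> (Suc t) \<le> \<phi> t"
    and cnt: "\<And>t. t \<in> {1..K} \<Longrightarrow> real (card {s\<in>S. \<tau> s \<le> t}) \<le> \<kappa> * real t + C"
  shows "(\<Sum>s\<in>S. \<phi> (\<tau> s)) \<le> \<kappa> * (\<Sum>t=1..K. \<phi> t) + C * \<phi> 1"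
proof -
  have "(\<Sum>s\<in>S. \<phi> (\<tau> s)) = (\<Sum>t=1..K. (\<phi> t - \<phi> (Suc t)) * real (card {s\<in>S. \<tau> s \<le> t}))"
    by (rule layer_cake[where \<phi>=\<phi> and \<tau>=\<tau>, OF S z])
  also have "\<dots> \<le> (\<Sum>t=1..K. (\<phi> t - \<phi> (Suc t)) * (\<kappa> * real t + C))"
    using mono cnt by (intro sum_mono mult_left_mono) auto
  finally show ?thesis by (simp only: layer_weights[where \<phi>=\<phi>, OF z K])
qed

lemma abel_lower:
  fixes \<phi> :: "nat \<Rightarrow> real" and \<tau> :: "'s \<Rightarrow> nat"
  assumes S: "finite S" "\<And>s. s \<in> S \<Longrightarrow> \<tau> s \<in> {1..K}" and z: "\<phi> (Suc K) = 0" and K: "K \<ge> 1"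
    and mono: "\<And>t. t \<in> {1..K} \<Longrightarrow> \<phi> (Suc t) \<le> \<phi> t"
    and cnt: "\<And>t. t \<in> {1..K} \<Longrightarrow> \<kappa> * real t + C \<le> real (card {s\<in>S. \<tau> s \<le> t})"
  shows "\<kappa> * (\<Sum>t=1..K. \<phi> t) + C * \<phi> 1 \<le> (\<Sum>s\<in>S. \<phi> (\<tau> s))"
proof -
  have "(\<Sum>t=1..K. (\<phi> t - \<phi> (Suc t)) * (\<kappa> * real t + C))
      \<le> (\<Sum>t=1..K. (\<phi> t - \<phi> (Suc t)) * real (card {s\<in>S. \<tau> s \<le> t}))"
    using mono cnt by (intro sum_mono mult_left_mono) auto
  also have "\<dots> = (\<Sum>s\<in>S. \<phi> (\<tau> s))"
    by (rule layer_cake[where \<phi>=\<phi> and \<tau>=\<tau>, OF S z, symmetric])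
  finally show ?thesis by (simp only: layer_weights[where \<phi>=\<phi>, OF z K])
qed

section \<open>The second moment\<close>

definition int_smul :: "int \<Rightarrow> int ^ 'k \<Rightarrow> int ^ 'k" where
  "int_smul a s = (\<chi> i. a * s $ i)"

lemma real_vec_int_smul: "real_vec (int_smul a s) = of_int a *\<^sub>R real_vec s"
  by (simp add: int_smul_def real_vec_def vec_eq_iff)

text \<open>
  The normalisation of \<open>\<nu>\<^sub>2\<close> enters as the lower bound \<open>1\<close> on non-zero integer vectors, which
  makes \<open>1 \<le> \<nu>\<^sub>2(q)\<^sup>n\<close> equivalent to \<open>q \<noteq> 0\<close>.
\<close>

locale approximation =
  fixes \<psi> :: "real \<Rightarrow> real"
    and v :: "int ^ ('m::finite + 'n::finite)"
    and N :: nat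
    and \<nu>\<^sub>1 :: "real ^ 'm \<Rightarrow> real"
    and \<nu>\<^sub>2 :: "real ^ 'n \<Rightarrow> real"
  assumes dim: "CARD('m) + CARD('n) \<ge> 3"
    and \<psi>_pos: "\<And>t. t \<ge> 1 \<Longrightarrow> \<psi> t > 0"
    and \<psi>_antimono: "\<And>s t. 1 \<le> s \<Longrightarrow> s \<le> t \<Longrightarrow> \<psi> t \<le> \<psi> s"
    and \<psi>_div: "filterlim (\<lambda>k::nat. \<Sum>t=1..k. \<psi> (real t)) at_top sequentially"
    and N: "N \<ge> 1"
    and \<nu>1: "is_norm \<nu>\<^sub>1" and \<nu>2: "is_norm \<nu>\<^sub>2"
    and \<nu>2_ge_1: "\<And>w. w \<noteq> 0 \<Longrightarrow> \<nu>\<^sub>2 (real_vec w) \<ge> 1"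
begin

definition num_class :: "int ^ 'm" where "num_class = (\<chi> i. v $ Inl i)"
definition den_class :: "int ^ 'n" where "den_class = (\<chi> j. v $ Inr j)"

definition height :: "int ^ 'n \<Rightarrow> real" where
  "height q = \<nu>\<^sub>2 (real_vec q) ^ CARD('n)"

definition radius :: "int ^ 'n \<Rightarrow> real" where
  "radius q = root CARD('m) (\<psi> (height q))"

text \<open>
  The residue class of the numerators is absorbed into the centre of the ball; the lattice to be
  summed over is then \<open>N \<int>\<^sup>m\<close> for every \<open>q\<close>.
\<close>

definition target :: "int ^ 'n \<Rightarrow> real ^ 'm \<Rightarrow> ennreal" where
  "target q x = indicator {z. \<nu>\<^sub>1 z < radius q} (x + real_vec num_class)"

definition hits :: "int ^ 'n \<Rightarrow> real ^ 'n ^ 'm \<Rightarrow> nat" where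
  "hits q \<theta> = card {p. vec_cong p num_class N \<and> \<nu>\<^sub>1 (\<theta> *v real_vec q + real_vec p) < radius q}"

definition denominators :: "real \<Rightarrow> (int ^ 'n) set" where
  "denominators T = {q. vec_cong q den_class N \<and> 1 \<le> height q \<and> height q < T}"

definition mean_hits :: "int ^ 'n \<Rightarrow> real" where
  "mean_hits q = unit_ball_volume \<nu>\<^sub>1 / real N ^ CARD('m) * \<psi> (height q)"

lemma N_pos: "real N > 0"
  using N by simp

lemma height_nonneg: "height q \<ge> 0"
  unfolding height_def using is_norm_nonneg[OF \<nu>2] by simp

lemma height_eq_0: "height q = 0 \<longleftrightarrow> q = 0"
  unfolding height_def using is_norm_zero[OF \<nu>2] real_vec_inj[of q 0] by (simp add: real_vec_zero)

lemma height_ge_1_iff: "height q \<ge> 1 \<longleftrightarrow> q \<noteq> 0"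
proof
  assume "q \<noteq> 0"
  thus "height q \<ge> 1" unfolding height_def by (intro one_le_power \<nu>2_ge_1)
qed (use height_eq_0[of q] in auto)

lemma height_int_smul: "height (int_smul a s) = of_int \<bar>a\<bar> ^ CARD('n) * height s"
  by (simp add: height_def real_vec_int_smul is_norm_scaleR[OF \<nu>2] power_mult_distrib)

lemma height_less_iff: "r > 0 \<Longrightarrow> height q < r \<longleftrightarrow> \<nu>\<^sub>2 (real_vec q) < root CARD('n) r"
proof -
  assume "r > 0"
  have "height q < r \<longleftrightarrow> root CARD('n) (height q) < root CARD('n) r" by simp
  also have "root CARD('n) (height q) = \<nu>\<^sub>2 (real_vec q)"
    unfolding height_def by (intro real_root_power_cancel is_norm_nonneg[OF \<nu>2]) simp
  finally show ?thesis .
qed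

lemma finite_height_less: "finite {q. height q < r}"
proof -
  have "finite {q. vec_cong q 0 1 \<and> \<nu>\<^sub>2 (0 + real_vec q) < root CARD('n) (max r 1)}"
    by (rule lattice_points_in_ball[OF \<nu>2]) simp
  moreover have "height q < max r 1" if "height q < r" for q using that by simp
  hence "{q. height q < r} \<subseteq> {q. vec_cong q 0 1 \<and> \<nu>\<^sub>2 (0 + real_vec q) < root CARD('n) (max r 1)}"
    by (auto simp: vec_cong_def height_less_iff[symmetric])
  ultimately show ?thesis by (rule rev_finite_subset)
qed

lemma finite_denominators: "finite (denominators T)"
  by (rule finite_subset[OF _ finite_height_less[of T]]) (auto simp: denominators_def)

lemma radius_pow: "height q \<ge> 1 \<Longrightarrow> radius q ^ CARD('m) = \<psi> (height q)"
  and radius_pos: "height q \<ge> 1 \<Longrightarrow> radius q > 0"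
  using \<psi>_pos[of "height q"] by (auto simp: radius_def)

lemma radius_iff:
  assumes "height q \<ge> 1"
  shows "\<nu>\<^sub>1 x ^ CARD('m) < \<psi> (height q) \<longleftrightarrow> \<nu>\<^sub>1 x < radius q"
proof -
  have "\<nu>\<^sub>1 x ^ CARD('m) < \<psi> (height q) \<longleftrightarrow> root CARD('m) (\<nu>\<^sub>1 x ^ CARD('m)) < root CARD('m) (\<psi> (height q))" by simp
  also have "root CARD('m) (\<nu>\<^sub>1 x ^ CARD('m)) = \<nu>\<^sub>1 x"
    by (intro real_root_power_cancel is_norm_nonneg[OF \<nu>1]) simp
  finally show ?thesis by (simp add: radius_def)
qed

lemma mean_hits_nonneg: "height q \<ge> 1 \<Longrightarrow> mean_hits q \<ge> 0"
  using \<psi>_pos[of "height q"] unit_ball_volume_pos[OF \<nu>1]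
  by (simp add: mean_hits_def)

lemma hits_eq_periodize: "ennreal (real (hits q \<theta>)) = periodize (real N) (target q) (\<theta> *v real_vec q)"
  unfolding hits_def lattice_points_in_ball(2)[OF \<nu>1 N]
  by (simp add: periodize_def target_def ac_simps)

lemma vec_cong_concat: "vec_cong (concat_vec p q) v N \<longleftrightarrow> vec_cong p num_class N \<and> vec_cong q den_class N"
proof -
  have "(\<forall>k. P k) \<longleftrightarrow> (\<forall>i. P (Inl i)) \<and> (\<forall>j. P (Inr j))" for P :: "'m + 'n \<Rightarrow> bool"
    by (metis sumE)
  thus ?thesis by (simp add: vec_cong_def concat_vec_def num_class_def den_class_def)
qed

lemma solution_count_eq: "solution_count \<nu>\<^sub>1 \<nu>\<^sub>2 \<psi> v N \<theta> T = (\<Sum>q\<in>denominators T. hits q \<theta>)"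
proof -
  let ?P = "\<lambda>q. {p. vec_cong p num_class N \<and> \<nu>\<^sub>1 (\<theta> *v real_vec q + real_vec p) < radius q}"
  have "solutions \<nu>\<^sub>1 \<nu>\<^sub>2 \<psi> v N \<theta> T = prod.swap ` Sigma (denominators T) ?P"
    unfolding solutions_def
    by (auto simp: image_iff denominators_def vec_cong_concat height_def[symmetric] radius_iff)
  hence "solution_count \<nu>\<^sub>1 \<nu>\<^sub>2 \<psi> v N \<theta> T = card (Sigma (denominators T) ?P)"
    unfolding solution_count_def by (simp add: card_image)
  also have "\<dots> = (\<Sum>q\<in>denominators T. hits q \<theta>)"
    unfolding hits_def
    by (rule card_SigmaI) (auto simp: finite_denominators lattice_points_in_ball(1)[OF \<nu>1 N])
  finally show ?thesis .
qed

lemma borel_measurable_target[measurable]: "target q \<in> borel_measurable borel"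
proof -
  note [measurable] = borel_measurable_is_norm[OF \<nu>1]
  show ?thesis unfolding target_def[abs_def] by measurable
qed

lemma borel_measurable_hits[measurable]: "(\<lambda>\<theta>. real (hits q \<theta>)) \<in> borel_measurable borel"
proof -
  note [measurable] = measurable_periodize[OF N_pos borel_measurable_target]
  have "(\<lambda>\<theta>. enn2real (ennreal (real (hits q \<theta>)))) \<in> borel_measurable borel"
    unfolding hits_eq_periodize by measurable
  thus ?thesis by simp
qed

lemma mean_target:
  assumes "height q \<ge> 1"
  shows "(\<integral>\<^sup>+x. periodize (real N) (target q) x \<partial>torus (real N)) = ennreal (mean_hits q)"
proof -
  note [measurable] = borel_measurable_is_norm[OF \<nu>1]
  have "(\<integral>\<^sup>+x. target q x \<partial>lborel) = (\<integral>\<^sup>+x. indicator {z. \<nu>\<^sub>1 z < radius q} x \<partial>lborel)"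
    unfolding target_def by (rule nn_integral_lborel_shift) measurable
  also have "\<dots> = ennreal (unit_ball_volume \<nu>\<^sub>1 * \<psi> (height q))"
    using emeasure_norm_ball[OF \<nu>1, of "radius q"] radius_pos[OF assms] radius_pow[OF assms] by simp
  finally show ?thesis
    using N_pos assms unit_ball_volume_pos[OF \<nu>1] \<psi>_pos[of "height q"]
    by (simp add: torus_mean_periodize[OF N_pos] mean_hits_def divide_ennreal)
qed

lemma expectation_hits:
  assumes "height q \<ge> 1"
  shows "(\<integral>\<^sup>+\<theta>. ennreal (real (hits q \<theta>)) \<partial>torus (real N)) = ennreal (mean_hits q)"
proof -
  have "real_vec q \<noteq> 0" using assms height_ge_1_iff[of q] real_vec_inj[of q 0] by (simp add: real_vec_zero)
  thus ?thesis unfolding hits_eq_periodize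
    by (subst torus_mean_mult_vec[OF N_pos measurable_periodize[OF N_pos borel_measurable_target] periodic_periodize])
       (simp_all add: mean_target[OF assms])
qed

definition correlation :: "int ^ 'n \<Rightarrow> int ^ 'n \<Rightarrow> ennreal" where
  "correlation q q' = (\<integral>\<^sup>+\<theta>. ennreal (real (hits q \<theta>)) * ennreal (real (hits q' \<theta>)) \<partial>torus (real N))"

lemma correlation_commute: "correlation q q' = correlation q' q"
  by (simp add: correlation_def mult.commute)

lemma correlation_independent:
  assumes "height q \<ge> 1" "height q' \<ge> 1"
    and "(real_vec q' \<bullet> real_vec q') *\<^sub>R real_vec q \<noteq> (real_vec q \<bullet> real_vec q') *\<^sub>R real_vec q'"
  shows "correlation q q' = ennreal (mean_hits q * mean_hits q')"
  unfolding correlation_def hits_eq_periodize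
  using torus_mean_independent[OF N_pos measurable_periodize[OF N_pos borel_measurable_target] periodic_periodize
     measurable_periodize[OF N_pos borel_measurable_target] periodic_periodize assms(3)] assms(1,2)
  by (simp add: mean_target ennreal_mult mean_hits_nonneg)

definition corr_const :: real where
  "corr_const = (unit_ball_volume \<nu>\<^sub>1 / real N ^ CARD('m))\<^sup>2 * (2 * real N * basis_norm \<nu>\<^sub>1) ^ CARD('m)"

lemma corr_const_nonneg: "corr_const \<ge> 0"
  unfolding corr_const_def using basis_norm_nonneg[OF \<nu>1] by simp

text \<open>
  The excess over independence is a relative error \<open>2 ^ m * \<delta>\<close>, to be made small, plus a term that decays
  in \<open>a\<close>. The parameter \<open>\<delta>\<close> stays free: it is chosen depending on \<open>K\<close> only at the end.
\<close>

lemma correlation_parallel: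
  assumes a: "a > 0" and cop: "coprime a b" and b: "int_smul b s \<noteq> 0" and s: "s \<noteq> 0"
    and \<delta>: "0 < \<delta>" "\<delta> \<le> 1"
  shows "correlation (int_smul a s) (int_smul b s)
    \<le> ennreal ((1 + 2 ^ CARD('m) * \<delta>) * (mean_hits (int_smul a s) * mean_hits (int_smul b s))
        + corr_const / \<delta> ^ CARD('m) * (\<psi> (height (int_smul a s)) / of_int a ^ CARD('m)))"
proof -
  define q where "q = int_smul a s"
  define q' where "q' = int_smul b s"
  let ?c = "unit_ball_volume \<nu>\<^sub>1" and ?\<beta> = "basis_norm \<nu>\<^sub>1"
  have "int_smul a s \<noteq> 0" using a s by (auto simp: int_smul_def vec_eq_iff)
  hence h1: "height q \<ge> 1" "height q' \<ge> 1" using b by (auto simp: q_def q'_def height_ge_1_iff)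
  have s0: "real_vec s \<noteq> 0" using s real_vec_inj[of s 0] by (simp add: real_vec_zero)
  have hp: "real N / of_int a > 0" using N_pos a by simp
  have c: "?c > 0" by (rule unit_ball_volume_pos[OF \<nu>1])
  have \<beta>: "?\<beta> \<ge> 0" by (rule basis_norm_nonneg[OF \<nu>1])
  note rad = radius_pos[OF h1(1)] radius_pos[OF h1(2)]
  define y where "y = real N * ?\<beta> / of_int a"
  have y: "y \<ge> 0" using a \<beta> by (simp add: y_def)
  define B where "B = ?c * (radius q' + y) ^ CARD('m) * (of_int a / real N) ^ CARD('m)"
  have B0: "B \<ge> 0" using c rad y a by (simp add: B_def)
  have B: "periodize (real N / of_int a) (target q') x \<le> ennreal B" for x
  proof -
    have "periodize (real N / of_int a) (target q') x * ennreal ((real N / of_int a) ^ CARD('m))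
       \<le> ennreal (?c * (radius q' + real N / of_int a * ?\<beta>) ^ CARD('m))"
      using grid_count_upper[OF \<nu>1 hp, of "radius q'" "x + real_vec num_class"] rad
      by (simp add: periodize_def target_def ac_simps)
    also have "\<dots> = ennreal B * ennreal ((real N / of_int a) ^ CARD('m))"
      using B0 N_pos a by (simp add: B_def y_def ennreal_mult[symmetric] power_divide field_simps)
    finally have "ennreal ((real N / of_int a) ^ CARD('m)) * periodize (real N / of_int a) (target q') x
        \<le> ennreal ((real N / of_int a) ^ CARD('m)) * ennreal B"
      by (simp only: mult.commute)
    moreover have "0 < (real N / of_int a) ^ CARD('m)" using hp by (rule zero_less_power)
    ultimately show ?thesis using N_pos a by (subst (asm) ennreal_mult_le_mult_iff) auto
  qed
  have "ennreal (of_int a ^ CARD('m)) * correlation q q' \<le> ennreal B * ennreal (mean_hits q)"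
    unfolding correlation_def hits_eq_periodize mean_target[OF h1(1), symmetric]
    by (rule torus_mean_parallel[OF N_pos measurable_periodize[OF N_pos borel_measurable_target]
          periodic_periodize borel_measurable_target a cop s0 _ _ B])
       (simp_all add: q_def q'_def real_vec_int_smul)
  also have "\<dots> = ennreal (of_int a ^ CARD('m)) * ennreal (mean_hits q * (?c / real N ^ CARD('m) * (radius q' + y) ^ CARD('m)))"
    using B0 mean_hits_nonneg[OF h1(1)] a N_pos c rad y
    by (simp add: B_def ennreal_mult[symmetric] power_divide field_simps)
  finally have "correlation q q' \<le> ennreal (mean_hits q * (?c / real N ^ CARD('m) * (radius q' + y) ^ CARD('m)))"
    using a by (subst (asm) ennreal_mult_le_mult_iff) auto
  also have "\<dots> \<le> ennreal (mean_hits q * (?c / real N ^ CARD('m) * ((1 + 2 ^ CARD('m) * \<delta>) * radius q' ^ CARD('m) + (2 / \<delta>) ^ CARD('m) * y ^ CARD('m))))"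
    using mean_hits_nonneg[OF h1(1)] c rad y \<delta> N_pos
    by (intro ennreal_leI mult_left_mono power_perturb_le) auto
  also have "mean_hits q * (?c / real N ^ CARD('m) * ((1 + 2 ^ CARD('m) * \<delta>) * radius q' ^ CARD('m) + (2 / \<delta>) ^ CARD('m) * y ^ CARD('m)))
     = (1 + 2 ^ CARD('m) * \<delta>) * (mean_hits q * mean_hits q') + corr_const / \<delta> ^ CARD('m) * (\<psi> (height q) / of_int a ^ CARD('m))"
    using a N_pos \<delta>
    by (simp add: radius_pow[OF h1(2)] mean_hits_def corr_const_def y_def power_divide power_mult_distrib power2_eq_square field_simps)
  finally show ?thesis by (simp add: q_def q'_def)
qed

text \<open>
  The triples \<open>(a, b, s)\<close> parametrise the ordered pairs \<open>(a s, b s)\<close> of parallel denominators in which the second one is not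
  the higher one. Leaving out coprimality and the residue class only enlarges a sum of non-negative terms.
\<close>

definition triples :: "nat \<Rightarrow> (int \<times> int \<times> (int ^ 'n)) set" where
  "triples K = (SIGMA a:{1..int K}. {-a..a} \<times> {s. s \<noteq> 0 \<and> height (int_smul a s) < real K})"

lemma triples_height: "(a, b, s) \<in> triples K \<Longrightarrow> height (int_smul a s) \<ge> 1"
  by (auto simp: triples_def height_ge_1_iff int_smul_def vec_eq_iff)

lemma finite_triples: "finite (triples K)"
proof -
  have "finite {s. s \<noteq> 0 \<and> height (int_smul a s) < real K}" if "a \<in> {1..int K}" for a
  proof (rule finite_subset[OF _ finite_height_less[of "real K"]], safe)
    fix s assume "height (int_smul a s) < real K"
    moreover have "1 * height s \<le> of_int \<bar>a\<bar> ^ CARD('n) * height s"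
      using that by (intro mult_right_mono height_nonneg one_le_power) auto
    ultimately show "height s < real K" by (simp add: height_int_smul)
  qed
  thus ?thesis unfolding triples_def by (intro finite_SigmaI finite_cartesian_product) auto
qed

definition triple_sum :: "nat \<Rightarrow> real" where
  "triple_sum K = (\<Sum>(a, b, s)\<in>triples K. \<psi> (height (int_smul a s)) / of_int a ^ CARD('m))"

text \<open>
  Either a pair of denominators is essentially uncorrelated, or, up to the order of its members, it comes
  from a triple. The order is settled by comparing heights.
\<close>

lemma correlation_cases:
  assumes q: "q \<in> denominators (real K)" "q' \<in> denominators (real K)" and \<delta>: "0 < \<delta>" "\<delta> \<le> 1"
  shows "correlation q q' \<le> ennreal ((1 + 2 ^ CARD('m) * \<delta>) * (mean_hits q * mean_hits q')) \<or>
    (\<exists>a b s. (a, b, s) \<in> triples K \<and> {(q, q'), (q', q)} = {(int_smul a s, int_smul b s), (int_smul b s, int_smul a s)} \<and>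
      correlation q q' \<le> ennreal ((1 + 2 ^ CARD('m) * \<delta>) * (mean_hits q * mean_hits q')
        + corr_const / \<delta> ^ CARD('m) * (\<psi> (height (int_smul a s)) / of_int a ^ CARD('m))))"
proof -
  have main: "correlation q q' \<le> ennreal ((1 + 2 ^ CARD('m) * \<delta>) * (mean_hits q * mean_hits q')) \<or>
    (\<exists>a b s. (a, b, s) \<in> triples K \<and> q = int_smul a s \<and> q' = int_smul b s \<and>
      correlation q q' \<le> ennreal ((1 + 2 ^ CARD('m) * \<delta>) * (mean_hits q * mean_hits q')
        + corr_const / \<delta> ^ CARD('m) * (\<psi> (height (int_smul a s)) / of_int a ^ CARD('m))))"
    if q: "q \<in> denominators (real K)" "q' \<in> denominators (real K)" and le: "height q' \<le> height q" for q q'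
  proof (cases "(real_vec q' \<bullet> real_vec q') *\<^sub>R real_vec q = (real_vec q \<bullet> real_vec q') *\<^sub>R real_vec q'")
    case False
    from q have h1: "height q \<ge> 1" "height q' \<ge> 1" by (auto simp: denominators_def)
    have "1 * (mean_hits q * mean_hits q') \<le> (1 + 2 ^ CARD('m) * \<delta>) * (mean_hits q * mean_hits q')"
      using \<delta> mean_hits_nonneg h1 by (intro mult_right_mono) auto
    thus ?thesis using correlation_independent[OF h1 False] by (simp add: ennreal_leI)
  next
    case True
    from q have h1: "height q \<ge> 1" "height q' \<ge> 1" and hK: "height q < real K" by (auto simp: denominators_def)
    hence q0: "q \<noteq> 0" "q' \<noteq> 0" by (auto simp: height_ge_1_iff)
    obtain a b s where ab: "a > 0" "coprime a b" "q = int_smul a s" "q' = int_smul b s"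
      using parallel_int_vectors[OF q0 True] unfolding int_smul_def by blast
    have s: "s \<noteq> 0" using q0 ab by (auto simp: int_smul_def vec_eq_iff)
    hence hs: "height s \<ge> 1" by (simp add: height_ge_1_iff)
    have "of_int \<bar>b\<bar> ^ CARD('n) * height s \<le> of_int \<bar>a\<bar> ^ CARD('n) * height s"
      using le ab by (simp add: height_int_smul)
    hence "real_of_int \<bar>b\<bar> ^ CARD('n) \<le> of_int \<bar>a\<bar> ^ CARD('n)" using hs by (simp add: mult_le_cancel_right)
    hence "real_of_int \<bar>b\<bar> \<le> of_int \<bar>a\<bar>" by (simp only: power_mono_iff of_int_0_le_iff abs_ge_zero zero_less_card_finite)
    hence ba: "\<bar>b\<bar> \<le> a" using ab(1) by linarith
    have "real_of_int a \<le> of_int a ^ CARD('n)" using ab(1) by (intro self_le_power) auto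
    also have "\<dots> \<le> of_int \<bar>a\<bar> ^ CARD('n) * height s" using ab(1) hs mult_left_mono[of 1 "height s" "of_int a ^ CARD('n)"] by simp
    also have "\<dots> < real K" using hK ab by (simp add: height_int_smul)
    finally have aK: "a \<le> int K" by linarith
    have "(a, b, s) \<in> triples K"
      using ba aK ab(1) s hK ab(3) by (auto simp: triples_def)
    moreover have "correlation q q' \<le> ennreal ((1 + 2 ^ CARD('m) * \<delta>) * (mean_hits q * mean_hits q')
        + corr_const / \<delta> ^ CARD('m) * (\<psi> (height (int_smul a s)) / of_int a ^ CARD('m)))"
      unfolding ab(3,4) using ab q0(2) s \<delta> by (intro correlation_parallel) auto
    ultimately show ?thesis using ab by blast
  qed
  show ?thesis
  proof (cases "height q' \<le> height q")
    case True
    from main[OF q True] show ?thesis by (elim disjE exE conjE) blast+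
  next
    case False
    hence "height q \<le> height q'" by simp
    from main[OF q(2) q(1) this] show ?thesis
      unfolding correlation_commute[of q' q] mult.commute[of "mean_hits q'"]
      by (elim disjE exE conjE) blast+
  qed
qed

definition count :: "nat \<Rightarrow> real ^ 'n ^ 'm \<Rightarrow> real" where
  "count K \<theta> = (\<Sum>q\<in>denominators (real K). real (hits q \<theta>))"

definition mean_count :: "nat \<Rightarrow> real" where
  "mean_count K = (\<Sum>q\<in>denominators (real K). mean_hits q)"

text \<open>
  Only the pairs in \<open>P\<close> exceed \<open>1 + 2 ^ m * \<delta>\<close> times the uncorrelated value, and each of them is the image of a triple together
  with a Boolean that records the order of the pair; hence the factor \<open>2\<close>.
\<close>

lemma second_moment:
  assumes \<delta>: "0 < \<delta>" "\<delta> \<le> 1"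
  shows "(\<integral>\<^sup>+\<theta>. ennreal ((count K \<theta>)\<^sup>2) \<partial>torus (real N))
    \<le> ennreal ((1 + 2 ^ CARD('m) * \<delta>) * (mean_count K)\<^sup>2 + 2 * corr_const / \<delta> ^ CARD('m) * triple_sum K)"
proof -
  let ?A = "denominators (real K)"
  let ?m = "\<lambda>(q, q'). (1 + 2 ^ CARD('m) * \<delta>) * (mean_hits q * mean_hits q')"
  let ?g = "\<lambda>(a, b, s). corr_const / \<delta> ^ CARD('m) * (\<psi> (height (int_smul a s)) / of_int a ^ CARD('m))"
  have g0: "?g x \<ge> 0" if "x \<in> triples K" for x
    using that \<psi>_pos[OF triples_height] corr_const_nonneg \<delta>
    by (cases x) (auto simp: triples_def less_imp_le intro!: mult_nonneg_nonneg divide_nonneg_nonneg)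
  define x where "x = (\<lambda>(q, q'). enn2real (correlation q q'))"
  have x: "correlation q q' = ennreal (x (q, q'))" if "q \<in> ?A" "q' \<in> ?A" for q q'
  proof -
    have "correlation q q' \<noteq> top"
      using correlation_cases[OF that \<delta>] by (auto simp: top_unique)
    thus ?thesis by (simp add: x_def less_top)
  qed
  define P where "P = {(q, q') \<in> ?A \<times> ?A. x (q, q') > ?m (q, q')}"
  have finP: "finite P" unfolding P_def by (rule finite_subset[of _ "?A \<times> ?A"]) (auto simp: finite_denominators)
  \<comment> \<open>The Boolean tells whether the member with the factor \<open>a\<close> comes first.\<close>
  define i where "i = (\<lambda>((a, b, s :: int ^ 'n), \<sigma>). if \<sigma> then (int_smul a s, int_smul b s) else (int_smul b s, int_smul a s))"
  have "(\<Sum>z\<in>?A \<times> ?A. x z - ?m z) = (\<Sum>z\<in>?A \<times> ?A - P. x z - ?m z) + (\<Sum>z\<in>P. x z - ?m z)"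
    by (rule sum.subset_diff) (auto simp: P_def finite_denominators)
  also have "\<dots> \<le> 0 + (\<Sum>z\<in>P. x z - ?m z)"
    by (intro add_right_mono sum_nonpos) (auto simp: P_def)
  also have "(\<Sum>z\<in>P. x z - ?m z) \<le> (\<Sum>y\<in>triples K \<times> (UNIV :: bool set). ?g (fst y))"
  proof (rule sum_le_included[where i=i])
    show "finite P" by (rule finP)
    show "finite (triples K \<times> (UNIV :: bool set))" by (intro finite_cartesian_product finite_triples) simp
    show "\<forall>y\<in>triples K \<times> (UNIV :: bool set). 0 \<le> ?g (fst y)" using g0 by auto
    show "\<forall>z\<in>P. \<exists>y\<in>triples K \<times> (UNIV :: bool set). i y = z \<and> x z - ?m z \<le> ?g (fst y)"
    proof
      fix z assume z: "z \<in> P"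
      obtain q q' where zq: "z = (q, q')" by (cases z)
      with z have A: "q \<in> ?A" "q' \<in> ?A" and gt: "x (q, q') > ?m (q, q')" by (auto simp: P_def)
      have h1: "height q \<ge> 1" "height q' \<ge> 1" using A by (auto simp: denominators_def)
      have m0: "?m (q, q') \<ge> 0" using \<delta> mean_hits_nonneg h1 by simp
      have "\<not> correlation q q' \<le> ennreal (?m (q, q'))"
        using gt m0 unfolding x[OF A] by (auto simp: ennreal_le_iff)
      with correlation_cases[OF A \<delta>] obtain a b s where t: "(a, b, s) \<in> triples K"
          "{(q, q'), (q', q)} = {(int_smul a s, int_smul b s), (int_smul b s, int_smul a s)}"
          "correlation q q' \<le> ennreal (?m (q, q') + ?g (a, b, s))"
        by auto
      have "x (q, q') \<le> ?m (q, q') + ?g (a, b, s)"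
        using t(3) m0 g0[OF t(1)] unfolding x[OF A] by (subst (asm) ennreal_le_iff) auto
      moreover from t(2) have "(q, q') = i ((a, b, s), True) \<or> (q, q') = i ((a, b, s), False)"
        by (auto simp: i_def doubleton_eq_iff)
      ultimately show "\<exists>y\<in>triples K \<times> (UNIV :: bool set). i y = z \<and> x z - ?m z \<le> ?g (fst y)"
        using t(1) zq by force
    qed
  qed
  also have "(\<Sum>y\<in>triples K \<times> (UNIV :: bool set). ?g (fst y)) = 2 * (\<Sum>y\<in>triples K. ?g y)"
  proof -
    have "(\<Sum>y\<in>triples K \<times> (UNIV :: bool set). ?g (fst y)) = (\<Sum>t\<in>triples K. \<Sum>\<sigma>\<in>(UNIV :: bool set). ?g t)"
      by (simp only: sum.cartesian_product case_prod_beta')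
    also have "\<dots> = 2 * (\<Sum>y\<in>triples K. ?g y)" by (simp add: sum_distrib_left)
    finally show ?thesis .
  qed
  also have "(\<Sum>y\<in>triples K. ?g y) = corr_const / \<delta> ^ CARD('m) * triple_sum K"
    unfolding triple_sum_def by (simp add: sum_distrib_left case_prod_beta')
  finally have "(\<Sum>z\<in>?A \<times> ?A. x z) \<le> (\<Sum>z\<in>?A \<times> ?A. ?m z) + 2 * corr_const / \<delta> ^ CARD('m) * triple_sum K"
    by (simp add: sum_subtractf)
  also have "(\<Sum>z\<in>?A \<times> ?A. ?m z) = (1 + 2 ^ CARD('m) * \<delta>) * (mean_count K)\<^sup>2"
    unfolding mean_count_def power2_eq_square sum_product sum.cartesian_product
    by (simp add: sum_distrib_left case_prod_beta')
  finally have le: "(\<Sum>z\<in>?A \<times> ?A. x z) \<le> (1 + 2 ^ CARD('m) * \<delta>) * (mean_count K)\<^sup>2 + 2 * corr_const / \<delta> ^ CARD('m) * triple_sum K" .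
  have "ennreal ((count K \<theta>)\<^sup>2) = (\<Sum>z\<in>?A \<times> ?A. ennreal (real (hits (fst z) \<theta>)) * ennreal (real (hits (snd z) \<theta>)))" for \<theta>
    unfolding count_def power2_eq_square sum_product sum.cartesian_product
    by (subst sum_ennreal[symmetric]) (auto simp: case_prod_beta' ennreal_mult)
  hence "(\<integral>\<^sup>+\<theta>. ennreal ((count K \<theta>)\<^sup>2) \<partial>torus (real N)) = (\<Sum>z\<in>?A \<times> ?A. correlation (fst z) (snd z))"
    unfolding correlation_def by (simp add: nn_integral_sum)
  also have "\<dots> = (\<Sum>z\<in>?A \<times> ?A. ennreal (x z))"
    by (intro sum.cong refl) (use x in auto)
  also have "\<dots> = ennreal (\<Sum>z\<in>?A \<times> ?A. x z)"
    by (rule sum_ennreal) (auto simp: x_def)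
  also have "\<dots> \<le> ennreal ((1 + 2 ^ CARD('m) * \<delta>) * (mean_count K)\<^sup>2 + 2 * corr_const / \<delta> ^ CARD('m) * triple_sum K)"
    by (rule ennreal_leI[OF le])
  finally show ?thesis .
qed

end

section \<open>From a sparse sequence to all integers\<close>

lemma filterlim_root_at_top:
  assumes "k > 0"
  shows "filterlim (root k) at_top at_top"
  unfolding filterlim_at_top
proof
  fix Z :: real
  have "eventually (\<lambda>x. max Z 0 ^ k \<le> x) at_top" by (rule eventually_ge_at_top)
  thus "eventually (\<lambda>x. Z \<le> root k x) at_top"
  proof eventually_elim
    case (elim x)
    hence "root k (max Z 0 ^ k) \<le> root k x" using assms by simp
    thus ?case using assms by (simp add: real_root_power_cancel)
  qed
qed

text \<open>
  The increments of \<open>P\<close> are bounded, so \<open>P\<close> at its first passage of \<open>j ^ L\<close> is \<open>j ^ L + O(1)\<close>, and the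
  quotient of consecutive such values tends to \<open>1\<close>. Monotonicity then traps \<open>S K / P K\<close> between quotients
  formed at neighbouring passages.
\<close>

lemma tendsto_along_powers:
  fixes S P :: "nat \<Rightarrow> real"
  assumes S: "\<And>K. S K \<ge> 0" "mono S" and P: "P 0 = 0" "mono P" "\<And>K. P (Suc K) \<le> P K + B"
    and top: "filterlim P at_top sequentially" and L: "L \<ge> 1"
  defines "k \<equiv> \<lambda>j. LEAST K. real j ^ L \<le> P K"
  assumes lim: "(\<lambda>j. S (k (Suc j)) / P (k (Suc j))) \<longlonglongrightarrow> \<kappa>"
  shows "(\<lambda>K. S K / P K) \<longlonglongrightarrow> \<kappa>"
proof -
  have ex: "\<exists>K. real j ^ L \<le> P K" for j
    using top by (metis (mono_tags) filterlim_at_top eventually_sequentially order_refl)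
  have lo: "real j ^ L \<le> P (k j)" for j
    unfolding k_def by (rule LeastI_ex[OF ex])
  have hi: "P (k (Suc j)) \<le> real (Suc j) ^ L + B" for j
  proof -
    have "k (Suc j) \<noteq> 0"
    proof
      assume "k (Suc j) = 0"
      with lo[of "Suc j"] P(1) have "real (Suc j) ^ L \<le> 0" by simp
      moreover have "real (Suc j) ^ L > 0" by simp
      ultimately show False by linarith
    qed
    then obtain K where K: "k (Suc j) = Suc K" by (cases "k (Suc j)") auto
    hence "\<not> real (Suc j) ^ L \<le> P K"
      unfolding k_def by (metis lessI not_less_Least)
    with P(3)[of K] K show ?thesis by simp
  qed
  have B: "B \<ge> 0" using P(3)[of 0] P(2) by (metis add.commute add_0 monoD P(1) le0 order_trans)
  have pos: "P (k (Suc j)) > 0" for j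
    using lo[of "Suc j"] by (rule less_le_trans[rotated]) simp
  have norm: "(\<lambda>j. P (k (Suc j)) / real (Suc j) ^ L) \<longlonglongrightarrow> 1"
  proof (rule tendsto_sandwich[where f="\<lambda>_. 1" and h="\<lambda>j. 1 + B / real (Suc j)"])
    show "eventually (\<lambda>j. 1 \<le> P (k (Suc j)) / real (Suc j) ^ L) sequentially"
    proof (intro always_eventually allI)
      fix j show "1 \<le> P (k (Suc j)) / real (Suc j) ^ L"
        using lo[of "Suc j"] by (simp del: of_nat_Suc)
    qed
    show "eventually (\<lambda>j. P (k (Suc j)) / real (Suc j) ^ L \<le> 1 + B / real (Suc j)) sequentially"
    proof (intro always_eventually allI)
      fix j
      have "real (Suc j) \<le> real (Suc j) ^ L" using L by (intro self_le_power) auto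
      hence "B / real (Suc j) ^ L \<le> B / real (Suc j)" using B by (intro divide_left_mono) auto
      moreover have "P (k (Suc j)) / real (Suc j) ^ L \<le> (real (Suc j) ^ L + B) / real (Suc j) ^ L"
        using hi[of j] by (intro divide_right_mono) auto
      ultimately show "P (k (Suc j)) / real (Suc j) ^ L \<le> 1 + B / real (Suc j)"
        by (simp add: add_divide_distrib)
    qed
    show "(\<lambda>j. 1 + B / real (Suc j)) \<longlonglongrightarrow> 1" by real_asymp
  qed simp
  have "(\<lambda>j. (real (Suc (Suc j)) / real (Suc j)) ^ L) \<longlonglongrightarrow> 1 ^ L"
    by (intro tendsto_power) real_asymp
  hence "(\<lambda>j. P (k (Suc (Suc j))) / real (Suc (Suc j)) ^ L / (P (k (Suc j)) / real (Suc j) ^ L)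
      * (real (Suc (Suc j)) / real (Suc j)) ^ L) \<longlonglongrightarrow> 1 / 1 * 1 ^ L"
    by (intro tendsto_mult tendsto_divide norm LIMSEQ_Suc[OF norm]) auto
  also have "(\<lambda>j. P (k (Suc (Suc j))) / real (Suc (Suc j)) ^ L / (P (k (Suc j)) / real (Suc j) ^ L)
      * (real (Suc (Suc j)) / real (Suc j)) ^ L) = (\<lambda>j. P (k (Suc (Suc j))) / P (k (Suc j)))"
    using pos by (intro ext) (simp add: power_divide field_simps)
  finally have ratio: "(\<lambda>j. P (k (Suc (Suc j))) / P (k (Suc j))) \<longlonglongrightarrow> 1" by simp
  have up: "(\<lambda>j. S (k (Suc (Suc j))) / P (k (Suc j))) \<longlonglongrightarrow> \<kappa>"
  proof -
    have "(\<lambda>j. S (k (Suc (Suc j))) / P (k (Suc (Suc j))) * (P (k (Suc (Suc j))) / P (k (Suc j)))) \<longlonglongrightarrow> \<kappa> * 1"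
      by (intro tendsto_mult ratio LIMSEQ_Suc[OF lim])
    moreover have "P (k (Suc j)) \<noteq> 0" for j using pos[of j] by simp
    ultimately show ?thesis by simp
  qed
  have low: "(\<lambda>j. S (k (Suc j)) / P (k (Suc (Suc j)))) \<longlonglongrightarrow> \<kappa>"
  proof -
    have "(\<lambda>j. S (k (Suc j)) / P (k (Suc j)) / (P (k (Suc (Suc j))) / P (k (Suc j)))) \<longlonglongrightarrow> \<kappa> / 1"
      by (intro tendsto_divide ratio lim) auto
    moreover have "P (k (Suc j)) \<noteq> 0" for j using pos[of j] by simp
    ultimately show ?thesis by simp
  qed
  \<comment> \<open>Once \<open>P K \<ge> 1\<close>, the number \<open>J K + 1\<close> is the largest \<open>j\<close> with \<open>j ^ L \<le> P K\<close>, so \<open>K\<close> lies between \<open>k (J K + 1)\<close> and \<open>k (J K + 2)\<close>.\<close>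
  define J where "J K = nat \<lfloor>root L (P K)\<rfloor> - 1" for K
  have root_top: "filterlim (\<lambda>K. root L (P K)) at_top sequentially"
    using L by (intro filterlim_compose[OF filterlim_root_at_top top]) auto
  have Jtop: "filterlim J sequentially sequentially"
    unfolding J_def filterlim_at_top
  proof
    fix Z :: nat
    have "eventually (\<lambda>K. real (Suc Z) \<le> root L (P K)) sequentially"
      using root_top by (simp add: filterlim_at_top)
    thus "eventually (\<lambda>K. Z \<le> nat \<lfloor>root L (P K)\<rfloor> - 1) sequentially"
    proof eventually_elim
      case (elim K)
      hence "int (Suc Z) \<le> \<lfloor>root L (P K)\<rfloor>" by (simp add: le_floor_iff)
      thus ?case by linarith
    qed
  qed
  have between: "eventually (\<lambda>K. k (Suc (J K)) \<le> K \<and> K \<le> k (Suc (Suc (J K)))) sequentially"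
  proof -
    have "eventually (\<lambda>K. 1 \<le> root L (P K)) sequentially"
      using root_top by (simp add: filterlim_at_top)
    moreover have "eventually (\<lambda>K. 1 \<le> P K) sequentially"
      using top by (simp add: filterlim_at_top)
    ultimately show ?thesis
    proof eventually_elim
      case (elim K)
      have rp: "root L (P K) ^ L = P K" using elim L by (simp add: real_root_pow_pos2)
      have fl: "1 \<le> \<lfloor>root L (P K)\<rfloor>" using elim by (simp add: le_floor_iff)
      have SJ: "real (Suc (J K)) = of_int \<lfloor>root L (P K)\<rfloor>" using fl by (simp add: J_def)
      have "real (Suc (J K)) ^ L \<le> root L (P K) ^ L"
        unfolding SJ using fl by (intro power_mono) auto
      hence 1: "k (Suc (J K)) \<le> K" unfolding k_def rp by (rule Least_le)
      have "root L (P K) < real (Suc (Suc (J K)))"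
        using SJ by linarith
      hence "P K < real (Suc (Suc (J K))) ^ L"
        using elim L by (subst rp[symmetric], intro power_strict_mono) auto
      hence "P K < P (k (Suc (Suc (J K))))" using lo by (rule less_le_trans)
      hence 2: "K \<le> k (Suc (Suc (J K)))" using P(2) by (meson linorder_not_less monoD nle_le)
      from 1 2 show ?case ..
    qed
  qed
  show ?thesis
  proof (rule tendsto_sandwich)
    show "((\<lambda>K. S (k (Suc (J K))) / P (k (Suc (Suc (J K))))) \<longlongrightarrow> \<kappa>) sequentially"
      by (rule filterlim_compose[OF low Jtop])
    show "((\<lambda>K. S (k (Suc (Suc (J K)))) / P (k (Suc (J K)))) \<longlongrightarrow> \<kappa>) sequentially"
      by (rule filterlim_compose[OF up Jtop])
    show "eventually (\<lambda>K. S (k (Suc (J K))) / P (k (Suc (Suc (J K)))) \<le> S K / P K) sequentially"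
      using between
    proof eventually_elim
      case (elim K)
      have "0 < P (k (Suc (J K)))" by (rule pos)
      also have "\<dots> \<le> P K" using elim P(2) by (auto dest: monoD)
      finally show ?case using elim S P(2) by (intro frac_le) (auto dest: monoD)
    qed
    show "eventually (\<lambda>K. S K / P K \<le> S (k (Suc (Suc (J K)))) / P (k (Suc (J K)))) sequentially"
      using between
    proof eventually_elim
      case (elim K)
      show ?case using elim S P(2) pos by (intro frac_le) (auto dest: monoD)
    qed
  qed
qed

section \<open>The contribution of parallel denominators\<close>

context approximation
begin

definition Psi :: "nat \<Rightarrow> real" where
  "Psi K = (\<Sum>t=1..K. \<psi> (real t))"

lemma Psi_simps[simp]: "Psi 0 = 0" "Psi (Suc K) = Psi K + \<psi> (real (Suc K))"
  by (simp_all add: Psi_def)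

lemma Psi_mono: "mono Psi"
  using \<psi>_pos by (intro incseq_SucI) (simp add: less_imp_le)

lemma Psi_nonneg: "Psi K \<ge> 0"
  using Psi_mono by (metis Psi_simps(1) le0 monoD)

lemma Psi_at_top: "filterlim Psi at_top sequentially"
  unfolding Psi_def by (rule \<psi>_div)

lemma Psi_pos: "K \<ge> 1 \<Longrightarrow> Psi K > 0"
  unfolding Psi_def using \<psi>_pos by (intro sum_pos) auto

text \<open>
  Since \<open>\<psi>\<close> is non-increasing, \<open>\<psi>(c t)\<close> is at most each of the \<open>c\<close> values \<open>\<psi>(u)\<close> with \<open>c (t - 1) < u \<le> c t\<close>.
\<close>

lemma dilate_sum:
  assumes "c \<ge> 1"
  shows "real c * (\<Sum>t=1..T. \<psi> (real (c * t))) \<le> Psi (c * T)"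
proof (induction T)
  case (Suc T)
  have "real c * \<psi> (real (c * Suc T)) = (\<Sum>u\<in>{c*T<..c*T+c}. \<psi> (real (c * Suc T)))" by simp
  also have "\<dots> \<le> (\<Sum>u\<in>{c*T<..c*T+c}. \<psi> (real u))"
    by (intro sum_mono \<psi>_antimono) (auto simp flip: of_nat_add of_nat_mult simp del: of_nat_add of_nat_mult)
  also have "Psi (c * T) + (\<Sum>u\<in>{c*T<..c*T+c}. \<psi> (real u)) = Psi (c * Suc T)"
  proof -
    have "{1..c * Suc T} = {1..c*T} \<union> {c*T<..c*T+c}" by auto
    thus ?thesis unfolding Psi_def by (subst sum.union_disjoint[symmetric]) auto
  qed
  ultimately show ?case using Suc by (simp add: distrib_left)
qed simp

definition height_const :: real where
  "height_const = unit_ball_volume \<nu>\<^sub>2 * (1 + basis_norm \<nu>\<^sub>2) ^ CARD('n)"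

lemma height_const_pos: "height_const > 0"
  unfolding height_const_def using unit_ball_volume_pos[OF \<nu>2] basis_norm_nonneg[OF \<nu>2]
  by (intro mult_pos_pos zero_less_power) auto

lemma card_height_less:
  assumes r: "r \<ge> 1"
  shows "real (card {q. height q < r}) \<le> height_const * r"
proof -
  have root1: "root CARD('n) r \<ge> 1" using r by simp
  have \<beta>: "basis_norm \<nu>\<^sub>2 \<ge> 0" by (rule basis_norm_nonneg[OF \<nu>2])
  have "{q. height q < r} = {p. vec_cong p 0 1 \<and> \<nu>\<^sub>2 (real_vec p) < root CARD('n) r}"
    using r by (auto simp: vec_cong_def height_less_iff)
  hence "real (card {q. height q < r}) \<le> unit_ball_volume \<nu>\<^sub>2 * (root CARD('n) r + basis_norm \<nu>\<^sub>2) ^ CARD('n)"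
    using lattice_card_upper[OF \<nu>2, of 1 "root CARD('n) r" 0] r by simp
  also have "\<dots> \<le> unit_ball_volume \<nu>\<^sub>2 * ((1 + basis_norm \<nu>\<^sub>2) * root CARD('n) r) ^ CARD('n)"
    using unit_ball_volume_pos[OF \<nu>2] root1 \<beta> mult_left_mono[of 1 "root CARD('n) r" "basis_norm \<nu>\<^sub>2"]
    by (intro mult_left_mono power_mono) (auto simp: algebra_simps)
  also have "\<dots> = height_const * r"
    using r by (simp add: height_const_def power_mult_distrib)
  finally show ?thesis .
qed

text \<open>
  Rounding \<open>height s\<close> down to an integer \<open>t\<close> and summing by parts replaces the sum over \<open>s\<close> by a sum over \<open>t\<close> of \<open>\<psi>(a\<^sup>n t)\<close>,
  which monotonicity bounds by \<open>a\<^sup>-\<^sup>n Psi K\<close>.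
\<close>

lemma dilated_height_sum:
  assumes a: "a \<ge> 1"
  shows "(\<Sum>s\<in>{s. s \<noteq> 0 \<and> height (int_smul a s) < real K}. \<psi> (height (int_smul a s)))
    \<le> 2 * height_const * Psi K / of_int a ^ CARD('n)"
proof (cases "K = 0")
  case True
  have e: "{s. s \<noteq> 0 \<and> height (int_smul a s) < real K} = {}"
    using True height_nonneg by (auto simp: not_less)
  show ?thesis unfolding e using True by simp
next
  case False
  let ?S = "{s. s \<noteq> 0 \<and> height (int_smul a s) < real K}"
  define c where "c = nat a ^ CARD('n)"
  have c: "c \<ge> 1" using a by (simp add: c_def)
  have rc: "real c = of_int a ^ CARD('n)" using a by (simp add: c_def)
  have hc: "height (int_smul a s) = real c * height s" for s
    using a by (simp add: height_int_smul rc)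
  have le_dil: "height s \<le> height (int_smul a s)" for s
    using c height_nonneg[of s] mult_right_mono[of 1 "real c" "height s"] by (simp add: hc)
  have finS: "finite ?S"
    by (rule finite_subset[OF _ finite_height_less[of "real K"]]) (use le_dil le_less_trans in blast)
  define \<tau> where "\<tau> s = nat \<lfloor>height s\<rfloor>" for s
  \<comment> \<open>The cut-off keeps \<open>\<phi>\<close> non-increasing and makes it vanish beyond \<open>K div c\<close>.\<close>
  define \<phi> where "\<phi> t = (if c * t \<le> K then \<psi> (real (c * t)) else 0)" for t
  have h1: "height s \<ge> 1" if "s \<in> ?S" for s using that by (simp add: height_ge_1_iff)
  have \<tau>: "real (\<tau> s) \<le> height s" "\<tau> s \<ge> 1" if "s \<in> ?S" for s
    using h1[OF that] by (auto simp: \<tau>_def le_nat_iff le_floor_iff)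
  have c\<tau>: "c * \<tau> s \<le> K" if "s \<in> ?S" for s
  proof -
    have "real (c * \<tau> s) \<le> real c * height s" using \<tau>(1)[OF that] by (simp add: mult_left_mono)
    also have "\<dots> < real K" using that by (simp add: hc)
    finally have "c * \<tau> s < K" by (simp only: of_nat_less_iff)
    thus ?thesis by simp
  qed
  have "(\<Sum>s\<in>?S. \<psi> (height (int_smul a s))) \<le> (\<Sum>s\<in>?S. \<phi> (\<tau> s))"
  proof (rule sum_mono)
    fix s assume s: "s \<in> ?S"
    have "1 \<le> c * \<tau> s" using c \<tau>(2)[OF s] by simp
    hence "1 \<le> real (c * \<tau> s)" by linarith
    moreover have "real (c * \<tau> s) \<le> real c * height s" using \<tau>(1)[OF s] by (simp add: mult_left_mono)
    ultimately have "\<psi> (real c * height s) \<le> \<psi> (real (c * \<tau> s))" by (rule \<psi>_antimono)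
    thus "\<psi> (height (int_smul a s)) \<le> \<phi> (\<tau> s)" using c\<tau>[OF s] by (simp add: \<phi>_def hc)
  qed
  also have "\<dots> \<le> (2 * height_const) * (\<Sum>t=1..K. \<phi> t) + 0 * \<phi> 1"
  proof (rule abel_upper)
    show "finite ?S" by (rule finS)
    show "\<tau> s \<in> {1..K}" if "s \<in> ?S" for s
    proof -
      have "\<tau> s \<le> c * \<tau> s" using c by simp
      hence "\<tau> s \<le> K" using c\<tau>[OF that] by linarith
      thus ?thesis using \<tau>(2)[OF that] by simp
    qed
    have "K < c * Suc K" using c by (metis Suc_le_eq mult_le_mono1 nat_mult_1)
    thus "\<phi> (Suc K) = 0" by (simp add: \<phi>_def)
    show "K \<ge> 1" using False by simp
    show "\<phi> (Suc t) \<le> \<phi> t" if "t \<in> {1..K}" for t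
    proof -
      have "1 \<le> c * t" using c that by simp
      hence "\<psi> (real (c * Suc t)) \<le> \<psi> (real (c * t))" "\<psi> (real (c * t)) > 0"
        by (intro \<psi>_antimono \<psi>_pos; simp flip: of_nat_mult)+
      thus ?thesis by (auto simp: \<phi>_def)
    qed
    show "real (card {s \<in> ?S. \<tau> s \<le> t}) \<le> 2 * height_const * real t + 0" if t: "t \<in> {1..K}" for t
    proof -
      have "{s \<in> ?S. \<tau> s \<le> t} \<subseteq> {q. height q < real t + 1}"
      proof safe
        fix s assume "\<tau> s \<le> t"
        thus "height s < real t + 1" unfolding \<tau>_def by linarith
      qed
      hence "real (card {s \<in> ?S. \<tau> s \<le> t}) \<le> real (card {q. height q < real t + 1})"
        by (intro of_nat_mono card_mono finite_height_less)
      also have "\<dots> \<le> height_const * (real t + 1)" by (rule card_height_less) simp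
      also have "\<dots> \<le> height_const * (2 * real t)" using t height_const_pos by (intro mult_left_mono) auto
      finally show ?thesis by simp
    qed
  qed
  also have "(\<Sum>t=1..K. \<phi> t) = (\<Sum>t=1..K div c. \<psi> (real (c * t)))"
  proof (rule sum.mono_neutral_cong_right)
    have "c * t \<le> K \<longleftrightarrow> t \<le> K div c" for t
      using c by (simp add: less_eq_div_iff_mult_less_eq mult.commute)
    thus "\<forall>i\<in>{1..K} - {1..K div c}. \<phi> i = 0" "\<And>x. x \<in> {1..K div c} \<Longrightarrow> \<phi> x = \<psi> (real (c * x))"
      by (auto simp: \<phi>_def)
    show "{1..K div c} \<subseteq> {1..K}" using div_le_dividend[of K c] by auto
  qed simp
  also have "\<dots> \<le> Psi K / real c"
  proof -
    have "real c * (\<Sum>t=1..K div c. \<psi> (real (c * t))) \<le> Psi (c * (K div c))" by (rule dilate_sum[OF c])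
    also have "\<dots> \<le> Psi K" by (rule monoD[OF Psi_mono]) simp
    finally show ?thesis using c by (simp add: field_simps)
  qed
  finally show ?thesis using height_const_pos by (simp add: rc mult_left_mono)
qed

text \<open>
  There are \<open>2 a + 1 \<le> 3 a\<close> values of \<open>b\<close>, so the terms with a given \<open>a\<close> contribute \<open>O(a * a\<^sup>-\<^sup>n * a\<^sup>-\<^sup>m)\<close> times \<open>Psi K\<close>,
  and \<open>m + n \<ge> 3\<close> leaves at most \<open>O(a\<^sup>-\<^sup>2)\<close>.
\<close>

lemma triple_sum_le: "\<exists>C\<ge>0. \<forall>K. triple_sum K \<le> C * Psi K"
proof -
  define Z where "Z = (\<Sum>k. inverse (real k ^ 2))"
  have sumZ: "summable (\<lambda>k. inverse (real k ^ 2))" by (rule inverse_power_summable) simp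
  have "triple_sum K \<le> 6 * height_const * Z * Psi K" for K
  proof -
    let ?S = "\<lambda>a. {s. s \<noteq> 0 \<and> height (int_smul a s) < real K}"
    have finS: "finite (?S a)" if "a \<in> {1..int K}" for a
    proof (rule finite_subset[of _ "(\<lambda>(a, b, s). s) ` triples K"])
      show "?S a \<subseteq> (\<lambda>(a, b, s). s) ` triples K"
      proof
        fix s assume "s \<in> ?S a"
        hence "(a, 0, s) \<in> triples K" using that by (auto simp: triples_def)
        thus "s \<in> (\<lambda>(a, b, s). s) ` triples K" by force
      qed
    qed (simp add: finite_triples)
    have "triple_sum K = (\<Sum>a\<in>{1..int K}. \<Sum>(b, s)\<in>{-a..a} \<times> ?S a. \<psi> (height (int_smul a s)) / of_int a ^ CARD('m))"
      unfolding triple_sum_def triples_def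
      by (subst sum.Sigma[symmetric]) (use finS in auto)
    also have "\<dots> \<le> (\<Sum>a\<in>{1..int K}. 6 * height_const * Psi K * inverse (of_int a ^ 2))"
    proof (rule sum_mono)
      fix a assume a: "a \<in> {1..int K}"
      let ?a = "real_of_int a"
      have nonneg: "0 \<le> \<psi> (height (int_smul a s))" if "s \<in> ?S a" for s
      proof -
        have "int_smul a s \<noteq> 0" using that a by (auto simp: int_smul_def vec_eq_iff)
        thus ?thesis using \<psi>_pos[of "height (int_smul a s)"] by (simp add: height_ge_1_iff)
      qed
      have "(\<Sum>(b, s)\<in>{-a..a} \<times> ?S a. \<psi> (height (int_smul a s)) / ?a ^ CARD('m))
         = (\<Sum>b\<in>{-a..a}. \<Sum>s\<in>?S a. \<psi> (height (int_smul a s)) / ?a ^ CARD('m))"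
        by (rule sum.cartesian_product[symmetric])
      also have "\<dots> = (2 * ?a + 1) * ((\<Sum>s\<in>?S a. \<psi> (height (int_smul a s))) / ?a ^ CARD('m))"
        using a by (simp add: sum_divide_distrib)
      also have "\<dots> \<le> (3 * ?a) * ((2 * height_const * Psi K / ?a ^ CARD('n)) / ?a ^ CARD('m))"
        using a dilated_height_sum[of a K] height_const_pos Psi_nonneg[of K] nonneg
        by (intro mult_mono divide_right_mono divide_nonneg_nonneg sum_nonneg) auto
      also have "\<dots> = 6 * height_const * Psi K * (?a / ?a ^ (CARD('m) + CARD('n)))"
        by (simp add: power_add field_simps)
      also have "\<dots> \<le> 6 * height_const * Psi K * inverse (?a ^ 2)"
      proof (intro mult_left_mono)
        have "?a ^ 3 \<le> ?a ^ (CARD('m) + CARD('n))" using a dim by (intro power_increasing) auto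
        hence "?a / ?a ^ (CARD('m) + CARD('n)) \<le> ?a / ?a ^ 3" using a by (intro divide_left_mono) auto
        also have "\<dots> = inverse (?a ^ 2)" using a by (simp add: power3_eq_cube power2_eq_square field_simps)
        finally show "?a / ?a ^ (CARD('m) + CARD('n)) \<le> inverse (?a ^ 2)" .
      qed (use height_const_pos Psi_nonneg[of K] in auto)
      finally show "(\<Sum>(b, s)\<in>{-a..a} \<times> ?S a. \<psi> (height (int_smul a s)) / ?a ^ CARD('m))
         \<le> 6 * height_const * Psi K * inverse (?a ^ 2)" .
    qed
    also have "\<dots> = 6 * height_const * Psi K * (\<Sum>a\<in>{1..int K}. inverse (of_int a ^ 2))"
      by (simp add: sum_distrib_left)
    also have "(\<Sum>a\<in>{1..int K}. inverse (of_int a ^ 2)) = (\<Sum>k\<in>{1..K}. inverse (real k ^ 2))"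
      using image_int_atLeastAtMost[of 1 K] sum.reindex[of int "{1..K}" "\<lambda>a. inverse (real_of_int a ^ 2)"]
      by simp
    also have "6 * height_const * Psi K * \<dots> \<le> 6 * height_const * Psi K * Z"
      unfolding Z_def using height_const_pos Psi_nonneg[of K] sumZ
      by (intro mult_left_mono sum_le_suminf) auto
    finally show ?thesis by (simp add: mult.commute mult.left_commute)
  qed
  moreover have "Z \<ge> 0" unfolding Z_def using sumZ by (intro suminf_nonneg) auto
  ultimately show ?thesis using height_const_pos
    by (intro exI[of _ "6 * height_const * Z"]) auto
qed

end

context approximation
begin

section \<open>The mean number of solutions\<close>

definition den_count :: "real \<Rightarrow> real" where
  "den_count t = real (card {q. vec_cong q den_class N \<and> height q < t})"

definition den_density :: real where
  "den_density = unit_ball_volume \<nu>\<^sub>2 / real N ^ CARD('n)"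

lemma den_density_pos: "den_density > 0"
  unfolding den_density_def using unit_ball_volume_pos[OF \<nu>2] N_pos by simp

lemma den_count_mono: "s \<le> t \<Longrightarrow> den_count s \<le> den_count t"
  unfolding den_count_def
  by (intro of_nat_mono card_mono finite_subset[OF _ finite_height_less[of t]]) auto

text \<open>
  With \<open>r = t\<^sup>1\<^sup>/\<^sup>n\<close>, the count lies between \<open>den_density * (r - \<beta>)\<^sup>n\<close> and \<open>den_density * (r + \<beta>)\<^sup>n\<close>,
  and \<open>r\<^sup>n = t\<close>.
\<close>

lemma den_count_asymp: "((\<lambda>t. den_count t / t) \<longlongrightarrow> den_density) at_top"
proof -
  define \<beta> where "\<beta> = real N * basis_norm \<nu>\<^sub>2"
  have \<beta>: "\<beta> \<ge> 0" using basis_norm_nonneg[OF \<nu>2] by (simp add: \<beta>_def)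
  let ?n = "CARD('n)"
  have eq: "den_count t = real (card {p. vec_cong p den_class N \<and> \<nu>\<^sub>2 (real_vec p) < root ?n t})" if "t > 0" for t
    unfolding den_count_def using that by (simp add: height_less_iff)
  have root_top: "filterlim (root ?n) at_top at_top"
    by (rule filterlim_root_at_top) simp
  have lim: "((\<lambda>t. den_density * (1 + c / root ?n t) ^ ?n) \<longlongrightarrow> den_density * (1 + 0) ^ ?n) at_top" for c
    by (intro tendsto_intros tendsto_divide_0[OF tendsto_const] filterlim_at_top_imp_at_infinity root_top)
  have pw: "den_density * (1 + c / root ?n t) ^ ?n = unit_ball_volume \<nu>\<^sub>2 * (root ?n t + c) ^ ?n / real N ^ ?n / t"
    if "t > 0" for t c
  proof -
    have "1 + c / root ?n t = (root ?n t + c) / root ?n t" using that by (simp add: field_simps)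
    thus ?thesis using that by (simp add: den_density_def power_divide)
  qed
  show ?thesis
  proof (rule tendsto_sandwich)
    show "((\<lambda>t. den_density * (1 + (- \<beta>) / root ?n t) ^ ?n) \<longlongrightarrow> den_density) at_top"
      using lim[of "- \<beta>"] by simp
    show "((\<lambda>t. den_density * (1 + \<beta> / root ?n t) ^ ?n) \<longlongrightarrow> den_density) at_top"
      using lim[of \<beta>] by simp
    have "eventually (\<lambda>t. \<beta> \<le> root ?n t) at_top"
      using root_top by (simp add: filterlim_at_top)
    thus "eventually (\<lambda>t. den_density * (1 + (- \<beta>) / root ?n t) ^ ?n \<le> den_count t / t) at_top"
      using eventually_gt_at_top[of 0]
    proof eventually_elim
      case (elim t)
      show ?case unfolding pw[OF elim(2)] eq[OF elim(2)]
        using lattice_card_lower[OF \<nu>2 N, of "root ?n t" den_class] elim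
        by (intro divide_right_mono) (auto simp: \<beta>_def)
    qed
    show "eventually (\<lambda>t. den_count t / t \<le> den_density * (1 + \<beta> / root ?n t) ^ ?n) at_top"
      using eventually_gt_at_top[of 0]
    proof eventually_elim
      case (elim t)
      show ?case unfolding pw[OF elim] eq[OF elim]
        using lattice_card_upper[OF \<nu>2 N, of "root ?n t" den_class] elim
        by (intro divide_right_mono) (auto simp: \<beta>_def)
    qed
  qed
qed

lemma den_count_linear:
  assumes \<epsilon>: "\<epsilon> > 0"
  obtains C where "C \<ge> 0" "\<And>t. t \<ge> 0 \<Longrightarrow> \<bar>den_count t - den_density * t\<bar> \<le> \<epsilon> * t + C"
proof -
  have "eventually (\<lambda>t. dist (den_count t / t) den_density < \<epsilon>) at_top"
    by (rule tendstoD[OF den_count_asymp \<epsilon>])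
  then obtain t0 where t0: "\<And>t. t \<ge> t0 \<Longrightarrow> dist (den_count t / t) den_density < \<epsilon>"
    by (auto simp: eventually_at_top_linorder)
  define t1 where "t1 = max t0 1"
  define C where "C = den_count t1 + den_density * t1"
  have dc: "den_count t \<ge> 0" for t by (simp add: den_count_def)
  have C: "C \<ge> 0" unfolding C_def t1_def using dc den_density_pos by simp
  have "\<bar>den_count t - den_density * t\<bar> \<le> \<epsilon> * t + C" if t: "t \<ge> 0" for t
  proof (cases "t \<ge> t1")
    case True
    hence tp: "t > 0" "t \<ge> t0" by (auto simp: t1_def)
    have "\<bar>den_count t - den_density * t\<bar> = \<bar>den_count t / t - den_density\<bar> * t"
      using tp by (simp add: abs_mult[symmetric] field_simps flip: abs_of_pos)
    also have "\<dots> \<le> \<epsilon> * t" using t0[OF tp(2)] tp by (intro mult_right_mono) (auto simp: dist_real_def)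
    finally show ?thesis using C by simp
  next
    case False
    have "den_count t \<le> den_count t1" "den_density * t \<le> den_density * t1" "0 \<le> den_density * t" "0 \<le> \<epsilon> * t"
      using False t den_density_pos \<epsilon> by (auto intro!: den_count_mono)
    thus ?thesis using dc[of t] dc[of t1] unfolding C_def by linarith
  qed
  with C show ?thesis by (rule that)
qed

definition psi_sum :: "nat \<Rightarrow> real" where
  "psi_sum K = (\<Sum>q\<in>denominators (real K). \<psi> (height q))"

text \<open>
  Rounding the heights down gives an upper bound for the sum and rounding them up a lower one; both
  are evaluated by parts from the count of denominators. The lower count loses one, because \<open>q = 0\<close> is a lattice point but not
  a denominator.
\<close>

lemma psi_sum_bounds:
  assumes \<epsilon>: "\<epsilon> > 0"
  obtains C where "C \<ge> 0" "\<And>K. K \<ge> 1 \<Longrightarrow> \<bar>psi_sum K - den_density * Psi K\<bar> \<le> \<epsilon> * Psi K + C"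
proof -
  obtain C0 where C0: "C0 \<ge> 0" "\<And>t. t \<ge> 0 \<Longrightarrow> \<bar>den_count t - den_density * t\<bar> \<le> \<epsilon> * t + C0"
    using den_count_linear[OF \<epsilon>] by blast
  define C where "C = (den_density + \<epsilon> + C0 + 1) * \<psi> 1"
  have \<psi>1: "\<psi> 1 > 0" by (rule \<psi>_pos) simp
  have C: "C \<ge> 0" unfolding C_def using den_density_pos \<epsilon> C0 \<psi>1 by simp
  have "\<bar>psi_sum K - den_density * Psi K\<bar> \<le> \<epsilon> * Psi K + C" if K: "K \<ge> 1" for K
  proof -
    let ?A = "denominators (real K)"
    define \<phi> where "\<phi> t = (if t \<le> K then \<psi> (real t) else 0)" for t
    have h1: "height q \<ge> 1" "height q < real K" if "q \<in> ?A" for q using that by (auto simp: denominators_def)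
    have z: "\<phi> (Suc K) = 0" by (simp add: \<phi>_def)
    have mono: "\<phi> (Suc t) \<le> \<phi> t" if "t \<in> {1..K}" for t
      using that \<psi>_antimono[of "real t" "real (Suc t)"] \<psi>_pos[of "real t"] by (auto simp: \<phi>_def)
    have \<phi>Psi: "(\<Sum>t=1..K. \<phi> t) = Psi K" by (simp add: \<phi>_def Psi_def)
    have \<phi>1: "\<phi> 1 = \<psi> 1" using K by (simp add: \<phi>_def)
    have fl: "nat \<lfloor>height q\<rfloor> \<in> {1..K}" "real (nat \<lfloor>height q\<rfloor>) \<le> height q" if "q \<in> ?A" for q
      using h1[OF that] by (auto simp: le_nat_iff le_floor_iff nat_le_iff floor_le_iff)
    have ce: "nat \<lceil>height q\<rceil> \<in> {1..K}" "height q \<le> real (nat \<lceil>height q\<rceil>)" if "q \<in> ?A" for q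
      using h1[OF that] by (auto simp: nat_le_iff ceiling_le_iff le_nat_iff le_ceiling_iff of_nat_ceiling)
    have "psi_sum K \<le> (\<Sum>q\<in>?A. \<phi> (nat \<lfloor>height q\<rfloor>))"
      unfolding psi_sum_def
    proof (rule sum_mono)
      fix q assume q: "q \<in> ?A"
      show "\<psi> (height q) \<le> \<phi> (nat \<lfloor>height q\<rfloor>)"
        using fl[OF q] \<psi>_antimono[of "real (nat \<lfloor>height q\<rfloor>)" "height q"] by (auto simp: \<phi>_def)
    qed
    also have "\<dots> \<le> (den_density + \<epsilon>) * (\<Sum>t=1..K. \<phi> t) + (den_density + \<epsilon> + C0) * \<phi> 1"
    proof (rule abel_upper[OF finite_denominators fl(1) z K mono])
      fix t assume t: "t \<in> {1..K}"
      have "real (card {q \<in> ?A. nat \<lfloor>height q\<rfloor> \<le> t}) \<le> den_count (real t + 1)"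
        unfolding den_count_def
      proof (intro of_nat_mono card_mono finite_subset[OF _ finite_height_less[of "real t + 1"]] subsetI)
        fix q assume "q \<in> {q \<in> ?A. nat \<lfloor>height q\<rfloor> \<le> t}"
        thus "q \<in> {q. vec_cong q den_class N \<and> height q < real t + 1}"
          by (auto simp: denominators_def) linarith
      qed auto
      also have "\<dots> \<le> (den_density + \<epsilon>) * (real t + 1) + C0"
        using C0(2)[of "real t + 1"] by (simp add: algebra_simps abs_le_iff)
      finally show "real (card {q \<in> ?A. nat \<lfloor>height q\<rfloor> \<le> t}) \<le> (den_density + \<epsilon>) * real t + (den_density + \<epsilon> + C0)"
        by (simp add: algebra_simps)
    qed
    also have "\<dots> \<le> den_density * Psi K + \<epsilon> * Psi K + C"
      unfolding \<phi>Psi \<phi>1 using \<psi>1 by (simp add: C_def algebra_simps)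
    finally have up: "psi_sum K \<le> den_density * Psi K + \<epsilon> * Psi K + C" .
    have "den_density * Psi K - \<epsilon> * Psi K - C \<le> (den_density - \<epsilon>) * (\<Sum>t=1..K. \<phi> t) + (- (C0 + 1)) * \<phi> 1"
      unfolding \<phi>Psi \<phi>1
      using \<psi>1 den_density_pos \<epsilon> mult_nonneg_nonneg[of "den_density + \<epsilon>" "\<psi> 1"]
      by (simp add: C_def algebra_simps)
    also have "\<dots> \<le> (\<Sum>q\<in>?A. \<phi> (nat \<lceil>height q\<rceil>))"
    proof (rule abel_lower[OF finite_denominators ce(1) z K mono])
      fix t assume t: "t \<in> {1..K}"
      have fin: "finite {q \<in> ?A. nat \<lceil>height q\<rceil> \<le> t}" using finite_denominators by simp
      have "{q. vec_cong q den_class N \<and> height q < real t} \<subseteq> insert 0 {q \<in> ?A. nat \<lceil>height q\<rceil> \<le> t}"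
      proof
        fix q assume q: "q \<in> {q. vec_cong q den_class N \<and> height q < real t}"
        hence "nat \<lceil>height q\<rceil> \<le> t" by (simp add: nat_le_iff ceiling_le_iff)
        thus "q \<in> insert 0 {q \<in> ?A. nat \<lceil>height q\<rceil> \<le> t}"
          using q t by (auto simp: denominators_def height_ge_1_iff)
      qed
      hence "card {q. vec_cong q den_class N \<and> height q < real t} \<le> card (insert 0 {q \<in> ?A. nat \<lceil>height q\<rceil> \<le> t})"
        using fin by (intro card_mono) auto
      also have "\<dots> \<le> Suc (card {q \<in> ?A. nat \<lceil>height q\<rceil> \<le> t})" using fin by (simp add: card_insert_if)
      finally have "den_count (real t) \<le> real (card {q \<in> ?A. nat \<lceil>height q\<rceil> \<le> t}) + 1"
        unfolding den_count_def by linarith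
      thus "(den_density - \<epsilon>) * real t + - (C0 + 1) \<le> real (card {q \<in> ?A. nat \<lceil>height q\<rceil> \<le> t})"
        using C0(2)[of "real t"] by (simp add: algebra_simps abs_le_iff)
    qed
    also have "\<dots> \<le> psi_sum K"
      unfolding psi_sum_def
    proof (rule sum_mono)
      fix q assume q: "q \<in> ?A"
      show "\<phi> (nat \<lceil>height q\<rceil>) \<le> \<psi> (height q)"
        using ce[OF q] h1[OF q] \<psi>_antimono[of "height q" "real (nat \<lceil>height q\<rceil>)"] by (auto simp: \<phi>_def)
    qed
    finally have low: "den_density * Psi K - \<epsilon> * Psi K - C \<le> psi_sum K" .
    from up low show ?thesis by (simp add: abs_le_iff)
  qed
  with C show ?thesis by (rule that)
qed

lemma psi_sum_asymp: "(\<lambda>K. psi_sum K / Psi K) \<longlonglongrightarrow> den_density"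
proof (rule tendstoI)
  fix \<epsilon> :: real assume "\<epsilon> > 0"
  hence e: "\<epsilon> / 3 > 0" by simp
  obtain C where C: "C \<ge> 0" "\<And>K. K \<ge> 1 \<Longrightarrow> \<bar>psi_sum K - den_density * Psi K\<bar> \<le> \<epsilon> / 3 * Psi K + C"
    using psi_sum_bounds[OF e] by blast
  have "eventually (\<lambda>K. 3 * C / \<epsilon> + 1 \<le> Psi K) sequentially"
    using Psi_at_top by (simp add: filterlim_at_top)
  thus "eventually (\<lambda>K. dist (psi_sum K / Psi K) den_density < \<epsilon>) sequentially"
    using eventually_ge_at_top[of 1]
  proof eventually_elim
    case (elim K)
    have P: "Psi K > 0" by (rule Psi_pos[OF elim(2)])
    have "C < \<epsilon> / 3 * Psi K" using elim(1) \<open>\<epsilon> > 0\<close> by (simp add: field_simps)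
    hence "\<bar>psi_sum K - den_density * Psi K\<bar> < \<epsilon> * Psi K"
      using C(2)[OF elim(2)] mult_pos_pos[OF \<open>\<epsilon> > 0\<close> P] by linarith
    moreover have "psi_sum K / Psi K - den_density = (psi_sum K - den_density * Psi K) / Psi K"
      using P by (simp add: field_simps)
    ultimately show ?case using P by (simp add: dist_real_def field_simps)
  qed
qed

definition main_const :: real where
  "main_const = unit_ball_volume \<nu>\<^sub>1 * unit_ball_volume \<nu>\<^sub>2 / real N ^ (CARD('m) + CARD('n))"

lemma main_const_pos: "main_const > 0"
  unfolding main_const_def using unit_ball_volume_pos[OF \<nu>1] unit_ball_volume_pos[OF \<nu>2] N_pos by simp

lemma mean_count_asymp: "(\<lambda>K. mean_count K / Psi K) \<longlonglongrightarrow> main_const"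
proof -
  have "mean_count K = unit_ball_volume \<nu>\<^sub>1 / real N ^ CARD('m) * psi_sum K" for K
    unfolding mean_count_def psi_sum_def mean_hits_def by (simp add: sum_distrib_left)
  moreover have "main_const = unit_ball_volume \<nu>\<^sub>1 / real N ^ CARD('m) * den_density"
    by (simp add: main_const_def den_density_def power_add)
  ultimately show ?thesis
    using tendsto_mult_left[OF psi_sum_asymp, of "unit_ball_volume \<nu>\<^sub>1 / real N ^ CARD('m)"] by simp
qed

section \<open>Almost sure convergence\<close>

lemma count_nonneg: "count K \<theta> \<ge> 0"
  unfolding count_def by (intro sum_nonneg) simp

lemma mean_count_nonneg: "mean_count K \<ge> 0"
  unfolding mean_count_def by (intro sum_nonneg mean_hits_nonneg) (auto simp: denominators_def)

lemma denominators_mono: "S \<le> T \<Longrightarrow> denominators S \<subseteq> denominators T"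
  by (auto simp: denominators_def)

lemma count_mono: "K \<le> L \<Longrightarrow> count K \<theta> \<le> count L \<theta>"
  unfolding count_def by (intro sum_mono2 finite_denominators denominators_mono) auto

lemma borel_measurable_count[measurable]: "count K \<in> borel_measurable borel"
  unfolding count_def[abs_def] by measurable

lemma periodic_hits: "periodic (real N) (hits q)"
  unfolding periodic_def
proof (intro allI ballI)
  fix \<theta> l :: "real ^ 'n ^ 'm" assume "l \<in> grid (real N)"
  hence "ennreal (real (hits q (\<theta> + l))) = ennreal (real (hits q \<theta>))"
    unfolding hits_eq_periodize
    using periodic_mult_vec[OF periodic_periodize, of "real N" "target q" q] by (simp add: periodic_def)
  thus "hits q (\<theta> + l) = hits q \<theta>" by simp
qed

lemma periodic_count: "periodic (real N) (count K)"
  using periodic_hits unfolding periodic_def count_def by simp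

text \<open>
  The identity \<open>(X - m)\<^sup>2 + 2 m X = X\<^sup>2 + m\<^sup>2\<close> has non-negative terms on both sides, so it can be integrated without
  integrability conditions, and the common finite term cancels.
\<close>

lemma variance_le:
  assumes \<delta>: "0 < \<delta>" "\<delta> \<le> 1"
  shows "(\<integral>\<^sup>+\<theta>. ennreal ((count K \<theta> - mean_count K)\<^sup>2) \<partial>torus (real N))
    \<le> ennreal (2 ^ CARD('m) * \<delta> * (mean_count K)\<^sup>2 + 2 * corr_const / \<delta> ^ CARD('m) * triple_sum K)"
proof -
  let ?m = "mean_count K" and ?V = "2 ^ CARD('m) * \<delta> * (mean_count K)\<^sup>2 + 2 * corr_const / \<delta> ^ CARD('m) * triple_sum K"
  let ?I = "\<integral>\<^sup>+\<theta>. ennreal ((count K \<theta> - ?m)\<^sup>2) \<partial>torus (real N)"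
  have m: "?m \<ge> 0" by (rule mean_count_nonneg)
  have "(\<integral>\<^sup>+\<theta>. ennreal (count K \<theta>) \<partial>torus (real N)) = (\<Sum>q\<in>denominators (real K). \<integral>\<^sup>+\<theta>. ennreal (real (hits q \<theta>)) \<partial>torus (real N))"
    unfolding count_def by (subst nn_integral_sum[symmetric]) (auto simp: sum_ennreal)
  also have "\<dots> = (\<Sum>q\<in>denominators (real K). ennreal (mean_hits q))"
    by (intro sum.cong refl expectation_hits) (auto simp: denominators_def)
  also have "\<dots> = ennreal ?m"
    unfolding mean_count_def by (rule sum_ennreal) (auto simp: denominators_def intro: mean_hits_nonneg)
  finally have E: "(\<integral>\<^sup>+\<theta>. ennreal (count K \<theta>) \<partial>torus (real N)) = ennreal ?m" .
  have "?I + ennreal (2 * ?m * ?m) = (\<integral>\<^sup>+\<theta>. ennreal ((count K \<theta> - ?m)\<^sup>2) + ennreal (2 * ?m) * ennreal (count K \<theta>) \<partial>torus (real N))"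
    using m by (subst nn_integral_add) (auto simp: nn_integral_cmult E ennreal_mult)
  also have "\<dots> = (\<integral>\<^sup>+\<theta>. ennreal ((count K \<theta>)\<^sup>2) + ennreal (?m\<^sup>2) \<partial>torus (real N))"
  proof (rule nn_integral_cong)
    fix \<theta> :: "real ^ 'n ^ 'm"
    have "ennreal ((count K \<theta> - ?m)\<^sup>2) + ennreal (2 * ?m) * ennreal (count K \<theta>) = ennreal ((count K \<theta> - ?m)\<^sup>2 + 2 * ?m * count K \<theta>)"
      using m count_nonneg[of K \<theta>] by (simp add: ennreal_plus ennreal_mult)
    also have "(count K \<theta> - ?m)\<^sup>2 + 2 * ?m * count K \<theta> = (count K \<theta>)\<^sup>2 + ?m\<^sup>2"
      by (simp add: power2_eq_square algebra_simps)
    finally show "ennreal ((count K \<theta> - ?m)\<^sup>2) + ennreal (2 * ?m) * ennreal (count K \<theta>) = ennreal ((count K \<theta>)\<^sup>2) + ennreal (?m\<^sup>2)"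
      by (simp add: ennreal_plus)
  qed
  also have "\<dots> = (\<integral>\<^sup>+\<theta>. ennreal ((count K \<theta>)\<^sup>2) \<partial>torus (real N)) + ennreal (?m\<^sup>2)"
    by (subst nn_integral_add) (auto simp: emeasure_torus[OF N_pos])
  also have "\<dots> \<le> ennreal ((1 + 2 ^ CARD('m) * \<delta>) * ?m\<^sup>2 + 2 * corr_const / \<delta> ^ CARD('m) * triple_sum K) + ennreal (?m\<^sup>2)"
    by (intro add_right_mono second_moment \<delta>)
  also have "\<dots> = ennreal ?V + ennreal (2 * ?m * ?m)"
  proof -
    have "triple_sum K \<ge> 0" unfolding triple_sum_def
      using \<psi>_pos[OF triples_height] by (intro sum_nonneg) (auto simp: triples_def less_imp_le)
    hence "0 \<le> 2 * corr_const / \<delta> ^ CARD('m) * triple_sum K" using corr_const_nonneg \<delta> by simp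
    moreover have "0 \<le> 2 ^ CARD('m) * \<delta> * ?m\<^sup>2" using \<delta> by simp
    ultimately show ?thesis using m
      by (simp add: ennreal_plus[symmetric] power2_eq_square algebra_simps del: ennreal_plus)
  qed
  finally show "?I \<le> ennreal ?V"
    by (simp add: add.commute[of _ "ennreal (2 * ?m * ?m)"] ennreal_add_left_cancel_le)
qed

text \<open>
  The subsequence \<open>K\<^sub>j\<close> along which \<open>Psi\<close> grows like \<open>j ^ (2 m + 2)\<close>: with \<open>\<delta> = j\<^sup>-\<^sup>2\<close> both
  terms of the variance are of relative size \<open>j\<^sup>-\<^sup>2\<close>.
\<close>

definition checkpoint :: "nat \<Rightarrow> nat" where
  "checkpoint j = (LEAST K. real j ^ (2 * CARD('m) + 2) \<le> Psi K)"

lemma Psi_checkpoint: "real j ^ (2 * CARD('m) + 2) \<le> Psi (checkpoint j)"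
proof -
  have "\<exists>K. real j ^ (2 * CARD('m) + 2) \<le> Psi K"
    using Psi_at_top by (metis (mono_tags) filterlim_at_top eventually_sequentially order_refl)
  thus ?thesis unfolding checkpoint_def by (rule LeastI_ex)
qed

text \<open>
  Here \<open>\<delta> = j\<^sup>-\<^sup>2\<close> and \<open>Psi K \<ge> j\<^sup>2\<^sup>m\<^sup>+\<^sup>2\<close>, so that \<open>\<delta>\<^sup>-\<^sup>m / Psi K \<le> j\<^sup>-\<^sup>2\<close> as well. The mean is \<open>O(Psi K)\<close> because
  the quotient converges.
\<close>

lemma relative_variance_checkpoint:
  "\<exists>C\<ge>0. \<forall>j. (\<integral>\<^sup>+\<theta>. ennreal (((count (checkpoint (Suc j)) \<theta> - mean_count (checkpoint (Suc j))) / Psi (checkpoint (Suc j)))\<^sup>2) \<partial>torus (real N))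
     \<le> ennreal (C / real (Suc j) ^ 2)"
proof -
  obtain C0 where C0: "C0 \<ge> 0" "\<And>K. triple_sum K \<le> C0 * Psi K" using triple_sum_le by blast
  obtain B where B: "\<And>K. norm (mean_count K / Psi K) \<le> B"
    using convergent_imp_Bseq[OF convergentI[OF mean_count_asymp]] unfolding Bseq_def by blast
  have B0: "B \<ge> 0" using B[of 0] norm_ge_zero order_trans by blast
  define C where "C = 2 ^ CARD('m) * B\<^sup>2 + 2 * corr_const * C0"
  have C: "C \<ge> 0" unfolding C_def using corr_const_nonneg C0(1) by simp
  have "(\<integral>\<^sup>+\<theta>. ennreal (((count K \<theta> - mean_count K) / Psi K)\<^sup>2) \<partial>torus (real N)) \<le> ennreal (C / real (Suc j) ^ 2)"
    if K: "K = checkpoint (Suc j)" for K j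
  proof -
    let ?j = "real (Suc j)"
    define P where "P = Psi K"
    have Pj: "?j ^ (2 * CARD('m) + 2) \<le> P" using Psi_checkpoint[of "Suc j"] by (simp add: K P_def)
    have "0 < ?j ^ (2 * CARD('m) + 2)" by simp
    hence P: "P > 0" using Pj by linarith
    define \<delta> where "\<delta> = 1 / ?j ^ 2"
    have \<delta>: "0 < \<delta>" "\<delta> \<le> 1" by (auto simp: \<delta>_def simp del: of_nat_Suc)
    have "(\<integral>\<^sup>+\<theta>. ennreal (((count K \<theta> - mean_count K) / P)\<^sup>2) \<partial>torus (real N))
        = (\<integral>\<^sup>+\<theta>. ennreal (1 / P\<^sup>2) * ennreal ((count K \<theta> - mean_count K)\<^sup>2) \<partial>torus (real N))"
      by (simp add: ennreal_mult[symmetric] power_divide)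
    also have "\<dots> = ennreal (1 / P\<^sup>2) * (\<integral>\<^sup>+\<theta>. ennreal ((count K \<theta> - mean_count K)\<^sup>2) \<partial>torus (real N))"
      by (rule nn_integral_cmult) measurable
    also have "\<dots> \<le> ennreal (1 / P\<^sup>2) * ennreal (2 ^ CARD('m) * \<delta> * (mean_count K)\<^sup>2 + 2 * corr_const / \<delta> ^ CARD('m) * triple_sum K)"
      by (intro mult_left_mono variance_le \<delta>) simp
    also have "\<dots> = ennreal (1 / P\<^sup>2 * (2 ^ CARD('m) * \<delta> * (mean_count K)\<^sup>2 + 2 * corr_const / \<delta> ^ CARD('m) * triple_sum K))"
      by (rule ennreal_mult'[symmetric]) simp
    also have "\<dots> \<le> ennreal (C / ?j ^ 2)"
    proof (rule ennreal_leI)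
      have "mean_count K \<le> B * P" using B[of K] mean_count_nonneg[of K] P by (simp add: P_def[symmetric] field_simps)
      hence "(mean_count K)\<^sup>2 \<le> (B * P)\<^sup>2" using mean_count_nonneg[of K] by (intro power_mono)
      hence 1: "2 ^ CARD('m) * \<delta> * (mean_count K)\<^sup>2 \<le> 2 ^ CARD('m) * \<delta> * (B * P)\<^sup>2"
        using \<delta> by (intro mult_left_mono) auto
      have 2: "2 * corr_const / \<delta> ^ CARD('m) * triple_sum K \<le> 2 * corr_const / \<delta> ^ CARD('m) * (C0 * P)"
        using C0(2)[of K] corr_const_nonneg \<delta> by (intro mult_left_mono) (auto simp: P_def)
      have "1 / P\<^sup>2 * (2 ^ CARD('m) * \<delta> * (mean_count K)\<^sup>2 + 2 * corr_const / \<delta> ^ CARD('m) * triple_sum K)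
          \<le> 1 / P\<^sup>2 * (2 ^ CARD('m) * \<delta> * (B * P)\<^sup>2 + 2 * corr_const / \<delta> ^ CARD('m) * (C0 * P))"
        by (rule mult_left_mono[OF add_mono[OF 1 2]]) simp
      also have "\<dots> = 2 ^ CARD('m) * B\<^sup>2 * \<delta> + 2 * corr_const * C0 * (1 / (\<delta> ^ CARD('m) * P))"
        using P \<delta> by (simp add: field_simps power2_eq_square)
      also have "1 / (\<delta> ^ CARD('m) * P) \<le> 1 / ?j ^ 2"
      proof -
        have "?j ^ 2 = \<delta> ^ CARD('m) * ?j ^ (2 * CARD('m) + 2)"
        proof -
          have "\<delta> ^ CARD('m) = 1 / ?j ^ (2 * CARD('m))"
            unfolding \<delta>_def by (simp only: power_divide power_one power_mult)
          moreover have "?j ^ (2 * CARD('m)) \<noteq> 0" by simp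
          ultimately show ?thesis by (simp only: power_add) (simp del: of_nat_Suc)
        qed
        also have "\<dots> \<le> \<delta> ^ CARD('m) * P" using Pj \<delta> by (intro mult_left_mono) auto
        finally show ?thesis by (intro divide_left_mono) (use \<delta> P in auto)
      qed
      hence "2 ^ CARD('m) * B\<^sup>2 * \<delta> + 2 * corr_const * C0 * (1 / (\<delta> ^ CARD('m) * P))
          \<le> 2 ^ CARD('m) * B\<^sup>2 * \<delta> + 2 * corr_const * C0 * (1 / ?j ^ 2)"
        using corr_const_nonneg C0(1) by (intro add_left_mono mult_left_mono) auto
      also have "\<dots> = C / ?j ^ 2" by (simp add: C_def \<delta>_def add_divide_distrib)
      finally show "1 / P\<^sup>2 * (2 ^ CARD('m) * \<delta> * (mean_count K)\<^sup>2 + 2 * corr_const / \<delta> ^ CARD('m) * triple_sum K) \<le> C / ?j ^ 2" .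
    qed
    finally show ?thesis by (simp add: P_def)
  qed
  with C show ?thesis by blast
qed

text \<open>
  The sum over \<open>j\<close> of the squared relative deviations has finite mean. It is therefore finite almost
  everywhere, which forces its terms to tend to \<open>0\<close>.
\<close>

lemma AE_count_checkpoint:
  "AE \<theta> in lborel. (\<lambda>j. count (checkpoint (Suc j)) \<theta> / Psi (checkpoint (Suc j))) \<longlonglongrightarrow> main_const"
proof -
  define D where "D j \<theta> = (count (checkpoint (Suc j)) \<theta> - mean_count (checkpoint (Suc j))) / Psi (checkpoint (Suc j))" for j \<theta>
  define H where "H \<theta> = (\<Sum>j. ennreal ((D j \<theta>)\<^sup>2))" for \<theta>
  have [measurable]: "D j \<in> borel_measurable borel" for j unfolding D_def[abs_def] by measurable
  have H: "H \<in> borel_measurable borel" unfolding H_def[abs_def] by measurable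
  have per: "periodic (real N) H"
    using periodic_count unfolding periodic_def H_def D_def by simp
  obtain C where C: "C \<ge> 0" "\<And>j. (\<integral>\<^sup>+\<theta>. ennreal ((D j \<theta>)\<^sup>2) \<partial>torus (real N)) \<le> ennreal (C / real (Suc j) ^ 2)"
    unfolding D_def using relative_variance_checkpoint by blast
  have sm: "summable (\<lambda>j. C / real (Suc j) ^ 2)"
  proof -
    have "summable (\<lambda>j. inverse (real j ^ 2))" by (rule inverse_power_summable) simp
    hence "summable (\<lambda>j. inverse (real (Suc j) ^ 2))" by (subst summable_Suc_iff)
    from summable_mult[OF this, of C] show ?thesis by (simp add: divide_inverse)
  qed
  have "(\<integral>\<^sup>+\<theta>. H \<theta> \<partial>torus (real N)) = (\<Sum>j. \<integral>\<^sup>+\<theta>. ennreal ((D j \<theta>)\<^sup>2) \<partial>torus (real N))"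
    unfolding H_def by (rule nn_integral_suminf) measurable
  also have "\<dots> \<le> (\<Sum>j. ennreal (C / real (Suc j) ^ 2))"
    by (intro suminf_le C) auto
  also have "\<dots> = ennreal (\<Sum>j. C / real (Suc j) ^ 2)"
    by (rule suminf_ennreal2) (use C sm in auto)
  finally have "(\<integral>\<^sup>+\<theta>. H \<theta> \<partial>torus (real N)) < \<infinity>"
    by (rule le_less_trans) simp
  from AE_finite_if_torus_mean_finite[OF N_pos H per this]
  show ?thesis
  proof (rule eventually_mono)
    fix \<theta> :: "real ^ 'n ^ 'm" assume "H \<theta> < \<infinity>"
    hence "summable (\<lambda>j. (D j \<theta>)\<^sup>2)"
      unfolding H_def by (intro summable_suminf_not_top) auto
    hence "(\<lambda>j. (D j \<theta>)\<^sup>2) \<longlonglongrightarrow> 0" by (rule summable_LIMSEQ_zero)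
    hence "(\<lambda>j. sqrt ((D j \<theta>)\<^sup>2)) \<longlonglongrightarrow> sqrt 0" by (rule tendsto_real_sqrt)
    hence D0: "(\<lambda>j. D j \<theta>) \<longlonglongrightarrow> 0" by (simp add: tendsto_rabs_zero_iff)
    have ck: "filterlim (\<lambda>j. checkpoint (Suc j)) sequentially sequentially"
      unfolding filterlim_at_top
    proof
      fix Z
      obtain j0 where "Psi Z < real j0" using reals_Archimedean2 by blast
      hence "eventually (\<lambda>j. Psi Z < real (Suc j)) sequentially"
        by (intro eventually_sequentiallyI[of j0]) simp
      thus "eventually (\<lambda>j. Z \<le> checkpoint (Suc j)) sequentially"
      proof eventually_elim
        case (elim j)
        have "real (Suc j) \<le> real (Suc j) ^ (2 * CARD('m) + 2)" by (intro self_le_power) auto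
        hence "Psi Z < Psi (checkpoint (Suc j))" using elim Psi_checkpoint[of "Suc j"] by linarith
        thus ?case using Psi_mono by (meson linorder_not_less monoD nle_le)
      qed
    qed
    have "(\<lambda>j. D j \<theta> + mean_count (checkpoint (Suc j)) / Psi (checkpoint (Suc j))) \<longlonglongrightarrow> 0 + main_const"
      by (intro tendsto_add D0 filterlim_compose[OF mean_count_asymp ck])
    thus "(\<lambda>j. count (checkpoint (Suc j)) \<theta> / Psi (checkpoint (Suc j))) \<longlonglongrightarrow> main_const"
      by (simp add: D_def diff_divide_distrib)
  qed
qed

lemma AE_count_asymp: "AE \<theta> in lborel. (\<lambda>K. count K \<theta> / Psi K) \<longlonglongrightarrow> main_const"
  using AE_count_checkpoint
proof (rule eventually_mono)
  fix \<theta> :: "real ^ 'n ^ 'm"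
  assume "(\<lambda>j. count (checkpoint (Suc j)) \<theta> / Psi (checkpoint (Suc j))) \<longlonglongrightarrow> main_const"
  hence lim: "(\<lambda>j. count (LEAST K. real (Suc j) ^ (2 * CARD('m) + 2) \<le> Psi K) \<theta>
      / Psi (LEAST K. real (Suc j) ^ (2 * CARD('m) + 2) \<le> Psi K)) \<longlonglongrightarrow> main_const"
    by (simp only: checkpoint_def)
  show "(\<lambda>K. count K \<theta> / Psi K) \<longlonglongrightarrow> main_const"
  proof (rule tendsto_along_powers[OF count_nonneg _ Psi_simps(1) Psi_mono _ Psi_at_top _ lim])
    show "mono (\<lambda>K. count K \<theta>)" by (intro monoI count_mono)
    show "Psi (Suc K) \<le> Psi K + \<psi> 1" for K using \<psi>_antimono[of 1 "real (Suc K)"] by simp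
  qed simp
qed

text \<open>
  A real \<open>T\<close> lies in \<open>(K, K + 1]\<close> for \<open>K = \<lceil>T\<rceil> - 1\<close>; the sum in the main term is then \<open>Psi K\<close>, and the count is
  trapped between its values at \<open>K\<close> and \<open>K + 1\<close>.
\<close>

lemma solution_count_asymp:
  assumes lim: "(\<lambda>K. count K \<theta> / Psi K) \<longlonglongrightarrow> main_const"
  shows "(\<lambda>T. real (solution_count \<nu>\<^sub>1 \<nu>\<^sub>2 \<psi> v N \<theta> T)) \<sim>[at_top]
    (\<lambda>T. main_const * (\<Sum>t | 1 \<le> t \<and> real t < T. \<psi> (real t)))"
proof -
  define k where "k T = nat (\<lceil>T\<rceil> - 1)" for T :: real
  have k: "real (k T) < T" "T \<le> real (Suc (k T))" if "T > 1" for T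
    using that unfolding k_def by linarith+
  have set: "{t. 1 \<le> t \<and> real t < T} = {1..k T}" if "T > 1" for T
    using k[OF that] by (auto simp: k_def) linarith+
  have sum: "(\<Sum>t | 1 \<le> t \<and> real t < T. \<psi> (real t)) = Psi (k T)" if "T > 1" for T
    unfolding set[OF that] Psi_def ..
  have sc: "count (k T) \<theta> \<le> real (solution_count \<nu>\<^sub>1 \<nu>\<^sub>2 \<psi> v N \<theta> T)"
      "real (solution_count \<nu>\<^sub>1 \<nu>\<^sub>2 \<psi> v N \<theta> T) \<le> count (Suc (k T)) \<theta>" if "T > 1" for T
    using k[OF that] unfolding solution_count_eq count_def of_nat_sum
    by (intro sum_mono2 finite_denominators denominators_mono; simp)+
  have ktop: "filterlim k sequentially at_top"
    unfolding filterlim_at_top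
  proof
    fix Z :: nat
    have "eventually (\<lambda>T. real Z + 1 \<le> T) at_top" by (rule eventually_ge_at_top)
    thus "eventually (\<lambda>T. Z \<le> k T) at_top"
      by eventually_elim (unfold k_def, linarith)
  qed
  have ratio: "(\<lambda>K. Psi (Suc K) / Psi K) \<longlonglongrightarrow> 1"
  proof (rule tendsto_sandwich[where f="\<lambda>_. 1" and h="\<lambda>K. 1 + \<psi> 1 / Psi K"])
    show "eventually (\<lambda>K. 1 \<le> Psi (Suc K) / Psi K) sequentially"
      using eventually_ge_at_top[of 1]
    proof eventually_elim
      case (elim K)
      show ?case using Psi_pos[OF elim] monoD[OF Psi_mono, of K "Suc K"] by (simp del: Psi_simps)
    qed
    show "eventually (\<lambda>K. Psi (Suc K) / Psi K \<le> 1 + \<psi> 1 / Psi K) sequentially"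
      using eventually_ge_at_top[of 1]
    proof eventually_elim
      case (elim K)
      show ?case using Psi_pos[OF elim] \<psi>_antimono[of 1 "real (Suc K)"] by (simp add: add_divide_distrib divide_right_mono)
    qed
    have "(\<lambda>K. \<psi> 1 / Psi K) \<longlonglongrightarrow> 0"
      by (intro tendsto_divide_0[OF tendsto_const] filterlim_at_top_imp_at_infinity Psi_at_top)
    from tendsto_add[OF tendsto_const this, of 1] show "(\<lambda>K. 1 + \<psi> 1 / Psi K) \<longlonglongrightarrow> 1" by simp
  qed simp
  have up: "(\<lambda>K. count (Suc K) \<theta> / Psi K) \<longlonglongrightarrow> main_const"
  proof -
    have "(\<lambda>K. count (Suc K) \<theta> / Psi (Suc K) * (Psi (Suc K) / Psi K)) \<longlonglongrightarrow> main_const * 1"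
      by (intro tendsto_mult ratio LIMSEQ_Suc[OF lim])
    moreover have "Psi (Suc K) \<noteq> 0" for K using Psi_pos[of "Suc K"] by simp
    ultimately show ?thesis by (simp del: Psi_simps)
  qed
  have "((\<lambda>T. real (solution_count \<nu>\<^sub>1 \<nu>\<^sub>2 \<psi> v N \<theta> T) / Psi (k T)) \<longlongrightarrow> main_const) at_top"
  proof (rule tendsto_sandwich)
    show "((\<lambda>T. count (k T) \<theta> / Psi (k T)) \<longlongrightarrow> main_const) at_top" by (rule filterlim_compose[OF lim ktop])
    show "((\<lambda>T. count (Suc (k T)) \<theta> / Psi (k T)) \<longlongrightarrow> main_const) at_top" by (rule filterlim_compose[OF up ktop])
    show "eventually (\<lambda>T. count (k T) \<theta> / Psi (k T) \<le> real (solution_count \<nu>\<^sub>1 \<nu>\<^sub>2 \<psi> v N \<theta> T) / Psi (k T)) at_top"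
      using eventually_gt_at_top[of 1] by eventually_elim (intro divide_right_mono sc Psi_nonneg)
    show "eventually (\<lambda>T. real (solution_count \<nu>\<^sub>1 \<nu>\<^sub>2 \<psi> v N \<theta> T) / Psi (k T) \<le> count (Suc (k T)) \<theta> / Psi (k T)) at_top"
      using eventually_gt_at_top[of 1] by eventually_elim (intro divide_right_mono sc Psi_nonneg)
  qed
  from tendsto_divide[OF this tendsto_const[of main_const]]
  have "((\<lambda>T. real (solution_count \<nu>\<^sub>1 \<nu>\<^sub>2 \<psi> v N \<theta> T) / Psi (k T) / main_const) \<longlongrightarrow> 1) at_top"
    using main_const_pos by simp
  hence "((\<lambda>T. real (solution_count \<nu>\<^sub>1 \<nu>\<^sub>2 \<psi> v N \<theta> T) / (main_const * (\<Sum>t | 1 \<le> t \<and> real t < T. \<psi> (real t)))) \<longlongrightarrow> 1) at_top"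
  proof (rule Lim_transform_eventually)
    show "eventually (\<lambda>T. real (solution_count \<nu>\<^sub>1 \<nu>\<^sub>2 \<psi> v N \<theta> T) / Psi (k T) / main_const
        = real (solution_count \<nu>\<^sub>1 \<nu>\<^sub>2 \<psi> v N \<theta> T) / (main_const * (\<Sum>t | 1 \<le> t \<and> real t < T. \<psi> (real t)))) at_top"
      using eventually_gt_at_top[of 1]
    proof eventually_elim
      case (elim T)
      show ?case unfolding sum[OF elim] by (simp add: mult.commute)
    qed
  qed
  thus ?thesis by (rule asymp_equivI')
qed

end

theorem theorem1p1:
  fixes d :: nat
    and \<psi> :: "real \<Rightarrow> real"
    and v :: "int ^ ('m::finite + 'n::finite)"
    and N :: nat
    and \<nu>\<^sub>1 :: "real ^ 'm \<Rightarrow> real"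
    and \<nu>\<^sub>2 :: "real ^ 'n \<Rightarrow> real"
  assumes "d = CARD('m) + CARD('n)" and "d \<ge> 3"
    and "\<And>t. t \<ge> 1 \<Longrightarrow> \<psi> t > 0"
    and "continuous_on {1..} \<psi>"
    and "antimono_on {1..} \<psi>"
    and "filterlim (\<lambda>k::nat. \<Sum>t=1..k. \<psi> (real t)) at_top sequentially"
    and "N \<ge> 1"
    and "is_norm \<nu>\<^sub>1" and "is_norm \<nu>\<^sub>2"
    and "\<exists>w :: int ^ 'n. w \<noteq> 0 \<and> \<nu>\<^sub>2 (real_vec w) = 1"
    and "\<forall>w :: int ^ 'n. w \<noteq> 0 \<longrightarrow> \<nu>\<^sub>2 (real_vec w) \<ge> 1"
  shows "AE \<theta> in (lebesgue :: (real ^ 'n ^ 'm) measure).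
    (\<lambda>T. real (solution_count \<nu>\<^sub>1 \<nu>\<^sub>2 \<psi> v N \<theta> T))
      \<sim>[at_top]
    (\<lambda>T. unit_ball_volume \<nu>\<^sub>1 * unit_ball_volume \<nu>\<^sub>2 / real N ^ d
       * (\<Sum>t | 1 \<le> t \<and> real t < T. \<psi> (real t)))"
proof -
  interpret approximation \<psi> v N \<nu>\<^sub>1 \<nu>\<^sub>2
  proof
    show "\<psi> t \<le> \<psi> s" if "1 \<le> s" "s \<le> t" for s t
      using assms(5) that by (auto simp: monotone_on_def)
  qed (use assms in auto)
  have "AE \<theta> in lebesgue. (\<lambda>K. count K \<theta> / Psi K) \<longlonglongrightarrow> main_const"
    by (rule AE_completion[OF AE_count_asymp])
  thus ?thesis
    by (rule eventually_mono) (use solution_count_asymp in \<open>simp add: main_const_def assms(1)\<close>)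
qed

end
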